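(* Let $G$ be a semisimple Lie group and $P\subset G$ a parabolic subgroup. Let $W$ and $W'$ be representations of $P$, $\Phi:W\to W'$ a $P$-equivariant (linear) mapping, and let us also denote by $\Phi$ the induced natural bundle map. Denoting by $\mathcal C_W$ and $\mathcal C_{W'}$ the curved Casimir operators on the natural bundles induced by $W$ and $W'$, we get $\mathcal C_{W'}(\Phi(\sigma))=\Phi(\mathcal C_W(\sigma))$ for any parabolic geometry $(p:\mathcal G\to M,\omega)$ of type $(G,P)$ and any $\sigma\in\Gamma(WM)$. In particular, the curved Casimir preserves sections of natural subbundles (those induced by $P$-invariant subspaces) and restricts to the curved Casimir of the subbundle on such sections. Likewise, the induced operator on sections of a natural quotient bundle coincides with the curved Casimir on that bundle.
   Context: $\mathfrak g$ is the Lie algebra of $G$, $\mathfrak p$ that of $P$, $B$ the Killing form of $\mathfrak g$. Representations of $P$ are finite dimensional. A parabolic geometry $(p:\mathcal G\to M,\omega)$ of type $(G,P)$ is a principal $P$-bundle over a smooth manifold $M$ with $\dim M=\dim G/P$, together with a Cartan connection $\omega\in\Omega^1(\mathcal G,\mathfrak g)$ (each $\omega_u:T_u\mathcal G\to\mathfrak g$ is a linear isomorphism, $(r^h)^*\omega=\mathrm{Ad}(h^{-1})\circ\omega$ for $h\in P$, and $\omega$ reproduces the generators of fundamental vector fields). The natural bundle induced by a representation $W$ of $P$ is $WM=\mathcal G\times_PW$, with $\Gamma(WM)\cong C^\infty(\mathcal G,W)^P$ ($P$-equivariant functions). The adjoint tractor bundle is $\mathcal AM=\mathcal G\times_P\mathfrak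 g$, with dual $\mathcal A^*M$. Fundamental derivative: via $\omega$, sections $s\in\Gamma(\mathcal AM)$ correspond to $P$-invariant vector fields on $\mathcal G$; $D_s\sigma$ is obtained by differentiating the equivariant function of $\sigma\in\Gamma(WM)$ along this vector field. So $D\sigma\in\Gamma(\mathcal A^*M\otimes WM)$, and iterating, $D^2\sigma\in\Gamma(\otimes^2\mathcal A^*M\otimes WM)$. The Killing form induces a non-degenerate bundle metric on $\mathcal AM$, and hence a tensorial map $B:\otimes^2\mathcal A^*M\to M\times\mathbb R$ (contraction with the inverse metric). The curved Casimir operator on $\Gamma(WM)$ is $\mathcal C=(B\otimes\mathrm{id}_W)\circ D^2$. *)

theory Defs
  imports "HOL-Analysis.Analysis" "HOL-Algebra.Group"
begin

section \<open>Finite-dimensional linear algebra\<close>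

text \<open>
  Model spaces and modules live in types of class \<open>real_normed_vector\<close>; finite dimension is an
  explicit hypothesis.  Unlike \<open>euclidean_space\<close> this allows dimension 0 (needed for \<open>P = G\<close>).
  The norm carries no information, since all norms on a finite-dimensional space are equivalent.
\<close>

definition finite_dim :: "'v::real_vector set \<Rightarrow> bool" where
  "finite_dim S \<longleftrightarrow> (\<exists>B. finite B \<and> S \<subseteq> span B)"

definition linear_on :: "'v::real_vector set \<Rightarrow> ('v \<Rightarrow> 'w::real_vector) \<Rightarrow> bool" where
  "linear_on S f \<longleftrightarrow>
     (\<forall>x\<in>S. \<forall>y\<in>S. f (x + y) = f x + f y) \<and> (\<forall>c. \<forall>x\<in>S. f (c *\<^sub>R x) = c *\<^sub>R f x)"

definition some_basis :: "'v::real_vector set" where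
  "some_basis = (SOME b. independent b \<and> span b = UNIV)"

definition trace_end :: "('v::real_vector \<Rightarrow> 'v) \<Rightarrow> real" where
  "trace_end f = (\<Sum>x\<in>some_basis. representation some_basis (f x) x)"

definition nondegenerate :: "('v::real_vector \<Rightarrow> 'v \<Rightarrow> real) \<Rightarrow> bool" where
  "nondegenerate b \<longleftrightarrow> (\<forall>x. (\<forall>y. b x y = 0) \<longrightarrow> x = 0)"

text \<open>The element of the \<open>b\<close>-dual basis of \<open>S\<close> that belongs to \<open>x \<in> S\<close>.\<close>

definition dual_vec :: "('v::real_vector \<Rightarrow> 'v \<Rightarrow> real) \<Rightarrow> 'v set \<Rightarrow> 'v \<Rightarrow> 'v" where
  "dual_vec b S x = (THE y. \<forall>z\<in>S. b z y = (if z = x then 1 else 0))"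

text \<open>
  Contraction of a \<open>W\<close>-valued bilinear form with the inverse of the metric \<open>b\<close>.  There is no
  inverse metric for degenerate \<open>b\<close>; the value is then set to 0, a case that does not
  occur for the Killing form of a semisimple Lie algebra.
\<close>

definition metric_contraction ::
    "('v::real_normed_vector \<Rightarrow> 'v \<Rightarrow> real) \<Rightarrow> ('v \<Rightarrow>\<^sub>L ('v \<Rightarrow>\<^sub>L 'w::real_normed_vector)) \<Rightarrow> 'w" where
  "metric_contraction b T =
     (if nondegenerate b
      then (\<Sum>x\<in>some_basis. blinfun_apply (blinfun_apply T x) (dual_vec b some_basis x))
      else 0)"


section \<open>Smooth manifolds\<close>

text \<open>\<open>Ck_on n S f\<close>: \<open>f\<close> is of class \<open>C\<^sup>n\<close> on the open subset \<open>S\<close> of a finite-dimensional space.\<close>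

primrec Ck_on ::
    "nat \<Rightarrow> 'e::real_normed_vector set \<Rightarrow> ('e \<Rightarrow> 'f::real_normed_vector) \<Rightarrow> bool" where
  "Ck_on 0 S f \<longleftrightarrow> continuous_on S f"
| "Ck_on (Suc n) S f \<longleftrightarrow>
     (\<forall>x\<in>S. f differentiable (at x)) \<and>
     (\<forall>v. Ck_on n S (\<lambda>x. frechet_derivative f (at x) v))"

definition smooth_on :: "'e::real_normed_vector set \<Rightarrow> ('e \<Rightarrow> 'f::real_normed_vector) \<Rightarrow> bool" where
  "smooth_on S f \<longleftrightarrow> (\<forall>n. Ck_on n S f)"

text \<open>A chart is a pair of its domain and its coordinate map.\<close>

record ('m, 'e) mfd =
  mtop :: "'m topology"
  atlas :: "('m set \<times> ('m \<Rightarrow> 'e)) set"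

abbreviation pts :: "('m, 'e) mfd \<Rightarrow> 'm set" where
  "pts M \<equiv> topspace (mtop M)"

definition smooth_manifold :: "('m, 'e::real_normed_vector) mfd \<Rightarrow> bool" where
  "smooth_manifold M \<longleftrightarrow>
     finite_dim (UNIV :: 'e set) \<and>
     Hausdorff_space (mtop M) \<and> second_countable (mtop M) \<and>
     pts M = \<Union> (fst ` atlas M) \<and>
     (\<forall>(U, \<phi>) \<in> atlas M. openin (mtop M) U \<and> open (\<phi> ` U) \<and>
        homeomorphic_map (subtopology (mtop M) U) (top_of_set (\<phi> ` U)) \<phi>) \<and>
     (\<forall>(U, \<phi>) \<in> atlas M. \<forall>(V, \<psi>) \<in> atlas M.
        smooth_on (\<phi> ` (U \<inter> V)) (\<psi> \<circ> inv_into U \<phi>))"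

definition smooth_map ::
    "('m, 'e::real_normed_vector) mfd \<Rightarrow> ('n, 'f::real_normed_vector) mfd \<Rightarrow> ('m \<Rightarrow> 'n) \<Rightarrow> bool" where
  "smooth_map M N f \<longleftrightarrow>
     continuous_map (mtop M) (mtop N) f \<and>
     (\<forall>(U, \<phi>) \<in> atlas M. \<forall>(V, \<psi>) \<in> atlas N.
        smooth_on (\<phi> ` (U \<inter> f -` V)) (\<psi> \<circ> f \<circ> inv_into U \<phi>))"

definition diffeo ::
    "('m, 'e::real_normed_vector) mfd \<Rightarrow> ('n, 'f::real_normed_vector) mfd \<Rightarrow> ('m \<Rightarrow> 'n) \<Rightarrow> bool" where
  "diffeo M N f \<longleftrightarrow> smooth_map M N f \<and>
     (\<exists>g. smooth_map N M g \<and> (\<forall>x\<in>pts M. g (f x) = x) \<and> (\<forall>y\<in>pts N. f (g y) = y))"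

definition vec_mfd :: "('e::real_normed_vector, 'e) mfd" where
  "vec_mfd = \<lparr>mtop = euclidean, atlas = {(UNIV, \<lambda>x. x)}\<rparr>"

definition prod_mfd :: "('m, 'e) mfd \<Rightarrow> ('n, 'f) mfd \<Rightarrow> ('m \<times> 'n, 'e \<times> 'f) mfd" where
  "prod_mfd M N =
     \<lparr>mtop = prod_topology (mtop M) (mtop N),
      atlas = {(U \<times> V, map_prod \<phi> \<psi>) | U \<phi> V \<psi>. (U, \<phi>) \<in> atlas M \<and> (V, \<psi>) \<in> atlas N}\<rparr>"

definition open_submfd :: "('m, 'e) mfd \<Rightarrow> 'm set \<Rightarrow> ('m, 'e) mfd" where
  "open_submfd M S =
     \<lparr>mtop = subtopology (mtop M) S, atlas = {(U \<inter> S, \<phi>) | U \<phi>. (U, \<phi>) \<in> atlas M}\<rparr>"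

text \<open>
  Every point has a preferred chart, and the tangent space \<open>T\<^sub>xM\<close> is the model space \<open>'e\<close>: a vector
  \<open>v\<close> stands for the tangent vector with coordinates \<open>v\<close> in the preferred chart at \<open>x\<close>.
  \<open>tangent_map M N f x\<close> is then the derivative \<open>T\<^sub>xM \<Rightarrow> T\<^bsub>f x\<^esub>N\<close>, and a vector field is a map \<open>'m \<Rightarrow> 'e\<close>
  (not its expression in one fixed chart).
\<close>

definition chart_at :: "('m, 'e) mfd \<Rightarrow> 'm \<Rightarrow> 'm set \<times> ('m \<Rightarrow> 'e)" where
  "chart_at M x = (SOME c. c \<in> atlas M \<and> x \<in> fst c)"

definition tangent_map ::
    "('m, 'e::real_normed_vector) mfd \<Rightarrow> ('n, 'f::real_normed_vector) mfd \<Rightarrow>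
     ('m \<Rightarrow> 'n) \<Rightarrow> 'm \<Rightarrow> 'e \<Rightarrow> 'f" where
  "tangent_map M N f x =
     (let (U, \<phi>) = chart_at M x; (V, \<psi>) = chart_at N (f x)
      in frechet_derivative (\<psi> \<circ> f \<circ> inv_into U \<phi>) (at (\<phi> x)))"

text \<open>\<open>local_rep M (U, \<phi>) Z\<close> is the expression of the vector field \<open>Z\<close> in the chart \<open>(U, \<phi>)\<close>.\<close>

definition local_rep ::
    "('m, 'e::real_normed_vector) mfd \<Rightarrow> 'm set \<times> ('m \<Rightarrow> 'e) \<Rightarrow> ('m \<Rightarrow> 'e) \<Rightarrow> 'e \<Rightarrow> 'e" where
  "local_rep M c Z y =
     (let x = inv_into (fst c) (snd c) y in tangent_map M vec_mfd (snd c) x (Z x))"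

definition vf_bracket ::
    "('m, 'e::real_normed_vector) mfd \<Rightarrow> ('m \<Rightarrow> 'e) \<Rightarrow> ('m \<Rightarrow> 'e) \<Rightarrow> 'm \<Rightarrow> 'e" where
  "vf_bracket M Y Z x =
     (let c = chart_at M x; Y' = local_rep M c Y; Z' = local_rep M c Z; y = snd c x
      in frechet_derivative Z' (at y) (Y' y) - frechet_derivative Y' (at y) (Z' y))"

text \<open>
  A form \<open>\<omega> x : T\<^sub>xM \<Rightarrow> 'v\<close> is smooth if its values on the coordinate vector fields of each chart are.
\<close>

definition smooth_form ::
    "('m, 'e::real_normed_vector) mfd \<Rightarrow> ('m \<Rightarrow> 'e \<Rightarrow> 'v::real_normed_vector) \<Rightarrow> bool" where
  "smooth_form M \<omega> \<longleftrightarrow>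
     (\<forall>(U, \<phi>) \<in> atlas M. \<forall>v.
        smooth_on (\<phi> ` U) (\<lambda>y. \<omega> (inv_into U \<phi> y) (tangent_map vec_mfd M (inv_into U \<phi>) y v)))"


section \<open>Lie algebras\<close>

definition lie_subalgebra :: "('v::real_vector \<Rightarrow> 'v \<Rightarrow> 'v) \<Rightarrow> 'v set \<Rightarrow> bool" where
  "lie_subalgebra br S \<longleftrightarrow> subspace S \<and> (\<forall>x\<in>S. \<forall>y\<in>S. br x y \<in> S)"

definition lie_ideal :: "('v::real_vector \<Rightarrow> 'v \<Rightarrow> 'v) \<Rightarrow> 'v set \<Rightarrow> bool" where
  "lie_ideal br I \<longleftrightarrow> subspace I \<and> (\<forall>x. \<forall>y\<in>I. br x y \<in> I)"

definition derived_algebra :: "('v::real_vector \<Rightarrow> 'v \<Rightarrow> 'v) \<Rightarrow> 'v set \<Rightarrow> 'v set" where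
  "derived_algebra br S = span {br x y | x y. x \<in> S \<and> y \<in> S}"

definition solvable_algebra :: "('v::real_vector \<Rightarrow> 'v \<Rightarrow> 'v) \<Rightarrow> 'v set \<Rightarrow> bool" where
  "solvable_algebra br S \<longleftrightarrow> (\<exists>n. (derived_algebra br ^^ n) S = {0})"

definition semisimple_algebra :: "('v::real_vector \<Rightarrow> 'v \<Rightarrow> 'v) \<Rightarrow> bool" where
  "semisimple_algebra br \<longleftrightarrow> (\<forall>I. lie_ideal br I \<and> solvable_algebra br I \<longrightarrow> I = {0})"

text \<open>The complexification, with \<open>(a, b)\<close> for \<open>a + i b\<close>.\<close>

definition complex_bracket :: "('v::real_vector \<Rightarrow> 'v \<Rightarrow> 'v) \<Rightarrow> 'v \<times> 'v \<Rightarrow> 'v \<times> 'v \<Rightarrow> 'v \<times> 'v" where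
  "complex_bracket br x y =
     (br (fst x) (fst y) - br (snd x) (snd y), br (fst x) (snd y) + br (snd x) (fst y))"

definition complex_subalgebra :: "('v::real_vector \<Rightarrow> 'v \<Rightarrow> 'v) \<Rightarrow> ('v \<times> 'v) set \<Rightarrow> bool" where
  "complex_subalgebra br S \<longleftrightarrow>
     lie_subalgebra (complex_bracket br) S \<and> (\<forall>(a, b) \<in> S. (- b, a) \<in> S)"

definition borel_subalgebra :: "('v::real_vector \<Rightarrow> 'v \<Rightarrow> 'v) \<Rightarrow> ('v \<times> 'v) set \<Rightarrow> bool" where
  "borel_subalgebra br b \<longleftrightarrow>
     complex_subalgebra br b \<and> solvable_algebra (complex_bracket br) b \<and>
     (\<forall>c. complex_subalgebra br c \<and> solvable_algebra (complex_bracket br) c \<and> b \<subseteq> c \<longrightarrow> c = b)"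

text \<open>A real subalgebra is parabolic if its complexification contains a Borel subalgebra.\<close>

definition parabolic_subalgebra :: "('v::real_vector \<Rightarrow> 'v \<Rightarrow> 'v) \<Rightarrow> 'v set \<Rightarrow> bool" where
  "parabolic_subalgebra br p \<longleftrightarrow>
     lie_subalgebra br p \<and> (\<exists>b. borel_subalgebra br b \<and> b \<subseteq> p \<times> p)"


section \<open>Lie groups\<close>

record ('a, 'g) lgroup =
  grp :: "'a monoid"
  gmfd :: "('a, 'g) mfd"

abbreviation gcarrier :: "('a, 'g) lgroup \<Rightarrow> 'a set" where
  "gcarrier G \<equiv> carrier (grp G)"
abbreviation gmult :: "('a, 'g) lgroup \<Rightarrow> 'a \<Rightarrow> 'a \<Rightarrow> 'a" where
  "gmult G \<equiv> monoid.mult (grp G)"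
abbreviation gone :: "('a, 'g) lgroup \<Rightarrow> 'a" where
  "gone G \<equiv> monoid.one (grp G)"
abbreviation ginv :: "('a, 'g) lgroup \<Rightarrow> 'a \<Rightarrow> 'a" where
  "ginv G \<equiv> m_inv (grp G)"

definition lie_group :: "('a, 'g::real_normed_vector) lgroup \<Rightarrow> bool" where
  "lie_group G \<longleftrightarrow>
     group (grp G) \<and> smooth_manifold (gmfd G) \<and> pts (gmfd G) = gcarrier G \<and>
     smooth_map (prod_mfd (gmfd G) (gmfd G)) (gmfd G) (\<lambda>(x, y). gmult G x y) \<and>
     smooth_map (gmfd G) (gmfd G) (ginv G)"

text \<open>The Lie algebra is the tangent space \<open>'g\<close> at the identity, with the bracket of
  left-invariant vector fields.\<close>

definition left_inv_field :: "('a, 'g::real_normed_vector) lgroup \<Rightarrow> 'g \<Rightarrow> 'a \<Rightarrow> 'g" where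
  "left_inv_field G A x = tangent_map (gmfd G) (gmfd G) (gmult G x) (gone G) A"

definition lie_bracket :: "('a, 'g::real_normed_vector) lgroup \<Rightarrow> 'g \<Rightarrow> 'g \<Rightarrow> 'g" where
  "lie_bracket G A B = vf_bracket (gmfd G) (left_inv_field G A) (left_inv_field G B) (gone G)"

definition Ad :: "('a, 'g::real_normed_vector) lgroup \<Rightarrow> 'a \<Rightarrow> 'g \<Rightarrow> 'g" where
  "Ad G h = tangent_map (gmfd G) (gmfd G) (\<lambda>x. gmult G (gmult G h x) (ginv G h)) (gone G)"

definition killing_form :: "('a, 'g::real_normed_vector) lgroup \<Rightarrow> 'g \<Rightarrow> 'g \<Rightarrow> real" where
  "killing_form G A B = trace_end (\<lambda>C. lie_bracket G A (lie_bracket G B C))"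

definition semisimple_lie_group :: "('a, 'g::real_normed_vector) lgroup \<Rightarrow> bool" where
  "semisimple_lie_group G \<longleftrightarrow> lie_group G \<and> semisimple_algebra (lie_bracket G)"

text \<open>
  The Lie algebra of the subgroup \<open>P\<close> is the type \<open>'p\<close>, which has to be mapped into \<open>'g\<close> by the
  derivative of the inclusion.
\<close>

definition sub_incl ::
    "('a, 'g::real_normed_vector) lgroup \<Rightarrow> ('a, 'p::real_normed_vector) lgroup \<Rightarrow> 'p \<Rightarrow> 'g" where
  "sub_incl G P = tangent_map (gmfd P) (gmfd G) (\<lambda>x. x) (gone P)"

definition lie_subgroup ::
    "('a, 'g::real_normed_vector) lgroup \<Rightarrow> ('a, 'p::real_normed_vector) lgroup \<Rightarrow> bool" where
  "lie_subgroup G P \<longleftrightarrow>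
     lie_group P \<and> subgroup (gcarrier P) (grp G) \<and> grp P = (grp G)\<lparr>carrier := gcarrier P\<rparr> \<and>
     closedin (mtop (gmfd G)) (gcarrier P) \<and>
     mtop (gmfd P) = subtopology (mtop (gmfd G)) (gcarrier P) \<and>
     smooth_map (gmfd P) (gmfd G) (\<lambda>x. x) \<and>
     (\<forall>x\<in>gcarrier P. inj (tangent_map (gmfd P) (gmfd G) (\<lambda>x. x) x))"

text \<open>
  A closed subgroup with parabolic Lie algebra \<open>p\<close> automatically lies between the normalizer of
  \<open>p\<close> in \<open>G\<close> and the identity component of that normalizer.
\<close>

definition parabolic_subgroup ::
    "('a, 'g::real_normed_vector) lgroup \<Rightarrow> ('a, 'p::real_normed_vector) lgroup \<Rightarrow> bool" where
  "parabolic_subgroup G P \<longleftrightarrow>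
     lie_subgroup G P \<and> parabolic_subalgebra (lie_bracket G) (range (sub_incl G P))"


section \<open>Representations\<close>

record ('a, 'w) rep =
  rspace :: "'w set"
  ract :: "'a \<Rightarrow> 'w \<Rightarrow> 'w"

definition representation_of ::
    "('a, 'p::real_normed_vector) lgroup \<Rightarrow> ('a, 'w::real_normed_vector) rep \<Rightarrow> bool" where
  "representation_of P W \<longleftrightarrow>
     subspace (rspace W) \<and> finite_dim (rspace W) \<and>
     (\<forall>h\<in>gcarrier P. linear_on (rspace W) (ract W h) \<and> ract W h ` rspace W \<subseteq> rspace W) \<and>
     (\<forall>w\<in>rspace W. ract W (gone P) w = w) \<and>
     (\<forall>h\<in>gcarrier P. \<forall>k\<in>gcarrier P. \<forall>w\<in>rspace W.
        ract W (gmult P h k) w = ract W h (ract W k w)) \<and>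
     (\<forall>w\<in>rspace W. smooth_map (gmfd P) vec_mfd (\<lambda>h. ract W h w))"

definition equivariant_linear ::
    "('a, 'p) lgroup \<Rightarrow> ('a, 'w::real_vector) rep \<Rightarrow> ('a, 'v::real_vector) rep \<Rightarrow> ('w \<Rightarrow> 'v) \<Rightarrow> bool" where
  "equivariant_linear P W V \<Phi> \<longleftrightarrow>
     linear_on (rspace W) \<Phi> \<and> \<Phi> ` rspace W \<subseteq> rspace V \<and>
     (\<forall>h\<in>gcarrier P. \<forall>w\<in>rspace W. \<Phi> (ract W h w) = ract V h (\<Phi> w))"

definition invariant_subspace ::
    "('a, 'p) lgroup \<Rightarrow> ('a, 'w::real_vector) rep \<Rightarrow> 'w set \<Rightarrow> bool" where
  "invariant_subspace P W V \<longleftrightarrow>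
     subspace V \<and> V \<subseteq> rspace W \<and> (\<forall>h\<in>gcarrier P. ract W h ` V \<subseteq> V)"

definition subrep :: "('a, 'w) rep \<Rightarrow> 'w set \<Rightarrow> ('a, 'w) rep" where
  "subrep W V = W\<lparr>rspace := V\<rparr>"

text \<open>Cosets do not form a normed space type, so the quotient of \<open>W\<close> by \<open>V\<close> is any representation
  \<open>Q\<close> with an equivariant surjection \<open>q\<close> with kernel \<open>V\<close>.\<close>

definition quotient_rep ::
    "('a, 'p::real_normed_vector) lgroup \<Rightarrow> ('a, 'w::real_normed_vector) rep \<Rightarrow> 'w set \<Rightarrow>
     ('a, 'q::real_normed_vector) rep \<Rightarrow> ('w \<Rightarrow> 'q) \<Rightarrow> bool" where
  "quotient_rep P W V Q q \<longleftrightarrow>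
     representation_of P Q \<and> equivariant_linear P W Q q \<and>
     q ` rspace W = rspace Q \<and> {w \<in> rspace W. q w = 0} = V"

text \<open>The representation on linear maps from the Lie algebra of \<open>G\<close> to \<open>W\<close>; it induces the
  tensor product of the dual adjoint tractor bundle with the bundle induced by \<open>W\<close>.\<close>

definition hom_rep ::
    "('a, 'g::real_normed_vector) lgroup \<Rightarrow> ('a, 'w::real_normed_vector) rep \<Rightarrow>
     ('a, 'g \<Rightarrow>\<^sub>L 'w) rep" where
  "hom_rep G W =
     \<lparr>rspace = {T. range (blinfun_apply T) \<subseteq> rspace W},
      ract = (\<lambda>h T. Blinfun (\<lambda>A. ract W h (blinfun_apply T (Ad G (ginv G h) A))))\<rparr>"


section \<open>Parabolic geometries\<close>

record ('u, 'e, 'm, 'b, 'a, 'g) geometry =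
  total :: "('u, 'e) mfd"
  base :: "('m, 'b) mfd"
  proj :: "'u \<Rightarrow> 'm"
  pact :: "'u \<Rightarrow> 'a \<Rightarrow> 'u"
  cform :: "'u \<Rightarrow> 'e \<Rightarrow> 'g"

definition principal_bundle ::
    "('a, 'p::real_normed_vector) lgroup \<Rightarrow>
     ('u, 'e::real_normed_vector, 'm, 'b::real_normed_vector, 'a, 'g) geometry \<Rightarrow> bool" where
  "principal_bundle P X \<longleftrightarrow>
     smooth_manifold (total X) \<and> smooth_manifold (base X) \<and>
     smooth_map (total X) (base X) (proj X) \<and>
     smooth_map (prod_mfd (total X) (gmfd P)) (total X) (\<lambda>(u, h). pact X u h) \<and>
     (\<forall>u\<in>pts (total X). pact X u (gone P) = u) \<and>
     (\<forall>u\<in>pts (total X). \<forall>h\<in>gcarrier P. \<forall>k\<in>gcarrier P.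
        pact X (pact X u h) k = pact X u (gmult P h k)) \<and>
     (\<forall>u\<in>pts (total X). \<forall>h\<in>gcarrier P. proj X (pact X u h) = proj X u) \<and>
     (\<forall>x\<in>pts (base X). \<exists>U \<tau>. openin (mtop (base X)) U \<and> x \<in> U \<and>
        diffeo (prod_mfd (open_submfd (base X) U) (gmfd P))
          (open_submfd (total X) {u \<in> pts (total X). proj X u \<in> U}) \<tau> \<and>
        (\<forall>y\<in>U. \<forall>h\<in>gcarrier P. proj X (\<tau> (y, h)) = y \<and>
           (\<forall>k\<in>gcarrier P. pact X (\<tau> (y, h)) k = \<tau> (y, gmult P h k))))"

text \<open>
  The fundamental vector field of \<open>A\<close> in the Lie algebra of \<open>P\<close> is, at \<open>u\<close>, the image of \<open>A\<close> under
  the derivative at the identity of the orbit map \<open>h \<mapsto> u h\<close>.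
\<close>

definition cartan_connection ::
    "('a, 'g::real_normed_vector) lgroup \<Rightarrow> ('a, 'p::real_normed_vector) lgroup \<Rightarrow>
     ('u, 'e::real_normed_vector, 'm, 'b, 'a, 'g) geometry \<Rightarrow> bool" where
  "cartan_connection G P X \<longleftrightarrow>
     smooth_form (total X) (cform X) \<and>
     (\<forall>u\<in>pts (total X). linear (cform X u) \<and> bij (cform X u)) \<and>
     (\<forall>u\<in>pts (total X). \<forall>h\<in>gcarrier P. \<forall>\<xi>.
        cform X (pact X u h) (tangent_map (total X) (total X) (\<lambda>v. pact X v h) u \<xi>) =
        Ad G (ginv G h) (cform X u \<xi>)) \<and>
     (\<forall>u\<in>pts (total X). \<forall>A.
        cform X u (tangent_map (gmfd P) (total X) (pact X u) (gone P) A) = sub_incl G P A)"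

definition parabolic_geometry ::
    "('a, 'g::real_normed_vector) lgroup \<Rightarrow> ('a, 'p::real_normed_vector) lgroup \<Rightarrow>
     ('u, 'e::real_normed_vector, 'm, 'b::real_normed_vector, 'a, 'g) geometry \<Rightarrow> bool" where
  "parabolic_geometry G P X \<longleftrightarrow>
     principal_bundle P X \<and> cartan_connection G P X \<and>
     dim (UNIV :: 'b set) + dim (UNIV :: 'p set) = dim (UNIV :: 'g set)"


section \<open>Natural bundles and their sections\<close>

text \<open>The class \<open>[u, w]\<close> in the associated bundle is the orbit \<open>{(u h, h\<^sup>-\<^sup>1 w)}\<close>.\<close>

definition assoc_class ::
    "('a, 'p) lgroup \<Rightarrow> ('u, 'e, 'm, 'b, 'a, 'g) geometry \<Rightarrow> ('a, 'w) rep \<Rightarrow> 'u \<Rightarrow> 'w \<Rightarrow> ('u \<times> 'w) set" where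
  "assoc_class P X W u w = {(pact X u h, ract W (ginv P h) w) | h. h \<in> gcarrier P}"

definition natural_bundle ::
    "('a, 'p) lgroup \<Rightarrow> ('u, 'e, 'm, 'b, 'a, 'g) geometry \<Rightarrow> ('a, 'w) rep \<Rightarrow> ('u \<times> 'w) set set" where
  "natural_bundle P X W = {assoc_class P X W u w | u w. u \<in> pts (total X) \<and> w \<in> rspace W}"

definition bundle_map :: "('w \<Rightarrow> 'v) \<Rightarrow> ('u \<times> 'w) set \<Rightarrow> ('u \<times> 'v) set" where
  "bundle_map \<Phi> c = {(u, \<Phi> w) | u w. (u, w) \<in> c}"

definition equivariant_functions ::
    "('a, 'p) lgroup \<Rightarrow> ('u, 'e::real_normed_vector, 'm, 'b, 'a, 'g) geometry \<Rightarrow>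
     ('a, 'w::real_normed_vector) rep \<Rightarrow> ('u \<Rightarrow> 'w) set" where
  "equivariant_functions P X W =
     {f. smooth_map (total X) vec_mfd f \<and> f ` pts (total X) \<subseteq> rspace W \<and>
         (\<forall>u\<in>pts (total X). \<forall>h\<in>gcarrier P. f (pact X u h) = ract W (ginv P h) (f u))}"

text \<open>
  Smooth sections: those \<open>\<sigma>\<close> given by \<open>\<sigma> (p u) = [u, f u]\<close> with \<open>f\<close> smooth and equivariant.  Values
  outside the base manifold are unconstrained, so sections are compared on the base only.
\<close>

definition sections ::
    "('a, 'p) lgroup \<Rightarrow> ('u, 'e::real_normed_vector, 'm, 'b, 'a, 'g) geometry \<Rightarrow>
     ('a, 'w::real_normed_vector) rep \<Rightarrow> ('m \<Rightarrow> ('u \<times> 'w) set) set" where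
  "sections P X W =
     {\<sigma>. \<exists>f \<in> equivariant_functions P X W.
           \<forall>u\<in>pts (total X). \<sigma> (proj X u) = assoc_class P X W u (f u)}"

definition fun_of_section ::
    "('u, 'e, 'm, 'b, 'a, 'g) geometry \<Rightarrow> ('a, 'w) rep \<Rightarrow> ('m \<Rightarrow> ('u \<times> 'w) set) \<Rightarrow> 'u \<Rightarrow> 'w" where
  "fun_of_section X W \<sigma> u = (THE w. w \<in> rspace W \<and> (u, w) \<in> \<sigma> (proj X u))"

definition section_of_fun ::
    "('a, 'p) lgroup \<Rightarrow> ('u, 'e, 'm, 'b, 'a, 'g) geometry \<Rightarrow> ('a, 'w) rep \<Rightarrow>
     ('u \<Rightarrow> 'w) \<Rightarrow> 'm \<Rightarrow> ('u \<times> 'w) set" where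
  "section_of_fun P X W f x =
     (let u = (SOME u. u \<in> pts (total X) \<and> proj X u = x) in assoc_class P X W u (f u))"


section \<open>The fundamental derivative and the curved Casimir operator\<close>

text \<open>
  The vector field of a section \<open>s\<close> of the adjoint tractor bundle has at \<open>u\<close> the value
  \<open>\<omega>\<^sub>u\<^sup>-\<^sup>1 (s u)\<close>, so the derivative of \<open>f\<close> along it depends on \<open>s u\<close> only; \<open>deriv_fun X f u\<close> is
  the resulting linear map on the Lie algebra.
\<close>

definition deriv_fun ::
    "('u, 'e::real_normed_vector, 'm, 'b, 'a, 'g::real_normed_vector) geometry \<Rightarrow>
     ('u \<Rightarrow> 'w::real_normed_vector) \<Rightarrow> 'u \<Rightarrow> 'g \<Rightarrow>\<^sub>L 'w" where
  "deriv_fun X f u =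
     Blinfun (\<lambda>A. tangent_map (total X) vec_mfd f u (inv_into UNIV (cform X u) A))"

definition fundamental_derivative ::
    "('a, 'g::real_normed_vector) lgroup \<Rightarrow> ('a, 'p) lgroup \<Rightarrow>
     ('u, 'e::real_normed_vector, 'm, 'b, 'a, 'g) geometry \<Rightarrow> ('a, 'w::real_normed_vector) rep \<Rightarrow>
     ('m \<Rightarrow> ('u \<times> 'w) set) \<Rightarrow> 'm \<Rightarrow> ('u \<times> ('g \<Rightarrow>\<^sub>L 'w)) set" where
  "fundamental_derivative G P X W \<sigma> =
     section_of_fun P X (hom_rep G W) (deriv_fun X (fun_of_section X W \<sigma>))"

definition curved_casimir ::
    "('a, 'g::real_normed_vector) lgroup \<Rightarrow> ('a, 'p) lgroup \<Rightarrow>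
     ('u, 'e::real_normed_vector, 'm, 'b, 'a, 'g) geometry \<Rightarrow> ('a, 'w::real_normed_vector) rep \<Rightarrow>
     ('m \<Rightarrow> ('u \<times> 'w) set) \<Rightarrow> 'm \<Rightarrow> ('u \<times> 'w) set" where
  "curved_casimir G P X W \<sigma> x =
     bundle_map (metric_contraction (killing_form G))
       (fundamental_derivative G P X (hom_rep G W) (fundamental_derivative G P X W \<sigma>) x)"

end

theory Submission
  imports Defs
begin

text \<open>
  A section \<open>\<sigma>\<close> of the bundle induced by \<open>W\<close> is the same as an equivariant function \<open>f\<close> on the total
  space, and on equivariant functions everything is explicit: the fundamental derivative is
  \<open>f \<mapsto> deriv_fun X f\<close>, the tangent map of \<open>f\<close> composed with the inverse of the Cartan connection, and
  the curved Casimir operator is the contraction of its square with the inverse of the Killing form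
  (\<open>casimir_fun\<close>, \<open>curved_casimir_from\<close>).  A \<open>P\<close>-equivariant linear map \<open>\<Phi>\<close> of modules acts on functions
  by \<open>f \<mapsto> \<Phi> \<circ> f\<close>.  It commutes with differentiation, because it is linear and does not depend on the point
  (\<open>deriv_fun_map\<close>), and with the contraction, which only involves the two arguments in the Lie algebra
  (\<open>metric_contraction_linear_on\<close>).  This is naturality (\<open>casimir_fun_map\<close>, \<open>curved_casimir_natural\<close>), and
  the statement on quotients is naturality for the projection.

  To translate back to sections, the functions involved must be smooth and equivariant again.  The
  derivative of an equivariant function is equivariant because the Cartan connection is, and smooth
  because the inverse of a smooth family of invertible linear maps is smooth
  (\<open>deriv_fun_equivariant\<close>, \<open>Ck_on_blinfun_inverse\<close>).  The contraction is equivariant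
  (\<open>equivariant_contraction\<close>) because the Killing form is invariant under the adjoint action: \<open>Ad\<close>
  preserves the bracket of left invariant fields (\<open>Ad_lie_bracket\<close>), which comes down to the symmetry of
  second derivatives, and the trace is invariant under conjugation.  Therefore the curved Casimir
  operator maps sections to sections.  A section with values in a natural subbundle has an equivariant
  function with values in the invariant subspace, hence the same function serves over the
  subrepresentation, and there the operator is given by the same formula
  (\<open>curved_casimir_subbundle\<close>).

  Modules are finite-dimensional subspaces of arbitrary normed spaces.  The analysis therefore rests on
  three facts proved first: such subspaces are closed, linear maps on them are bounded, and derivatives of
  functions with values in them stay in them.
\<close>

section \<open>Finite-dimensional subspaces of normed spaces\<close>

lemma finite_dim_spanning:
  assumes "subspace S" "finite_dim S"
  obtains B where "finite B" "independent B" "span B = S"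
proof -
  obtain F where F: "finite F" "S \<subseteq> span F" using assms(2) by (auto simp: finite_dim_def)
  obtain B where B: "B \<subseteq> S" "independent B" "S \<subseteq> span B"
    using maximal_independent_subset[of S] by blast
  have "finite B" using independent_span_bound[OF F(1) B(2)] B(1) F(2) by auto
  moreover have "span B = S"
    using B assms(1) span_minimal[of B S] by auto
  ultimately show ?thesis using that B(2) by blast
qed

text \<open>
  A ball around \<open>a\<close> misses the closed subspace, and scaling turns its radius into a lower bound: the
  coefficient of \<open>a\<close> is controlled by the norm.  This is the induction step of the next two lemmas.
\<close>

lemma closed_subspace_distance:
  fixes S :: "'v::real_normed_vector set"
  assumes "closed S" "subspace S" "a \<notin> S"
  obtains d where "d > 0" "\<And>c s. s \<in> S \<Longrightarrow> \<bar>c\<bar> * d \<le> norm (c *\<^sub>R a + s)"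
proof -
  have "open (- S)" "a \<in> - S" using assms by auto
  then obtain d where d: "d > 0" "ball a d \<subseteq> - S" by (meson openE)
  have "\<bar>c\<bar> * d \<le> norm (c *\<^sub>R a + s)" if s: "s \<in> S" for c s
  proof (cases "c = 0")
    case False
    have "(- 1 / c) *\<^sub>R s \<in> S" using s assms(2) by (rule subspace_scale[rotated])
    then have "(- 1 / c) *\<^sub>R s \<notin> ball a d" using d by auto
    then have "d \<le> norm (a - (- 1 / c) *\<^sub>R s)" by (simp add: dist_norm)
    then have "\<bar>c\<bar> * d \<le> \<bar>c\<bar> * norm (a - (- 1 / c) *\<^sub>R s)" by (simp add: mult_left_mono)
    also have "\<dots> = norm (c *\<^sub>R (a - (- 1 / c) *\<^sub>R s))" by simp
    also have "c *\<^sub>R (a - (- 1 / c) *\<^sub>R s) = c *\<^sub>R a + s"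
      using False by (simp add: algebra_simps)
    finally show ?thesis .
  qed simp
  then show ?thesis using that d by blast
qed

text \<open>
  Adjoining \<open>a\<close> to the closed subspace \<open>span B\<close>: along a convergent sequence the coefficients of \<open>a\<close>
  form a Cauchy sequence, and what remains converges in \<open>span B\<close>.
\<close>

lemma closed_span_finite:
  fixes B :: "'v::real_normed_vector set"
  assumes "finite B"
  shows "closed (span B)"
  using assms
proof (induction B)
  case (insert a B)
  show ?case
  proof (cases "a \<in> span B")
    case True
    then show ?thesis using insert span_redundant by metis
  next
    case False
    obtain d where d: "d > 0" "\<And>c s. s \<in> span B \<Longrightarrow> \<bar>c\<bar> * d \<le> norm (c *\<^sub>R a + s)"
      using closed_subspace_distance[OF insert.IH subspace_span False] by blast
    show ?thesis
      unfolding closed_sequential_limits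
    proof (intro allI impI, elim conjE)
      fix x l assume x: "\<forall>n. x n \<in> span (insert a B)" and l: "x \<longlonglongrightarrow> l"
      have "\<forall>n. \<exists>c. x n - c *\<^sub>R a \<in> span B" using x span_breakdown_eq by blast
      then obtain c where c: "\<And>n. x n - c n *\<^sub>R a \<in> span B" by metis
      have *: "\<bar>c m - c n\<bar> * d \<le> norm (x m - x n)" for m n
        using d(2)[OF span_diff[OF c[of m] c[of n]], of "c m - c n"] by (simp add: algebra_simps)
      have "Cauchy c"
      proof (rule metric_CauchyI)
        fix e :: real assume "e > 0"
        then have "e * d > 0" using d by simp
        then obtain M where "\<forall>m\<ge>M. \<forall>n\<ge>M. dist (x m) (x n) < e * d"
          using LIMSEQ_imp_Cauchy[OF l] unfolding Cauchy_def by meson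
        then have "\<bar>c m - c n\<bar> * d < e * d" if "m \<ge> M" "n \<ge> M" for m n
          using *[of m n] that by (fastforce simp: dist_norm)
        then show "\<exists>M. \<forall>m\<ge>M. \<forall>n\<ge>M. dist (c m) (c n) < e"
          using d(1) by (auto simp: dist_norm)
      qed
      then obtain k where k: "c \<longlonglongrightarrow> k" by (meson Cauchy_convergent_iff convergentD)
      have lim: "(\<lambda>n. x n - c n *\<^sub>R a) \<longlonglongrightarrow> l - k *\<^sub>R a" by (intro tendsto_intros l k)
      have "l - k *\<^sub>R a \<in> span B" by (rule closed_sequentially[OF insert.IH _ lim]) (rule c)
      then show "l \<in> span (insert a B)" using span_breakdown_eq by blast
    qed
  qed
qed simp

lemma closed_finite_dim:
  fixes S :: "'v::real_normed_vector set"
  assumes "subspace S" "finite_dim S"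
  shows "closed S"
  using finite_dim_spanning[OF assms] closed_span_finite by metis

text \<open>
  Modules are subspaces of normed spaces of any dimension, on which linear maps are given on the
  subspace only.  Boundedness there replaces the extension to a continuous linear map.
\<close>

lemma linear_on_bounded:
  fixes f :: "'v::real_normed_vector \<Rightarrow> 'w::real_normed_vector"
  assumes "subspace S" "finite_dim S" "linear_on S f"
  obtains C where "C > 0" "\<And>x. x \<in> S \<Longrightarrow> norm (f x) \<le> C * norm x"
proof -
  have "\<exists>C>0. \<forall>x \<in> span B. norm (f x) \<le> C * norm x" if "finite B" "span B \<subseteq> S" for B
    using that
  proof (induction B)
    case empty
    have "f 0 = 0" using assms(3) \<open>subspace S\<close> subspace_0[of S]
      unfolding linear_on_def by (metis scale_zero_left)
    then show ?case by (intro exI[of _ 1]) simp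
  next
    case (insert a B)
    have aS: "a \<in> S" and BS: "span B \<subseteq> S"
      using insert.prems span_base[of a "insert a B"] span_mono[of B "insert a B"] by blast+
    obtain C where C: "C > 0" "\<forall>x \<in> span B. norm (f x) \<le> C * norm x" using insert.IH BS by blast
    show ?case
    proof (cases "a \<in> span B")
      case True
      then show ?thesis using C span_redundant by metis
    next
      case False
      obtain d where d: "d > 0" "\<And>c s. s \<in> span B \<Longrightarrow> \<bar>c\<bar> * d \<le> norm (c *\<^sub>R a + s)"
        using closed_subspace_distance[OF closed_span_finite[OF insert.hyps(1)] subspace_span False]
        by blast
      define K where "K = (norm (f a) + C * norm a) / d + C"
      have "norm (f x) \<le> K * norm x" if x: "x \<in> span (insert a B)" for x
      proof -
        obtain c where c: "x - c *\<^sub>R a \<in> span B" using x span_breakdown_eq by blast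
        define s where "s = x - c *\<^sub>R a"
        have s: "s \<in> span B" "x = c *\<^sub>R a + s" using c by (auto simp: s_def)
        have cd: "\<bar>c\<bar> \<le> norm x / d" using d(2)[OF s(1), of c] d(1) s(2) by (simp add: field_simps)
        have "f x = c *\<^sub>R f a + f s"
          using assms(3) aS s BS \<open>subspace S\<close> unfolding linear_on_def
          by (metis subspace_scale subsetD)
        then have "norm (f x) \<le> \<bar>c\<bar> * norm (f a) + norm (f s)"
          using norm_triangle_ineq[of "c *\<^sub>R f a" "f s"] by simp
        also have "norm (f s) \<le> C * norm s" using C(2) s(1) by blast
        also have "C * norm s \<le> C * (norm x + \<bar>c\<bar> * norm a)"
          unfolding s_def using norm_triangle_ineq4[of x "c *\<^sub>R a"] C(1) by simp
        also have "\<bar>c\<bar> * norm (f a) + C * (norm x + \<bar>c\<bar> * norm a) =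
            \<bar>c\<bar> * (norm (f a) + C * norm a) + C * norm x"
          by (simp add: algebra_simps)
        also have "\<dots> \<le> norm x / d * (norm (f a) + C * norm a) + C * norm x"
          using cd C(1) by (intro add_right_mono mult_right_mono) auto
        also have "\<dots> = K * norm x" by (simp add: K_def algebra_simps add_divide_distrib)
        finally show ?thesis using C(1) by simp
      qed
      moreover have "K > 0" using C(1) d(1) unfolding K_def
        by (intro add_nonneg_pos divide_nonneg_pos add_nonneg_nonneg mult_nonneg_nonneg) auto
      ultimately show ?thesis by blast
    qed
  qed
  then show ?thesis using finite_dim_spanning[OF assms(1,2)] that by (metis order_refl)
qed

lemma linear_onD:
  assumes "linear_on S f"
  shows "x \<in> S \<Longrightarrow> y \<in> S \<Longrightarrow> f (x + y) = f x + f y" "x \<in> S \<Longrightarrow> f (c *\<^sub>R x) = c *\<^sub>R f x"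
  using assms by (auto simp: linear_on_def)

lemma linear_on_0: "subspace S \<Longrightarrow> linear_on S f \<Longrightarrow> f 0 = 0"
  using linear_onD(2)[of S f 0 0] subspace_0 by fastforce

lemma linear_on_diff:
  assumes "subspace S" "linear_on S f" "x \<in> S" "y \<in> S"
  shows "f (x - y) = f x - f y"
  using linear_onD(1)[OF assms(2) subspace_diff[OF assms(1,3,4)] assms(4)] by simp

lemma linear_on_sum:
  assumes "subspace S" "linear_on S f" "\<And>i. i \<in> A \<Longrightarrow> g i \<in> S"
  shows "f (\<Sum>i\<in>A. g i) = (\<Sum>i\<in>A. f (g i))"
  using assms(3)
proof (induction A rule: infinite_finite_induct)
  case (insert i A)
  then have "sum g A \<in> S" "g i \<in> S" using subspace_sum[OF assms(1), of A g] by auto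
  then show ?case using insert by (simp add: linear_onD(1)[OF assms(2)])
qed (use linear_on_0 assms in auto)

lemma linear_on_UNIV: "linear_on UNIV f \<longleftrightarrow> linear f"
  by (auto simp: linear_on_def linear_iff)

lemma linear_imp_bounded_linear_finite_dim:
  fixes f :: "'v::real_normed_vector \<Rightarrow> 'w::real_normed_vector"
  assumes "finite_dim (UNIV :: 'v set)" "linear f"
  shows "bounded_linear f"
proof -
  obtain C where "\<And>x. norm (f x) \<le> C * norm x"
    using linear_on_bounded[OF subspace_UNIV assms(1)] assms(2) linear_on_UNIV by (metis UNIV_I)
  then show ?thesis using assms(2)
    by (intro bounded_linear_intro[where K = C]) (auto simp: linear_iff mult.commute)
qed

lemma some_basis:
  assumes "finite_dim (UNIV :: 'v::real_vector set)"
  shows "finite (some_basis :: 'v set)" "independent (some_basis :: 'v set)"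
    "span (some_basis :: 'v set) = UNIV"
proof -
  obtain B :: "'v set" where B: "finite B" "independent B" "span B = UNIV"
    using finite_dim_spanning[OF subspace_UNIV assms] by blast
  have *: "independent (some_basis :: 'v set) \<and> span (some_basis :: 'v set) = UNIV"
    unfolding some_basis_def by (rule someI[of "\<lambda>b. independent b \<and> span b = UNIV" B]) (use B in auto)
  then show "independent (some_basis :: 'v set)" "span (some_basis :: 'v set) = UNIV" by auto
  show "finite (some_basis :: 'v set)"
    using independent_span_bound[OF B(1)] * B(3) by (metis subset_UNIV)
qed

abbreviation coord :: "'v::real_vector \<Rightarrow> 'v \<Rightarrow> real" where
  "coord b x \<equiv> representation some_basis x b"

lemma coord_sum:
  assumes "finite_dim (UNIV :: 'v::real_vector set)"
  shows "(\<Sum>b\<in>some_basis. coord b x *\<^sub>R b) = (x :: 'v)"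
  using sum_representation_eq[OF some_basis(2)[OF assms], of x some_basis] some_basis[OF assms]
  by auto

lemma linear_coord:
  assumes "finite_dim (UNIV :: 'v::real_vector set)"
  shows "linear (coord (b :: 'v))"
  using representation_add[OF some_basis(2)[OF assms]] representation_scale[OF some_basis(2)[OF assms]]
    some_basis(3)[OF assms] by (auto simp: linear_iff fun_eq_iff)

lemma coord_basis:
  assumes "finite_dim (UNIV :: 'v::real_vector set)" "b \<in> some_basis" "c \<in> some_basis"
  shows "coord b (c :: 'v) = (if c = b then 1 else 0)"
  using representation_basis[OF some_basis(2)[OF assms(1)] assms(3)] by auto

lemma bounded_linear_coord:
  assumes "finite_dim (UNIV :: 'v::real_normed_vector set)"
  shows "bounded_linear (coord (b :: 'v))"
  using linear_imp_bounded_linear_finite_dim[OF assms linear_coord[OF assms]] .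

lemma linear_coord_expand:
  assumes "finite_dim (UNIV :: 'v::real_vector set)" "linear f"
  shows "f x = (\<Sum>b\<in>some_basis. coord b x *\<^sub>R f (b :: 'v))"
  using linear_sum[OF assms(2), of "\<lambda>b. coord b x *\<^sub>R b" some_basis] coord_sum[OF assms(1), of x]
  by (simp add: linear_cmul[OF assms(2)])


section \<open>Derivatives\<close>

text \<open>
  The derivative of a function with values in \<open>S\<close> has values in \<open>S\<close>, because \<open>S\<close> is closed.  Hence the
  chain rule holds for \<open>L\<close>, although \<open>L\<close> is a bounded linear map on \<open>S\<close> only.
\<close>

lemma has_derivative_linear_on:
  fixes g :: "'e::real_normed_vector \<Rightarrow> 'w::real_normed_vector"
  assumes g: "(g has_derivative g') (at x)"
    and S: "subspace S" "finite_dim S" and L: "linear_on S L"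
    and U: "open U" "x \<in> U" "g ` U \<subseteq> S"
  shows "g' v \<in> S" "((\<lambda>y. L (g y)) has_derivative (\<lambda>v. L (g' v))) (at x)"
proof -
  have bl: "bounded_linear g'" using g has_derivative_bounded_linear by blast
  have lin: "linear g'" using bl bounded_linear.linear by blast
  have gS: "y \<in> U \<Longrightarrow> g y \<in> S" for y using U by auto
  have inS: "g' v \<in> S" for v
  proof (rule ccontr)
    assume False: "g' v \<notin> S"
    obtain d where d: "d > 0" "\<And>c s. s \<in> S \<Longrightarrow> \<bar>c\<bar> * d \<le> norm (c *\<^sub>R g' v + s)"
      using closed_subspace_distance[OF closed_finite_dim[OF S] S(1) False] by blast
    \<comment> \<open>Small enough for \<open>e * norm v < d\<close>; the summand 1 covers \<open>v = 0\<close>.\<close>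
    define e where "e = d / (2 * (norm v + 1))"
    have n: "norm v + 1 > 0" using norm_ge_zero[of v] by linarith
    have e: "e > 0" using d(1) n by (simp add: e_def)
    have "e * norm v \<le> e * (norm v + 1)" using e by simp
    also have "\<dots> = d / 2" using n unfolding e_def by (simp add: field_simps)
    finally have ed: "e * norm v < d" using d(1) by simp
    obtain r where r: "r > 0"
      "\<And>y. norm (y - x) < r \<Longrightarrow> norm (g y - g x - g' (y - x)) \<le> e * norm (y - x)"
      using g e unfolding has_derivative_at_alt by meson
    obtain q where q: "q > 0" "ball x q \<subseteq> U" using U by (meson openE)
    define t where "t = min r q / (2 * (norm v + 1))"
    have t: "t > 0" using r(1) q(1) n by (simp add: t_def)
    have "t * norm v < min r q"
    proof -
      have "t * norm v \<le> t * (norm v + 1)" using t by simp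
      also have "\<dots> = min r q / 2" unfolding t_def using n by (simp add: field_simps)
      also have "\<dots> < min r q" using r(1) q(1) by (auto simp: min_def)
      finally show ?thesis .
    qed
    then have tr: "norm (t *\<^sub>R v) < r" "norm (t *\<^sub>R v) < q" using t by auto
    have "x + t *\<^sub>R v \<in> U" using q tr(2) by (auto simp: subset_eq dist_norm)
    then have "g x - g (x + t *\<^sub>R v) \<in> S" using gS U(2) subspace_diff[OF S(1)] by blast
    then have "t * d \<le> norm (t *\<^sub>R g' v + (g x - g (x + t *\<^sub>R v)))"
      using d(2)[of _ t] t by force
    also have "\<dots> = norm (g (x + t *\<^sub>R v) - g x - g' (t *\<^sub>R v))"
      using norm_minus_commute[of "t *\<^sub>R g' v" "g (x + t *\<^sub>R v) - g x"]
      by (simp add: linear_cmul[OF lin] algebra_simps)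
    also have "\<dots> \<le> e * (t * norm v)" using r(2)[of "x + t *\<^sub>R v"] tr(1) t by simp
    also have "\<dots> = t * (e * norm v)" by simp
    also have "\<dots> < t * d" using ed t by simp
    finally show False by simp
  qed
  show "g' v \<in> S" by (rule inS)
  obtain C where C: "C > 0" "\<And>x. x \<in> S \<Longrightarrow> norm (L x) \<le> C * norm x"
    using linear_on_bounded[OF S L] by blast
  show "((\<lambda>y. L (g y)) has_derivative (\<lambda>v. L (g' v))) (at x)"
    unfolding has_derivative_at_alt
  proof (intro conjI allI impI)
    obtain K where K: "\<And>v. norm (g' v) \<le> norm v * K" using bl bounded_linear.bounded by blast
    show "bounded_linear (\<lambda>v. L (g' v))"
    proof (rule bounded_linear_intro[where K = "C * K"])
      show "L (g' (u + v)) = L (g' u) + L (g' v)" for u v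
        using linear_onD(1)[OF L inS inS] linear_add[OF lin] by metis
      show "L (g' (r *\<^sub>R v)) = r *\<^sub>R L (g' v)" for r v
        using linear_onD(2)[OF L inS] linear_cmul[OF lin] by metis
      show "norm (L (g' v)) \<le> norm v * (C * K)" for v
        using order_trans[OF C(2)[OF inS[of v]] mult_left_mono[OF K[of v]]] C(1)
        by (simp add: mult.commute mult.left_commute)
    qed
    fix e :: real assume "e > 0"
    then have "e / C > 0" using C by simp
    then obtain d where d: "d > 0"
      "\<And>y. norm (y - x) < d \<Longrightarrow> norm (g y - g x - g' (y - x)) \<le> e / C * norm (y - x)"
      using g unfolding has_derivative_at_alt by meson
    obtain r where r: "r > 0" "ball x r \<subseteq> U" using U by (meson openE)
    have "norm (L (g y) - L (g x) - L (g' (y - x))) \<le> e * norm (y - x)"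
      if y: "norm (y - x) < min d r" for y
    proof -
      have yU: "y \<in> U" using y r by (auto simp: subset_eq dist_norm norm_minus_commute)
      have gd: "g y - g x \<in> S" by (rule subspace_diff[OF S(1) gS[OF yU] gS[OF U(2)]])
      have "L (g y) - L (g x) - L (g' (y - x)) = L (g y - g x - g' (y - x))"
        unfolding linear_on_diff[OF S(1) L gd inS] linear_on_diff[OF S(1) L gS[OF yU] gS[OF U(2)]] ..
      also have "norm \<dots> \<le> C * norm (g y - g x - g' (y - x))"
        by (rule C(2)[OF subspace_diff[OF S(1) gd inS]])
      also have "\<dots> \<le> C * (e / C * norm (y - x))" using d(2)[of y] y C(1) by (intro mult_left_mono) auto
      finally show ?thesis using C(1) by simp
    qed
    then show "\<exists>d>0. \<forall>y. norm (y - x) < d \<longrightarrow> norm (L (g y) - L (g x) - L (g' (y - x))) \<le> e * norm (y - x)"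
      using d(1) r(1) by (intro exI[of _ "min d r"]) auto
  qed
qed

section \<open>Calculus of \<open>C\<^sup>k\<close> functions\<close>

lemma Ck_on_has_derivative:
  "Ck_on (Suc n) S f \<Longrightarrow> x \<in> S \<Longrightarrow> (f has_derivative frechet_derivative f (at x)) (at x)"
  by (simp add: frechet_derivative_works)

lemma Ck_on_cong:
  assumes "open S" "\<And>x. x \<in> S \<Longrightarrow> f x = g x" "Ck_on n S f"
  shows "Ck_on n S g"
  using assms(2,3)
proof (induction n arbitrary: f g)
  case 0
  then show ?case using continuous_on_cong[of S S f g] by simp
next
  case (Suc n)
  have *: "(g has_derivative frechet_derivative f (at x)) (at x)" if "x \<in> S" for x
    using has_derivative_transform_within_open[OF Ck_on_has_derivative[OF Suc.prems(2) that] assms(1) that]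
      Suc.prems(1) by blast
  then have eq: "frechet_derivative f (at x) = frechet_derivative g (at x)" if "x \<in> S" for x
    using frechet_derivative_at that by blast
  have "Ck_on n S (\<lambda>x. frechet_derivative g (at x) v)" for v
    by (rule Suc.IH[of "\<lambda>x. frechet_derivative f (at x) v"]) (use eq Suc.prems(2) in auto)
  moreover have "\<forall>x\<in>S. g differentiable (at x)" using * by (auto simp: differentiable_def)
  ultimately show ?case by simp
qed

lemma Ck_on_SucI:
  assumes "open S" "\<And>x. x \<in> S \<Longrightarrow> (f has_derivative f' x) (at x)"
    "\<And>v. Ck_on n S (\<lambda>x. f' x v)"
  shows "Ck_on (Suc n) S f"
proof -
  have "f' x = frechet_derivative f (at x)" if "x \<in> S" for x
    using frechet_derivative_at[OF assms(2)[OF that]] .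
  then have "Ck_on n S (\<lambda>x. frechet_derivative f (at x) v)" for v
    using assms(3) by (intro Ck_on_cong[OF assms(1) _ assms(3)[of v]]) auto
  then show ?thesis using assms(2) by (auto simp: differentiable_def)
qed

lemma Ck_on_Suc_imp: "Ck_on (Suc n) S f \<Longrightarrow> Ck_on n S f"
proof (induction n arbitrary: f)
  case 0
  then show ?case
    by (auto intro!: continuous_at_imp_continuous_on differentiable_imp_continuous_within)
next
  case (Suc n)
  show ?case
    unfolding Ck_on.simps(2)[of n]
    using Suc.prems Suc.IH unfolding Ck_on.simps(2)[of "Suc n"] by blast
qed

lemma Ck_on_subset: "Ck_on n S f \<Longrightarrow> T \<subseteq> S \<Longrightarrow> Ck_on n T f"
  by (induction n arbitrary: f) (auto intro: continuous_on_subset)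

lemma Ck_on_continuous: "Ck_on n S f \<Longrightarrow> continuous_on S f"
  by (induction n arbitrary: f) (use Ck_on_Suc_imp in auto)

lemma Ck_on_const:
  assumes "open S" shows "Ck_on n S (\<lambda>x. c)"
proof (induction n arbitrary: c)
  case (Suc n)
  show ?case by (rule Ck_on_SucI[OF assms, where f' = "\<lambda>x v. 0"]) (auto intro: Suc)
qed simp

lemma Ck_on_id:
  assumes "open S" shows "Ck_on n S (\<lambda>x. x)"
proof (cases n)
  case (Suc m)
  show ?thesis unfolding Suc
    by (rule Ck_on_SucI[OF assms, where f' = "\<lambda>x v. v"]) (auto intro: Ck_on_const[OF assms])
qed simp

lemma Ck_on_local:
  assumes "\<And>x. x \<in> S \<Longrightarrow> \<exists>T. open T \<and> x \<in> T \<and> T \<subseteq> S \<and> Ck_on n T f"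
  shows "Ck_on n S f"
  using assms
proof (induction n arbitrary: f)
  case 0
  show ?case unfolding Ck_on.simps
  proof (rule continuous_at_imp_continuous_on, rule ballI)
    fix x assume "x \<in> S"
    then obtain T where "open T" "x \<in> T" "continuous_on T f" using 0[of x] by auto
    then show "isCont f x" using continuous_on_eq_continuous_at by blast
  qed
next
  case (Suc n)
  have "f differentiable (at x)" if "x \<in> S" for x using Suc.prems[OF that] by auto
  moreover have "Ck_on n S (\<lambda>x. frechet_derivative f (at x) v)" for v
    by (rule Suc.IH) (use Suc.prems in fastforce)
  ultimately show ?case by simp
qed

text \<open>
  The derivative of \<open>L \<circ> f\<close> is \<open>L\<close> applied to that of \<open>f\<close>, which again takes values in \<open>S\<close>.
\<close>

lemma Ck_on_linear_on:
  fixes f :: "'e::real_normed_vector \<Rightarrow> 'w::real_normed_vector"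
    and L :: "'w \<Rightarrow> 'v::real_normed_vector"
  assumes "open U" and S: "subspace S" "finite_dim S" "linear_on S L"
    and "Ck_on n U f" "f ` U \<subseteq> S"
  shows "Ck_on n U (\<lambda>x. L (f x))"
  using assms(5,6)
proof (induction n arbitrary: f)
  case 0
  obtain C where C: "C > 0" "\<And>x. x \<in> S \<Longrightarrow> norm (L x) \<le> C * norm x"
    using linear_on_bounded[OF S] by blast
  have "continuous_on S L"
    unfolding continuous_on_iff
  proof (intro ballI allI impI)
    fix x and e :: real assume x: "x \<in> S" "e > 0"
    show "\<exists>d>0. \<forall>x'\<in>S. dist x' x < d \<longrightarrow> dist (L x') (L x) < e"
    proof (intro exI[of _ "e / C"] conjI ballI impI)
      fix y assume y: "y \<in> S" "dist y x < e / C"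
      have "dist (L y) (L x) = norm (L (y - x))"
        using linear_on_diff[OF S(1,3) y(1) x(1)] by (simp add: dist_norm)
      also have "\<dots> \<le> C * norm (y - x)" using C(2) subspace_diff[OF S(1) y(1) x(1)] by blast
      also have "\<dots> < e" using y(2) C(1) by (simp add: dist_norm field_simps)
      finally show "dist (L y) (L x) < e" .
    qed (use x C in auto)
  qed
  then show ?case using 0 continuous_on_compose2[of S L U f] by auto
next
  case (Suc n)
  note der = Ck_on_has_derivative[OF Suc.prems(1)]
  have *: "frechet_derivative f (at x) v \<in> S"
    "((\<lambda>y. L (f y)) has_derivative (\<lambda>v. L (frechet_derivative f (at x) v))) (at x)"
    if "x \<in> U" for x v
    using has_derivative_linear_on[OF der[OF that] S assms(1) that Suc.prems(2)] by auto
  show ?case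
    by (rule Ck_on_SucI[OF assms(1) *(2)]) (use Suc.prems(1) *(1) in \<open>auto intro!: Suc.IH\<close>)
qed

lemma Ck_on_bounded_linear:
  assumes "open U" "bounded_linear L" "Ck_on n U f"
  shows "Ck_on n U (\<lambda>x. L (f x))"
  using assms(3)
proof (induction n arbitrary: f)
  case 0
  then show ?case
    using continuous_on_compose2[OF bounded_linear.continuous_on[OF assms(2) continuous_on_id]]
    by auto
next
  case (Suc n)
  show ?case
    by (rule Ck_on_SucI[OF assms(1)
          bounded_linear.has_derivative[OF assms(2) Ck_on_has_derivative[OF Suc.prems]]])
      (use Suc.prems in \<open>auto intro!: Suc.IH\<close>)
qed

lemma Ck_on_add:
  assumes "open U" "Ck_on n U f" "Ck_on n U g"
  shows "Ck_on n U (\<lambda>x. f x + g x)"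
  using assms(2,3)
proof (induction n arbitrary: f g)
  case (Suc n)
  show ?case
    by (rule Ck_on_SucI[OF assms(1) has_derivative_add[OF
            Ck_on_has_derivative[OF Suc.prems(1)] Ck_on_has_derivative[OF Suc.prems(2)]]])
      (use Suc.prems in \<open>auto intro!: Suc.IH\<close>)
qed (auto intro: continuous_on_add)

lemma Ck_on_sum:
  assumes "open U" "\<And>i. i \<in> A \<Longrightarrow> Ck_on n U (f i)"
  shows "Ck_on n U (\<lambda>x. \<Sum>i\<in>A. f i x)"
  using assms(2)
proof (induction A rule: infinite_finite_induct)
  case (insert i A)
  then have "Ck_on n U (\<lambda>x. f i x + (\<Sum>i\<in>A. f i x))" by (intro Ck_on_add[OF assms(1)]) auto
  then show ?case using insert by simp
qed (auto intro: Ck_on_const[OF assms(1)])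

lemma Ck_on_bilinear:
  assumes "open U" "bounded_bilinear b" "Ck_on n U f" "Ck_on n U g"
  shows "Ck_on n U (\<lambda>x. b (f x) (g x))"
  using assms(3,4)
proof (induction n arbitrary: f g)
  case 0
  then show ?case using bounded_bilinear.continuous_on[OF assms(2)] by auto
next
  case (Suc n)
  note IH = Suc.IH[OF _ Ck_on_Suc_imp[OF Suc.prems(2)]] Suc.IH[OF Ck_on_Suc_imp[OF Suc.prems(1)]]
  show ?case
    by (rule Ck_on_SucI[OF assms(1) bounded_bilinear.FDERIV[OF assms(2)
            Ck_on_has_derivative[OF Suc.prems(1)] Ck_on_has_derivative[OF Suc.prems(2)]]])
      (use Suc.prems in \<open>auto intro!: Ck_on_add[OF assms(1)] IH\<close>)
qed

text \<open>
  Expanding the inner derivative in a basis of the middle space makes the derivative of \<open>g \<circ> f\<close> a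
  finite sum of products of functions to which the induction hypothesis applies.
\<close>

lemma Ck_on_compose:
  fixes f :: "'a::real_normed_vector \<Rightarrow> 'e::real_normed_vector"
    and g :: "'e \<Rightarrow> 'w::real_normed_vector"
  assumes fd: "finite_dim (UNIV :: 'e set)"
    and "open U" "Ck_on n U f" "Ck_on n T g" "f ` U \<subseteq> T"
  shows "Ck_on n U (\<lambda>x. g (f x))"
  using assms(3,4)
proof (induction n arbitrary: g)
  case 0
  then show ?case using assms(5) continuous_on_compose2[of T g U f] by auto
next
  case (Suc n)
  note dg = Ck_on_has_derivative[OF Suc.prems(2)] and df = Ck_on_has_derivative[OF Suc.prems(1)]
  define h where "h = (\<lambda>x v. \<Sum>b\<in>some_basis.
    coord b (frechet_derivative f (at x) v) *\<^sub>R frechet_derivative g (at (f x)) b)"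
  have der: "((\<lambda>x. g (f x)) has_derivative h x) (at x)" if x: "x \<in> U" for x
  proof -
    have fx: "f x \<in> T" using assms(5) x by auto
    have "h x = (\<lambda>v. frechet_derivative g (at (f x)) (frechet_derivative f (at x) v))"
      unfolding h_def
      by (rule ext) (rule linear_coord_expand[OF fd has_derivative_linear[OF dg[OF fx]], symmetric])
    then show ?thesis using has_derivative_compose[OF df[OF x] dg[OF fx]] by simp
  qed
  show ?case
  proof (rule Ck_on_SucI[OF assms(2) der])
    fix v
    have "Ck_on n U (\<lambda>x. frechet_derivative g (at (f x)) b)" for b
      by (rule Suc.IH[of "\<lambda>y. frechet_derivative g (at y) b"])
        (use Suc.prems Ck_on_Suc_imp[OF Suc.prems(1)] in auto)
    moreover have "Ck_on n U (\<lambda>x. frechet_derivative f (at x) v)" using Suc.prems by simp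
    ultimately show "Ck_on n U (\<lambda>x. h x v)" unfolding h_def
      by (intro Ck_on_sum[OF assms(2)] Ck_on_bilinear[OF assms(2) bounded_bilinear_scaleR]
          Ck_on_bounded_linear[OF assms(2) bounded_linear_coord[OF fd]])
  qed
qed

lemma Ck_on_Pair:
  assumes "open U" "Ck_on n U f" "Ck_on n U g"
  shows "Ck_on n U (\<lambda>x. (f x, g x))"
proof -
  have "Ck_on n U (\<lambda>x. (f x, 0) + (0, g x))"
    by (intro Ck_on_add[OF assms(1)]
        Ck_on_bounded_linear[OF assms(1) _ assms(2), of "\<lambda>z. (z, 0)"]
        Ck_on_bounded_linear[OF assms(1) _ assms(3), of "\<lambda>z. (0, z)"]
        bounded_linear_Pair bounded_linear_ident bounded_linear_zero)
  then show ?thesis by simp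
qed

lemma bounded_linear_rank_one:
  fixes k :: "'e::real_normed_vector \<Rightarrow> real"
  assumes "bounded_linear k"
  shows "bounded_linear (\<lambda>w::'w::real_normed_vector. Blinfun (\<lambda>v. k v *\<^sub>R w))"
    "blinfun_apply (Blinfun (\<lambda>v. k v *\<^sub>R (w::'w::real_normed_vector))) = (\<lambda>v. k v *\<^sub>R w)"
proof -
  have *: "blinfun_apply (Blinfun (\<lambda>v. k v *\<^sub>R (w::'w::real_normed_vector))) = (\<lambda>v. k v *\<^sub>R w)" for w :: 'w
    by (intro bounded_linear_Blinfun_apply bounded_linear_compose[OF bounded_linear_scaleR_left assms])
  then show "blinfun_apply (Blinfun (\<lambda>v. k v *\<^sub>R (w::'w::real_normed_vector))) = (\<lambda>v. k v *\<^sub>R w)" .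
  have "(\<lambda>w::'w::real_normed_vector. Blinfun (\<lambda>v. k v *\<^sub>R (w::'w::real_normed_vector))) = (\<lambda>w::'w. blinfun_scaleR_left w o\<^sub>L Blinfun k)"
    by (intro ext blinfun_eqI) (simp add: * bounded_linear_Blinfun_apply[OF assms])
  moreover have "bounded_linear (\<lambda>w::'w. blinfun_scaleR_left w o\<^sub>L Blinfun k)"
    by (intro bounded_linear_compose[OF bounded_bilinear.bounded_linear_left[OF
            bounded_bilinear_blinfun_compose] bounded_linear_blinfun_scaleR_left])
  ultimately show "bounded_linear (\<lambda>w::'w::real_normed_vector. Blinfun (\<lambda>v. k v *\<^sub>R w))" by simp
qed

text \<open>
  A linear map is the sum of the rank one maps given by its values on a basis, and these depend
  linearly and continuously on the values.
\<close>

lemma Ck_on_Blinfun: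
  fixes F :: "'a::real_normed_vector \<Rightarrow> 'e::real_normed_vector \<Rightarrow> 'w::real_normed_vector"
  assumes fd: "finite_dim (UNIV :: 'e set)" and "open U"
    and lin: "\<And>x. x \<in> U \<Longrightarrow> linear (F x)" and "\<And>v. Ck_on n U (\<lambda>x. F x v)"
  shows "Ck_on n U (\<lambda>x. Blinfun (F x))"
proof -
  have "Ck_on n U (\<lambda>x. \<Sum>b\<in>some_basis. Blinfun (\<lambda>v. coord b v *\<^sub>R F x b))"
    by (intro Ck_on_sum[OF assms(2)] Ck_on_bounded_linear[OF assms(2)
          bounded_linear_rank_one(1)[OF bounded_linear_coord[OF fd]] assms(4)])
  moreover have "(\<Sum>b\<in>some_basis. Blinfun (\<lambda>v. coord b v *\<^sub>R F x b)) = Blinfun (F x)"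
    if "x \<in> U" for x
    by (rule blinfun_eqI)
      (simp add: blinfun.sum_left bounded_linear_rank_one(2)[OF bounded_linear_coord[OF fd]]
        bounded_linear_Blinfun_apply[OF linear_imp_bounded_linear_finite_dim[OF fd lin[OF that]]]
        linear_coord_expand[OF fd lin[OF that], symmetric])
  ultimately show ?thesis by (rule Ck_on_cong[OF assms(2), rotated]) auto
qed

text \<open>
  Near a zero of \<open>k\<close> the increment of \<open>g\<close> only contributes a term of smaller order, so continuity of
  \<open>g\<close> suffices.  In the next lemma \<open>g\<close> is the inverse whose differentiability is to be shown.
\<close>

lemma has_derivative_bilinear_vanishing:
  assumes b: "bounded_bilinear b" and g: "isCont g x"
    and k: "(k has_derivative k') (at x)" and "k x = 0"
  shows "((\<lambda>y. b (g y) (k y)) has_derivative (\<lambda>v. b (g x) (k' v))) (at x)"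
proof -
  interpret b: bounded_bilinear b by (rule b)
  obtain K where K: "K > 0" "\<And>u v. norm (b u v) \<le> norm u * norm v * K"
    using b.pos_bounded by blast
  have zero: "((\<lambda>y. b (g y - g x) (k y)) has_derivative (\<lambda>v. 0)) (at x)"
    unfolding has_derivative_at_alt
  proof (intro conjI allI impI bounded_linear_zero)
    fix e :: real assume e: "e > 0"
    obtain C where C: "C > 0" "\<And>v. norm (k' v) \<le> norm v * C"
      using bounded_linear.pos_bounded[OF has_derivative_bounded_linear[OF k]] by blast
    obtain d where d: "d > 0" "\<And>y. norm (y - x) < d \<Longrightarrow>
        norm (k y - k x - k' (y - x)) \<le> 1 * norm (y - x)"
      using k unfolding has_derivative_at_alt by (meson zero_less_one)
    define \<epsilon> where "\<epsilon> = e / ((1 + C) * K)"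
    have "\<epsilon> > 0" using e C K by (simp add: \<epsilon>_def)
    then obtain r where r: "r > 0" "\<And>y. dist y x < r \<Longrightarrow> dist (g y) (g x) < \<epsilon>"
      using g unfolding continuous_at_eps_delta by meson
    have "norm (b (g y - g x) (k y)) \<le> e * norm (y - x)" if y: "norm (y - x) < min d r" for y
    proof -
      have "norm (k y) \<le> norm (k y - k x - k' (y - x)) + norm (k' (y - x))"
        using norm_triangle_ineq[of "k y - k x - k' (y - x)" "k' (y - x)"] assms(4) by simp
      also have "\<dots> \<le> (1 + C) * norm (y - x)"
        using d(2)[of y] C(2)[of "y - x"] y by (simp add: algebra_simps)
      finally have 1: "norm (k y) \<le> (1 + C) * norm (y - x)" .
      have 2: "norm (g y - g x) \<le> \<epsilon>" using r(2)[of y] y by (simp add: dist_norm)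
      have "norm (b (g y - g x) (k y)) \<le> norm (g y - g x) * norm (k y) * K" by (rule K(2))
      also have "\<dots> \<le> \<epsilon> * ((1 + C) * norm (y - x)) * K"
        using 1 2 K(1) \<open>\<epsilon> > 0\<close> by (intro mult_right_mono mult_mono) auto
      also have "\<dots> = \<epsilon> * ((1 + C) * K) * norm (y - x)" by simp
      also have "\<epsilon> * ((1 + C) * K) = e" using C(1) K(1) by (simp add: \<epsilon>_def)
      finally show ?thesis .
    qed
    then show "\<exists>d>0. \<forall>y. norm (y - x) < d \<longrightarrow>
        norm (b (g y - g x) (k y) - b (g x - g x) (k x) - 0) \<le> e * norm (y - x)"
      using d(1) r(1) by (intro exI[of _ "min d r"]) (simp add: b.zero_left)
  qed
  have "((\<lambda>y. b (g x) (k y) + b (g y - g x) (k y)) has_derivative (\<lambda>v. b (g x) (k' v) + 0)) (at x)"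
    by (intro has_derivative_add zero bounded_linear.has_derivative[OF b.bounded_linear_right k])
  then show ?thesis by (simp add: b.diff_left)
qed

text \<open>
  From \<open>I y - I x = - I y (N y - N x) I x\<close> one first reads off that \<open>I\<close> is bounded near \<open>x\<close>, then
  that it is continuous, and then that \<open>N' \<mapsto> - I x N' I x\<close> is its derivative.  The last formula
  is bilinear in known functions, so the order of differentiability goes up by induction.
\<close>

lemma Ck_on_blinfun_inverse:
  fixes N :: "'x::real_normed_vector \<Rightarrow> ('e::real_normed_vector \<Rightarrow>\<^sub>L 'g::real_normed_vector)"
    and I :: "'x \<Rightarrow> ('g \<Rightarrow>\<^sub>L 'e)"
  assumes "open U" and inv: "\<And>x. x \<in> U \<Longrightarrow> I x o\<^sub>L N x = id_blinfun"
      "\<And>x. x \<in> U \<Longrightarrow> N x o\<^sub>L I x = id_blinfun"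
    and "Ck_on n U N"
  shows "Ck_on n U I"
proof -
  have diff: "I y - I x = - (I y o\<^sub>L ((N y - N x) o\<^sub>L I x))" if "x \<in> U" "y \<in> U" for x y
  proof -
    have "I y o\<^sub>L ((N y - N x) o\<^sub>L I x) = ((I y o\<^sub>L N y) o\<^sub>L I x) - (I y o\<^sub>L (N x o\<^sub>L I x))"
      by (intro blinfun_eqI) (simp add: blinfun.bilinear_simps)
    also have "\<dots> = I x - I y" unfolding inv[OF that(1)] inv[OF that(2)]
      by (intro blinfun_eqI) (simp add: blinfun.bilinear_simps)
    finally show ?thesis by simp
  qed
  have cont: "isCont I x" if N: "isCont N x" and x: "x \<in> U" for x
  proof -
    define a where "a = norm (I x)"
    have N0: "((\<lambda>y. norm (N y - N x)) \<longlongrightarrow> 0) (at x)"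
      using N by (intro tendsto_norm_zero LIM_zero) (simp add: isCont_def)
    have a: "0 < 1 / (2 * (a + 1))" by (simp add: a_def add_nonneg_pos)
    have ev: "\<forall>\<^sub>F y in at x. norm (I y - I x) \<le> 2 * a * a * norm (N y - N x)"
      using order_tendstoD(2)[OF N0 a] eventually_at_in_open'[OF assms(1) x]
    proof eventually_elim
      case (elim y)
      define t where "t = norm (N y - N x)"
      have *: "norm (I y - I x) \<le> norm (I y) * (t * a)"
      proof -
        have "norm (I y - I x) = norm (I y o\<^sub>L ((N y - N x) o\<^sub>L I x))"
          using diff[OF x elim(2)] by simp
        also have "\<dots> \<le> norm (I y) * norm ((N y - N x) o\<^sub>L I x)" by (rule norm_blinfun_compose)
        also have "\<dots> \<le> norm (I y) * (t * a)"
          unfolding t_def a_def by (intro mult_left_mono norm_blinfun_compose norm_ge_zero)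
        finally show ?thesis .
      qed
      have t0: "t \<ge> 0" "a \<ge> 0" by (auto simp: t_def a_def)
      have "t * a \<le> t * (a + 1)" using t0 by (intro mult_left_mono) auto
      also have "\<dots> \<le> 1 / (2 * (a + 1)) * (a + 1)"
        using elim(1) t0 unfolding t_def by (intro mult_right_mono) auto
      also have "\<dots> = 1 / 2" using t0 by (simp add: field_simps)
      finally have "norm (I y) * (t * a) \<le> norm (I y) * (1 / 2)"
        by (intro mult_left_mono) auto
      moreover have "norm (I y) \<le> a + norm (I y - I x)"
        unfolding a_def using norm_triangle_ineq[of "I x" "I y - I x"] by simp
      ultimately have "norm (I y) \<le> 2 * a" using * by linarith
      then have "norm (I y) * (t * a) \<le> 2 * a * (t * a)" using t0 by (intro mult_right_mono) auto
      then show ?case using * unfolding t_def by (simp add: mult_ac)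
    qed
    have "((\<lambda>y. I y - I x) \<longlongrightarrow> 0) (at x)"
      by (rule Lim_null_comparison[OF ev]) (use tendsto_mult_right_zero[OF N0] in simp)
    then show ?thesis unfolding isCont_def by (rule LIM_zero_cancel)
  qed
  have bb: "bounded_bilinear (o\<^sub>L)" by (rule bounded_bilinear_blinfun_compose)
  show ?thesis using assms(4)
  proof (induction n)
    case 0
    then have "isCont N x" if "x \<in> U" for x
      using continuous_on_eq_continuous_at[OF assms(1)] that by auto
    then show ?case using cont by (auto intro: continuous_at_imp_continuous_on)
  next
    case (Suc n)
    note dN = Ck_on_has_derivative[OF Suc.prems]
    show ?case
    proof (rule Ck_on_SucI[OF assms(1)])
      fix x assume x: "x \<in> U"
      have "isCont N x" using dN[OF x] has_derivative_continuous by blast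
      then have I: "isCont I x" using cont x by blast
      have k: "((\<lambda>y. (N y - N x) o\<^sub>L I x) has_derivative
          (\<lambda>v. frechet_derivative N (at x) v o\<^sub>L I x)) (at x)"
        by (rule bounded_linear.has_derivative[OF bounded_bilinear.bounded_linear_left[OF bb]])
          (auto intro!: derivative_eq_intros dN[OF x])
      have "((\<lambda>y. I x - (I y o\<^sub>L ((N y - N x) o\<^sub>L I x))) has_derivative
          (\<lambda>v. 0 - (I x o\<^sub>L (frechet_derivative N (at x) v o\<^sub>L I x)))) (at x)"
        by (intro has_derivative_diff has_derivative_const
            has_derivative_bilinear_vanishing[OF bb I k]) (auto intro!: blinfun_eqI)
      then show "(I has_derivative (\<lambda>v. 0 - (I x o\<^sub>L (frechet_derivative N (at x) v o\<^sub>L I x)))) (at x)"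
      proof (rule has_derivative_transform_within_open[OF _ assms(1) x])
        fix y assume y: "y \<in> U"
        have "I x - (I y o\<^sub>L ((N y - N x) o\<^sub>L I x)) = I x + (I y - I x)"
          using diff[OF x y] by simp
        then show "I x - (I y o\<^sub>L ((N y - N x) o\<^sub>L I x)) = I y" by simp
      qed
    next
      fix v
      have "Ck_on n U I" using Suc.IH Ck_on_Suc_imp[OF Suc.prems] by blast
      moreover have "Ck_on n U (\<lambda>x. frechet_derivative N (at x) v)" using Suc.prems by simp
      ultimately show "Ck_on n U (\<lambda>x. 0 - (I x o\<^sub>L (frechet_derivative N (at x) v o\<^sub>L I x)))"
        unfolding diff_0
        by (intro Ck_on_bounded_linear[OF assms(1), of uminus] Ck_on_bilinear[OF assms(1) bb]
            bounded_linear_minus bounded_linear_ident)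
    qed
  qed
qed

text \<open>
  The mean value inequality, applied to \<open>s \<mapsto> f (x + s u + t v) - f (x + s u) - s t (h' v)\<close>.
\<close>

lemma second_difference_quotient:
  fixes f :: "'e::real_normed_vector \<Rightarrow> 'w::real_normed_vector"
  assumes S: "open S" "x \<in> S" and df: "\<And>y. y \<in> S \<Longrightarrow> f differentiable (at y)"
    and h: "((\<lambda>y. frechet_derivative f (at y) u) has_derivative h') (at x)"
    and e: "e > 0"
  shows "\<exists>d>0. \<forall>t. 0 < t \<and> t < d \<longrightarrow>
    norm (f (x + t *\<^sub>R u + t *\<^sub>R v) - f (x + t *\<^sub>R u) - f (x + t *\<^sub>R v) + f x - t\<^sup>2 *\<^sub>R h' v) \<le> e * t\<^sup>2"
proof -
  define F where "F = (\<lambda>y. frechet_derivative f (at y) u)"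
  define M where "M = norm u + norm v + 1"
  have M: "M > 0" by (simp add: M_def add_nonneg_pos)
  \<comment> \<open>The error of the linear approximation of \<open>F\<close> enters twice, each time at distance at most \<open>t * M\<close>.\<close>
  define \<epsilon> where "\<epsilon> = e / (2 * M)"
  have "\<epsilon> > 0" using e M by (simp add: \<epsilon>_def)
  then obtain r where r: "r > 0"
    "\<And>y. norm (y - x) < r \<Longrightarrow> norm (F y - F x - h' (y - x)) \<le> \<epsilon> * norm (y - x)"
    using h unfolding has_derivative_at_alt F_def by meson
  obtain q where q: "q > 0" "ball x q \<subseteq> S" using S by (meson openE)
  have linh: "linear h'" using h has_derivative_linear by blast
  have "norm (f (x + t *\<^sub>R u + t *\<^sub>R v) - f (x + t *\<^sub>R u) - f (x + t *\<^sub>R v) + f x - t\<^sup>2 *\<^sub>R h' v) \<le> e * t\<^sup>2"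
    if t: "0 < t" "t < min r q / M" for t
  proof -
    have tM: "t * M < r" "t * M < q" using t M by (auto simp: field_simps)
    define p where "p = (\<lambda>s k. x + s *\<^sub>R u + k *\<^sub>R v)"
    define g where "g = (\<lambda>s. f (p s t) - f (p s 0) - (s * t) *\<^sub>R h' v)"
    define g' where "g' = (\<lambda>s. F (p s t) - F (p s 0) - t *\<^sub>R h' v)"
    have np: "norm (p s k - x) \<le> t * M" if "0 \<le> s" "s \<le> t" "0 \<le> k" "k \<le> t" for s k
    proof -
      have "norm (p s k - x) \<le> s * norm u + k * norm v"
        using norm_triangle_ineq[of "s *\<^sub>R u" "k *\<^sub>R v"] that by (simp add: p_def)
      also have "\<dots> \<le> t * norm u + t * norm v" using that by (intro add_mono mult_right_mono) auto
      also have "\<dots> \<le> t * M" using t by (simp add: M_def algebra_simps)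
      finally show ?thesis .
    qed
    have der: "((\<lambda>s. f (p s k)) has_derivative (\<lambda>c. c *\<^sub>R F (p s k))) (at s)"
      if "0 \<le> s" "s \<le> t" "0 \<le> k" "k \<le> t" for s k
    proof -
      have "p s k \<in> S" using np[OF that] tM q by (auto simp: subset_eq dist_norm norm_minus_commute)
      then have f: "(f has_derivative frechet_derivative f (at (p s k))) (at (p s k))"
        using df frechet_derivative_works by blast
      have "((\<lambda>s. p s k) has_derivative (\<lambda>c. c *\<^sub>R u)) (at s)"
        unfolding p_def by (auto intro!: derivative_eq_intros)
      from has_derivative_compose[OF this f] show ?thesis
        by (simp add: F_def linear_cmul[OF has_derivative_linear[OF f]])
    qed
    have dg: "(g has_derivative (\<lambda>c. c *\<^sub>R g' s)) (at s within {0..t})" if "s \<in> {0..t}" for s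
    proof -
      have "(g has_derivative (\<lambda>c. c *\<^sub>R F (p s t) - c *\<^sub>R F (p s 0) - (c * t) *\<^sub>R h' v)) (at s)"
        unfolding g_def using that t
        by (intro has_derivative_diff der) (auto intro!: derivative_eq_intros)
      moreover have "(\<lambda>c. c *\<^sub>R F (p s t) - c *\<^sub>R F (p s 0) - (c * t) *\<^sub>R h' v) = (\<lambda>c. c *\<^sub>R g' s)"
        by (simp add: g'_def scaleR_diff_right)
      ultimately show ?thesis by (simp add: has_derivative_at_withinI)
    qed
    have bd: "norm (g' s) \<le> e * t" if s: "s \<in> {0..t}" for s
    proof -
      have 1: "norm (F (p s k) - F x - h' (p s k - x)) \<le> \<epsilon> * (t * M)" if "0 \<le> k" "k \<le> t" for k
      proof -
        have "norm (p s k - x) \<le> t * M" using np s that by auto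
        then show ?thesis using r(2)[of "p s k"] tM \<open>\<epsilon> > 0\<close>
          by (meson le_less_trans mult_left_mono less_imp_le order_trans)
      qed
      have "h' (p s t - x) - h' (p s 0 - x) = t *\<^sub>R h' v"
        using linear_diff[OF linh, of "p s t - x" "p s 0 - x"] by (simp add: p_def linear_cmul[OF linh])
      then have "g' s = (F (p s t) - F x - h' (p s t - x)) - (F (p s 0) - F x - h' (p s 0 - x))"
        unfolding g'_def by (simp add: algebra_simps)
      also have "norm \<dots> \<le> norm (F (p s t) - F x - h' (p s t - x)) + norm (F (p s 0) - F x - h' (p s 0 - x))"
        by (rule norm_triangle_ineq4)
      also have "\<dots> \<le> \<epsilon> * (t * M) + \<epsilon> * (t * M)" using t by (intro add_mono 1) auto
      also have "\<dots> = e * t" using M by (simp add: \<epsilon>_def field_simps)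
      finally show ?thesis .
    qed
    have "norm (g t - g 0) \<le> e * t * norm (t - 0)"
    proof (rule differentiable_bound[OF convex_real_interval(5)[of 0 t] dg])
      fix s assume "s \<in> {0..t}"
      then show "onorm (\<lambda>c. c *\<^sub>R g' s) \<le> e * t"
        using bd by (intro onorm_le) (simp add: mult.commute mult_left_mono)
    qed (use t in auto)
    then show ?thesis using t by (simp add: g_def p_def power2_eq_square algebra_simps)
  qed
  then show ?thesis using r(1) q(1) M by (intro exI[of _ "min r q / M"]) auto
qed

text \<open>
  The second difference is symmetric in \<open>u\<close> and \<open>v\<close>, and divided by \<open>t\<^sup>2\<close> it tends to either second
  derivative.
\<close>

lemma symmetric_second_derivative:
  fixes f :: "'e::real_normed_vector \<Rightarrow> 'w::real_normed_vector"
  assumes S: "open S" "x \<in> S" and df: "\<And>y. y \<in> S \<Longrightarrow> f differentiable (at y)"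
    and h: "((\<lambda>y. frechet_derivative f (at y) u) has_derivative h') (at x)"
    and k: "((\<lambda>y. frechet_derivative f (at y) v) has_derivative k') (at x)"
  shows "h' v = k' u"
proof -
  have "norm (h' v - k' u) \<le> 0 + e" if e: "e > 0" for e
  proof -
    define E where "E = (\<lambda>t. f (x + t *\<^sub>R u + t *\<^sub>R v) - f (x + t *\<^sub>R u) - f (x + t *\<^sub>R v) + f x)"
    obtain d where d: "d > 0" "\<And>t. 0 < t \<Longrightarrow> t < d \<Longrightarrow> norm (E t - t\<^sup>2 *\<^sub>R h' v) \<le> e / 2 * t\<^sup>2"
      using second_difference_quotient[OF S df h, of "e / 2" v] e unfolding E_def by auto
    obtain c where c: "c > 0" "\<And>t. 0 < t \<Longrightarrow> t < c \<Longrightarrow> norm (E t - t\<^sup>2 *\<^sub>R k' u) \<le> e / 2 * t\<^sup>2"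
      using second_difference_quotient[OF S df k, of "e / 2" u] e unfolding E_def
      by (auto simp: algebra_simps)
    obtain t where t: "0 < t" "t < d" "t < c" using d(1) c(1)
      by (metis field_lbound_gt_zero)
    have "t\<^sup>2 * norm (h' v - k' u) = norm (t\<^sup>2 *\<^sub>R (h' v - k' u))" by simp
    also have "t\<^sup>2 *\<^sub>R (h' v - k' u) = (E t - t\<^sup>2 *\<^sub>R k' u) - (E t - t\<^sup>2 *\<^sub>R h' v)"
      by (simp add: algebra_simps)
    also have "norm \<dots> \<le> t\<^sup>2 * e"
      using d(2)[OF t(1,2)] c(2)[OF t(1,3)]
        norm_triangle_ineq4[of "E t - t\<^sup>2 *\<^sub>R k' u" "E t - t\<^sup>2 *\<^sub>R h' v"] by (simp add: algebra_simps)
    finally show ?thesis using t(1) by simp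
  qed
  then have "norm (h' v - k' u) \<le> 0" by (rule field_le_epsilon)
  then show ?thesis by simp
qed

section \<open>Smooth maps and tangent maps\<close>

text \<open>
  The tangent map is defined through preferred charts, so its chain rule only needs charts that are
  homeomorphisms onto open sets.  Model spaces with their identity chart are then on the same
  footing as manifolds, and charts themselves become maps with a tangent map.
\<close>

definition charted :: "('m, 'e::real_normed_vector) mfd \<Rightarrow> bool" where
  "charted M \<longleftrightarrow> pts M = \<Union> (fst ` atlas M) \<and>
     (\<forall>(U, \<phi>) \<in> atlas M. openin (mtop M) U \<and> open (\<phi> ` U) \<and>
        homeomorphic_map (subtopology (mtop M) U) (top_of_set (\<phi> ` U)) \<phi>)"

lemma smooth_manifold_charted: "smooth_manifold M \<Longrightarrow> charted M"
  by (auto simp: smooth_manifold_def charted_def)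

lemma smooth_manifold_finite_dim:
  "smooth_manifold (M :: ('m, 'e::real_normed_vector) mfd) \<Longrightarrow> finite_dim (UNIV :: 'e set)"
  by (simp add: smooth_manifold_def)

lemma charted_vec_mfd: "charted vec_mfd"
  by (auto simp: charted_def vec_mfd_def homeomorphic_map_id[unfolded id_def])

lemma pts_vec_mfd [simp]: "pts vec_mfd = UNIV"
  by (simp add: vec_mfd_def)

lemma mtop_vec_mfd [simp]: "mtop vec_mfd = euclidean"
  by (simp add: vec_mfd_def)

lemma atlas_vec_mfd: "atlas vec_mfd = {(UNIV, \<lambda>x. x)}"
  by (simp add: vec_mfd_def)

lemma chart_subset: "charted M \<Longrightarrow> (U, \<phi>) \<in> atlas M \<Longrightarrow> U \<subseteq> pts M"
  by (auto simp: charted_def)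

lemma chart_open:
  assumes "charted M" "(U, \<phi>) \<in> atlas M"
  shows "openin (mtop M) U" "open (\<phi> ` U)"
  using assms by (auto simp: charted_def)

lemma chart_homeomorphic:
  assumes "charted M" "(U, \<phi>) \<in> atlas M"
  shows "homeomorphic_map (subtopology (mtop M) U) (top_of_set (\<phi> ` U)) \<phi>"
  using assms by (auto simp: charted_def)

lemma topspace_chart:
  assumes "charted M" "(U, \<phi>) \<in> atlas M"
  shows "topspace (subtopology (mtop M) U) = U"
  using chart_subset[OF assms] by auto

lemma chart_inj:
  assumes "charted M" "(U, \<phi>) \<in> atlas M"
  shows "inj_on \<phi> U"
  using chart_homeomorphic[OF assms] topspace_chart[OF assms] homeomorphic_imp_injective_map by metis

lemma chart_inv [simp]:
  assumes "charted M" "(U, \<phi>) \<in> atlas M" "x \<in> U"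
  shows "inv_into U \<phi> (\<phi> x) = x"
  using chart_inj[OF assms(1,2)] assms(3) by simp

lemma open_chart_image:
  assumes "charted M" "(U, \<phi>) \<in> atlas M" "openin (mtop M) A"
  shows "open (\<phi> ` (U \<inter> A))"
proof -
  have "openin (subtopology (mtop M) U) (U \<inter> A)"
    using assms(3) by (auto simp: openin_subtopology Int_commute)
  then have "openin (top_of_set (\<phi> ` U)) (\<phi> ` (U \<inter> A))"
    using homeomorphic_imp_open_map[OF chart_homeomorphic[OF assms(1,2)]] by (simp add: open_map_def)
  then show ?thesis using chart_open(2)[OF assms(1,2)] openin_open_trans by blast
qed

lemma openin_chart_preimage:
  assumes "charted M" "(U, \<phi>) \<in> atlas M" "open B"
  shows "openin (mtop M) {x \<in> U. \<phi> x \<in> B}"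
proof -
  have "continuous_map (subtopology (mtop M) U) (top_of_set (\<phi> ` U)) \<phi>"
    using homeomorphic_imp_continuous_map[OF chart_homeomorphic[OF assms(1,2)]] .
  then have "continuous_map (subtopology (mtop M) U) euclidean \<phi>"
    by (simp add: continuous_map_in_subtopology)
  then have "openin (subtopology (mtop M) U) {x \<in> topspace (subtopology (mtop M) U). \<phi> x \<in> B}"
    using openin_continuous_map_preimage[OF _ open_openin[THEN iffD1, OF assms(3)]] by blast
  then have "openin (subtopology (mtop M) U) {x \<in> U. \<phi> x \<in> B}"
    unfolding topspace_chart[OF assms(1,2)] .
  then show ?thesis using openin_trans_full[OF _ chart_open(1)[OF assms(1,2)]] by blast
qed

abbreviation pref_dom :: "('m, 'e) mfd \<Rightarrow> 'm \<Rightarrow> 'm set" where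
  "pref_dom M x \<equiv> fst (chart_at M x)"
abbreviation pref_chart :: "('m, 'e) mfd \<Rightarrow> 'm \<Rightarrow> 'm \<Rightarrow> 'e" where
  "pref_chart M x \<equiv> snd (chart_at M x)"
abbreviation pref_param :: "('m, 'e) mfd \<Rightarrow> 'm \<Rightarrow> 'e \<Rightarrow> 'm" where
  "pref_param M x \<equiv> inv_into (pref_dom M x) (pref_chart M x)"

lemma chart_at:
  assumes "charted M" "x \<in> pts M"
  shows "(pref_dom M x, pref_chart M x) \<in> atlas M" "x \<in> pref_dom M x"
proof -
  have "\<exists>c. c \<in> atlas M \<and> x \<in> fst c" using assms by (auto simp: charted_def)
  then have "chart_at M x \<in> atlas M \<and> x \<in> fst (chart_at M x)"
    unfolding chart_at_def by (rule someI_ex)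
  then show "(pref_dom M x, pref_chart M x) \<in> atlas M" "x \<in> pref_dom M x" by auto
qed

lemma chart_at_vec_mfd [simp]: "chart_at vec_mfd x = (UNIV, \<lambda>x. x)"
  by (auto simp: chart_at_def vec_mfd_def)

lemma inv_into_UNIV_ident [simp]: "inv_into UNIV (\<lambda>x. x) = (\<lambda>x. x)"
  by (simp add: fun_eq_iff inv_into_f_eq)

lemma tangent_map_pref:
  "tangent_map M N f x =
     frechet_derivative (\<lambda>y. pref_chart N (f x) (f (pref_param M x y))) (at (pref_chart M x x))"
  by (simp add: tangent_map_def split_def o_def Let_def)

text \<open>
  Continuity is a separate clause because the coordinate expression of \<open>f\<close> is only meaningful where
  \<open>f\<close> stays in the preferred chart at \<open>f x\<close>: charts are arbitrary functions off their domain.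
\<close>

definition diff_at ::
    "('m, 'e::real_normed_vector) mfd \<Rightarrow> ('n, 'f::real_normed_vector) mfd \<Rightarrow> ('m \<Rightarrow> 'n) \<Rightarrow> 'm \<Rightarrow> bool" where
  "diff_at M N f x \<longleftrightarrow> x \<in> pts M \<and> f x \<in> pts N \<and>
     (\<forall>V. openin (mtop N) V \<and> f x \<in> V \<longrightarrow> (\<exists>U. openin (mtop M) U \<and> x \<in> U \<and> f ` U \<subseteq> V)) \<and>
     (\<lambda>y. pref_chart N (f x) (f (pref_param M x y))) differentiable (at (pref_chart M x x))"

lemma diff_atD:
  assumes "diff_at M N f x"
  shows "x \<in> pts M" "f x \<in> pts N"
    "((\<lambda>y. pref_chart N (f x) (f (pref_param M x y))) has_derivative tangent_map M N f x)
       (at (pref_chart M x x))"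
  using assms by (auto simp: diff_at_def tangent_map_pref frechet_derivative_works)

lemma diff_at_nbhd:
  assumes "diff_at M N f x" "openin (mtop N) V" "f x \<in> V"
  obtains U where "openin (mtop M) U" "x \<in> U" "f ` U \<subseteq> V"
  using assms unfolding diff_at_def by blast

lemma diff_atI:
  assumes "x \<in> pts M" "f x \<in> pts N"
    "\<And>V. openin (mtop N) V \<Longrightarrow> f x \<in> V \<Longrightarrow> \<exists>U. openin (mtop M) U \<and> x \<in> U \<and> f ` U \<subseteq> V"
    "((\<lambda>y. pref_chart N (f x) (f (pref_param M x y))) has_derivative f') (at (pref_chart M x x))"
  shows "diff_at M N f x" "tangent_map M N f x = f'"
  using assms frechet_derivative_at[OF assms(4)]
  by (auto simp: diff_at_def tangent_map_pref differentiable_def)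

lemma linear_tangent_map: "diff_at M N f x \<Longrightarrow> linear (tangent_map M N f x)"
  by (rule has_derivative_linear[OF diff_atD(3)])

lemma chart_nbhd:
  assumes "charted M" "(U, \<phi>) \<in> atlas M" "openin (mtop M) A" "x \<in> A" "x \<in> U"
  shows "open (\<phi> ` (U \<inter> A))" "\<phi> x \<in> \<phi> ` (U \<inter> A)"
    "\<And>y. y \<in> \<phi> ` (U \<inter> A) \<Longrightarrow> inv_into U \<phi> y \<in> A"
    "\<And>y. y \<in> \<phi> ` (U \<inter> A) \<Longrightarrow> \<phi> (inv_into U \<phi> y) = y"
  using open_chart_image[OF assms(1-3)] assms by auto

lemma tangent_map_compose:
  assumes M: "charted M" and N: "charted N"
    and f: "diff_at M N f x" and g: "diff_at N K g (f x)"
  shows "diff_at M K (\<lambda>x. g (f x)) x"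
    "tangent_map M K (\<lambda>x. g (f x)) x = (\<lambda>v. tangent_map N K g (f x) (tangent_map M N f x v))"
proof -
  note cM = chart_at[OF M diff_atD(1)[OF f]] and cN = chart_at[OF N diff_atD(1)[OF g]]
  obtain A where A: "openin (mtop M) A" "x \<in> A" "f ` A \<subseteq> pref_dom N (f x)"
    using diff_at_nbhd[OF f chart_open(1)[OF N cN(1)] cN(2)] by blast
  note B = chart_nbhd[OF M cM(1) A(1,2) cM(2)]
  define h where "h = (\<lambda>y. pref_chart N (f x) (f (pref_param M x y)))"
  have hx: "h (pref_chart M x x) = pref_chart N (f x) (f x)"
    unfolding h_def using chart_inv[OF M cM] by simp
  have "((\<lambda>y. pref_chart K (g (f x)) (g (pref_param N (f x) (h y)))) has_derivative
      (\<lambda>v. tangent_map N K g (f x) (tangent_map M N f x v))) (at (pref_chart M x x))"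
    by (rule has_derivative_compose[of h])
      (use diff_atD(3)[OF f] diff_atD(3)[OF g] in \<open>simp_all add: hx h_def[symmetric]\<close>)
  then have d: "((\<lambda>y. pref_chart K (g (f x)) (g (f (pref_param M x y)))) has_derivative
      (\<lambda>v. tangent_map N K g (f x) (tangent_map M N f x v))) (at (pref_chart M x x))"
  proof (rule has_derivative_transform_within_open[OF _ B(1,2)])
    fix y assume "y \<in> pref_chart M x ` (pref_dom M x \<inter> A)"
    then have "f (pref_param M x y) \<in> pref_dom N (f x)" using B(3) A(3) by blast
    then show "pref_chart K (g (f x)) (g (pref_param N (f x) (h y))) =
        pref_chart K (g (f x)) (g (f (pref_param M x y)))"
      unfolding h_def using chart_inv[OF N cN(1)] by simp
  qed
  have n: "\<exists>U. openin (mtop M) U \<and> x \<in> U \<and> (\<lambda>x. g (f x)) ` U \<subseteq> V"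
    if V: "openin (mtop K) V" "g (f x) \<in> V" for V
  proof -
    obtain W where W: "openin (mtop N) W" "f x \<in> W" "g ` W \<subseteq> V" using diff_at_nbhd[OF g V] by blast
    obtain U where "openin (mtop M) U" "x \<in> U" "f ` U \<subseteq> W" using diff_at_nbhd[OF f W(1,2)] by blast
    then show ?thesis using W(3) by (intro exI[of _ U]) auto
  qed
  show "diff_at M K (\<lambda>x. g (f x)) x"
    "tangent_map M K (\<lambda>x. g (f x)) x = (\<lambda>v. tangent_map N K g (f x) (tangent_map M N f x v))"
    by (rule diff_atI[OF diff_atD(1)[OF f] diff_atD(2)[OF g] n d]; assumption)+
qed

lemma tangent_map_cong:
  assumes M: "charted M" and A: "openin (mtop M) A" "x \<in> A" and eq: "\<And>y. y \<in> A \<Longrightarrow> f y = g y"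
    and f: "diff_at M N f x"
  shows "diff_at M N g x" "tangent_map M N g x = tangent_map M N f x"
proof -
  note cM = chart_at[OF M diff_atD(1)[OF f]]
  note B = chart_nbhd[OF M cM(1) A cM(2)]
  have d: "((\<lambda>y. pref_chart N (g x) (g (pref_param M x y))) has_derivative tangent_map M N f x)
      (at (pref_chart M x x))"
    by (rule has_derivative_transform_within_open[OF diff_atD(3)[OF f] B(1,2)])
      (simp add: eq[OF A(2)] eq[OF B(3)])
  have n: "\<exists>U. openin (mtop M) U \<and> x \<in> U \<and> g ` U \<subseteq> V"
    if V: "openin (mtop N) V" "g x \<in> V" for V
  proof -
    obtain U where U: "openin (mtop M) U" "x \<in> U" "f ` U \<subseteq> V"
      using diff_at_nbhd[OF f V(1)] V(2) eq[OF A(2)] by auto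
    then have "g ` (U \<inter> A) \<subseteq> V" using eq by force
    then show ?thesis using U A by (intro exI[of _ "U \<inter> A"]) auto
  qed
  have x: "x \<in> pts M" "g x \<in> pts N" using diff_atD(1,2)[OF f] eq[OF A(2)] by auto
  show "diff_at M N g x" "tangent_map M N g x = tangent_map M N f x"
    by (rule diff_atI[OF x n d]; assumption)+
qed

lemma tangent_map_ident:
  assumes M: "charted M" and "x \<in> pts M"
  shows "diff_at M M (\<lambda>x. x) x" "tangent_map M M (\<lambda>x. x) x = (\<lambda>v. v)"
proof -
  note cM = chart_at[OF assms]
  have op: "openin (mtop M) (pts M)" by simp
  note B = chart_nbhd[OF M cM(1) op assms(2) cM(2)]
  have d: "((\<lambda>y. pref_chart M x (pref_param M x y)) has_derivative (\<lambda>v. v)) (at (pref_chart M x x))"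
    by (rule has_derivative_transform_within_open[OF has_derivative_ident B(1,2)]) (simp add: B(4))
  have n: "\<exists>U. openin (mtop M) U \<and> x \<in> U \<and> (\<lambda>x. x) ` U \<subseteq> V"
    if "openin (mtop M) V" "x \<in> V" for V
    using that by auto
  show "diff_at M M (\<lambda>x. x) x" "tangent_map M M (\<lambda>x. x) x = (\<lambda>v. v)"
    by (rule diff_atI[OF assms(2) assms(2) n d]; assumption)+
qed

lemma tangent_map_inverse:
  assumes M: "charted M" and N: "charted N"
    and f: "diff_at M N f x" and g: "diff_at N M g (f x)"
    and A: "openin (mtop M) A" "x \<in> A" "\<And>y. y \<in> A \<Longrightarrow> g (f y) = y"
  shows "tangent_map N M g (f x) (tangent_map M N f x v) = v"
proof -
  note c = tangent_map_compose[OF M N f g]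
  have "tangent_map M M (\<lambda>x. x) x = tangent_map M M (\<lambda>x. g (f x)) x"
    using tangent_map_cong(2)[OF M A(1,2) _ c(1), of "\<lambda>x. x"] A(3) by blast
  then show ?thesis unfolding c(2) tangent_map_ident(2)[OF M diff_atD(1)[OF f]] by metis
qed

lemma diff_at_vec_mfd:
  "diff_at vec_mfd vec_mfd f y \<longleftrightarrow> f differentiable (at y)"
  "tangent_map vec_mfd vec_mfd f y = frechet_derivative f (at y)"
proof -
  show "tangent_map vec_mfd vec_mfd f y = frechet_derivative f (at y)"
    by (simp add: tangent_map_pref)
  have "\<exists>U. open U \<and> y \<in> U \<and> f ` U \<subseteq> V" if "f differentiable (at y)" "open V" "f y \<in> V" for V
    using differentiable_imp_continuous_within[OF that(1)] that(2,3)
    unfolding continuous_at_open by (meson image_subsetI)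
  then show "diff_at vec_mfd vec_mfd f y \<longleftrightarrow> f differentiable (at y)"
    by (auto simp: diff_at_def)
qed

lemma smooth_on_differentiable: "smooth_on S f \<Longrightarrow> x \<in> S \<Longrightarrow> f differentiable (at x)"
  unfolding smooth_on_def by (metis Ck_on.simps(2))

lemma smooth_map_coordinates:
  assumes "smooth_map M N f" "(U, \<phi>) \<in> atlas M" "(V, \<psi>) \<in> atlas N"
  shows "smooth_on (\<phi> ` (U \<inter> f -` V)) (\<lambda>y. \<psi> (f (inv_into U \<phi> y)))"
  using assms unfolding smooth_map_def by (fastforce simp: o_def)

lemma smooth_mapI:
  assumes "continuous_map (mtop M) (mtop N) f"
    and "\<And>U \<phi> V \<psi>. (U, \<phi>) \<in> atlas M \<Longrightarrow> (V, \<psi>) \<in> atlas N \<Longrightarrow>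
      smooth_on (\<phi> ` (U \<inter> f -` V)) (\<lambda>y. \<psi> (f (inv_into U \<phi> y)))"
  shows "smooth_map M N f"
  using assms unfolding smooth_map_def by (auto simp: o_def)

lemma smooth_map_nbhd:
  assumes "smooth_map M N f" "openin (mtop N) V"
  shows "openin (mtop M) {x \<in> pts M. f x \<in> V}"
  using assms openin_continuous_map_preimage unfolding smooth_map_def by blast

lemma open_smooth_map_chart:
  assumes M: "charted M" "(U, \<phi>) \<in> atlas M" and f: "continuous_map (mtop M) (mtop N) f"
    and V: "openin (mtop N) V"
  shows "open (\<phi> ` (U \<inter> f -` V))"
proof -
  have "U \<inter> f -` V = U \<inter> {x \<in> pts M. f x \<in> V}" using chart_subset[OF M] by auto
  then show ?thesis using open_chart_image[OF M openin_continuous_map_preimage[OF f V]] by simp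
qed

lemma smooth_map_diff_at:
  assumes M: "charted M" and N: "charted N" and f: "smooth_map M N f" and x: "x \<in> pts M"
  shows "diff_at M N f x"
proof -
  have fx: "f x \<in> pts N" using f x by (auto simp: smooth_map_def continuous_map_def)
  note cM = chart_at[OF M x] and cN = chart_at[OF N fx]
  have "(\<lambda>y. pref_chart N (f x) (f (pref_param M x y))) differentiable (at (pref_chart M x x))"
    by (rule smooth_on_differentiable[OF smooth_map_coordinates[OF f cM(1) cN(1)]])
      (use cM(2) cN(2) in auto)
  moreover have "\<exists>U. openin (mtop M) U \<and> x \<in> U \<and> f ` U \<subseteq> V" if "openin (mtop N) V" "f x \<in> V" for V
    using smooth_map_nbhd[OF f that(1)] x that(2) by (intro exI[of _ "{x \<in> pts M. f x \<in> V}"]) auto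
  ultimately show ?thesis using x fx by (simp add: diff_at_def)
qed

lemma transition_smooth:
  assumes "smooth_manifold M" "(U, \<phi>) \<in> atlas M" "(V, \<psi>) \<in> atlas M"
  shows "smooth_on (\<phi> ` (U \<inter> V)) (\<lambda>y. \<psi> (inv_into U \<phi> y))"
  using assms unfolding smooth_manifold_def by (fastforce simp: o_def)

text \<open>
  The coordinate expression of a chart in a preferred chart is a transition function.
\<close>

lemma chart_diff_at:
  assumes M: "smooth_manifold M" and c: "(U, \<phi>) \<in> atlas M" and x: "x \<in> U"
  shows "diff_at M vec_mfd \<phi> x" "diff_at vec_mfd M (inv_into U \<phi>) (\<phi> x)"
proof -
  note ch = smooth_manifold_charted[OF M]
  have xM: "x \<in> pts M" using chart_subset[OF ch c] x by auto
  note cM = chart_at[OF ch xM]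
  have "\<exists>A. openin (mtop M) A \<and> x \<in> A \<and> \<phi> ` A \<subseteq> B" if "open B" "\<phi> x \<in> B" for B
    using openin_chart_preimage[OF ch c that(1)] x that(2) by (intro exI[of _ "{x \<in> U. \<phi> x \<in> B}"]) auto
  moreover have "(\<lambda>y. \<phi> (pref_param M x y)) differentiable (at (pref_chart M x x))"
    by (rule smooth_on_differentiable[OF transition_smooth[OF M cM(1) c]]) (use cM(2) x in auto)
  ultimately show "diff_at M vec_mfd \<phi> x" using xM by (simp add: diff_at_def)
  have "\<exists>B. open B \<and> \<phi> x \<in> B \<and> inv_into U \<phi> ` B \<subseteq> A" if "openin (mtop M) A" "x \<in> A" for A
    using chart_nbhd[OF ch c that x] by (intro exI[of _ "\<phi> ` (U \<inter> A)"]) blast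
  moreover have "(\<lambda>y. pref_chart M x (inv_into U \<phi> y)) differentiable (at (\<phi> x))"
    by (rule smooth_on_differentiable[OF transition_smooth[OF M c cM(1)]]) (use cM(2) x in auto)
  ultimately show "diff_at vec_mfd M (inv_into U \<phi>) (\<phi> x)"
    using xM x by (simp add: diff_at_def chart_inv[OF ch c])
qed

lemma chart_tangent_inverse:
  assumes M: "smooth_manifold M" and c: "(U, \<phi>) \<in> atlas M" and x: "x \<in> U"
  shows "tangent_map vec_mfd M (inv_into U \<phi>) (\<phi> x) (tangent_map M vec_mfd \<phi> x v) = v"
    "tangent_map M vec_mfd \<phi> x (tangent_map vec_mfd M (inv_into U \<phi>) (\<phi> x) w) = w"
proof -
  note ch = smooth_manifold_charted[OF M]
  note d = chart_diff_at[OF M c x]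
  show "tangent_map vec_mfd M (inv_into U \<phi>) (\<phi> x) (tangent_map M vec_mfd \<phi> x v) = v"
    by (rule tangent_map_inverse[OF ch charted_vec_mfd d chart_open(1)[OF ch c] x])
      (simp add: chart_inv[OF ch c])
  have d1: "diff_at M vec_mfd \<phi> (inv_into U \<phi> (\<phi> x))"
    using d(1) chart_inv[OF ch c x] by simp
  have "tangent_map M vec_mfd \<phi> (inv_into U \<phi> (\<phi> x))
      (tangent_map vec_mfd M (inv_into U \<phi>) (\<phi> x) w) = w"
    by (rule tangent_map_inverse[OF charted_vec_mfd ch d(2) d1, of "\<phi> ` U"])
      (use x chart_open(2)[OF ch c] in \<open>auto simp: f_inv_into_f\<close>)
  then show "tangent_map M vec_mfd \<phi> x (tangent_map vec_mfd M (inv_into U \<phi>) (\<phi> x) w) = w"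
    using chart_inv[OF ch c x] by simp
qed

lemma pref_chart_tangent:
  assumes M: "charted M" and x: "x \<in> pts M"
  shows "tangent_map M vec_mfd (pref_chart M x) x = (\<lambda>v. v)"
    "tangent_map vec_mfd M (pref_param M x) (pref_chart M x x) = (\<lambda>v. v)"
proof -
  note cM = chart_at[OF assms]
  have op: "openin (mtop M) (pts M)" by simp
  note B = chart_nbhd[OF M cM(1) op x cM(2)]
  have "((\<lambda>y. pref_chart M x (pref_param M x y)) has_derivative (\<lambda>v. v)) (at (pref_chart M x x))"
    by (rule has_derivative_transform_within_open[OF has_derivative_ident B(1,2)]) (simp add: B(4))
  note d = frechet_derivative_at[OF this, symmetric]
  show "tangent_map M vec_mfd (pref_chart M x) x = (\<lambda>v. v)"
    "tangent_map vec_mfd M (pref_param M x) (pref_chart M x x) = (\<lambda>v. v)"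
    by (simp_all add: tangent_map_pref chart_inv[OF M cM] d)
qed

text \<open>
  The derivative of a coordinate expression in an arbitrary chart, in terms of the tangent map, which
  is defined through the preferred charts.
\<close>

lemma tangent_map_in_chart:
  assumes M: "smooth_manifold M" and c: "(U, \<phi>) \<in> atlas M" and x: "x \<in> U"
    and f: "diff_at M vec_mfd f x"
  shows "frechet_derivative (\<lambda>y. f (inv_into U \<phi> y)) (at (\<phi> x)) v =
    tangent_map M vec_mfd f x (tangent_map vec_mfd M (inv_into U \<phi>) (\<phi> x) v)"
proof -
  note ch = smooth_manifold_charted[OF M]
  have "diff_at M vec_mfd f (inv_into U \<phi> (\<phi> x))" using f chart_inv[OF ch c x] by simp
  from tangent_map_compose(2)[OF charted_vec_mfd ch chart_diff_at(2)[OF M c x] this]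
  show ?thesis by (simp add: diff_at_vec_mfd(2) chart_inv[OF ch c x])
qed

lemma smooth_on_subset: "smooth_on S f \<Longrightarrow> T \<subseteq> S \<Longrightarrow> smooth_on T f"
  by (auto simp: smooth_on_def intro: Ck_on_subset)

lemma smooth_on_cong:
  "open S \<Longrightarrow> smooth_on S f \<Longrightarrow> (\<And>x. x \<in> S \<Longrightarrow> f x = g x) \<Longrightarrow> smooth_on S g"
  unfolding smooth_on_def using Ck_on_cong by blast

lemma smooth_on_local:
  "(\<And>x. x \<in> S \<Longrightarrow> \<exists>T. open T \<and> x \<in> T \<and> T \<subseteq> S \<and> smooth_on T f) \<Longrightarrow> smooth_on S f"
  unfolding smooth_on_def by (intro allI Ck_on_local) blast

lemma smooth_on_compose:
  fixes f :: "'a::real_normed_vector \<Rightarrow> 'e::real_normed_vector"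
  assumes "finite_dim (UNIV :: 'e set)" "open U" "smooth_on U f" "smooth_on T g" "f ` U \<subseteq> T"
  shows "smooth_on U (\<lambda>x. g (f x))"
  using assms Ck_on_compose[OF assms(1,2)] unfolding smooth_on_def by blast

text \<open>
  Smoothness is local, and near each point the composite is read through one chart of the middle
  manifold.
\<close>

lemma smooth_map_compose:
  assumes M: "charted M" and N: "smooth_manifold N" and K: "charted K"
    and f: "smooth_map M N f" and g: "smooth_map N K g"
  shows "smooth_map M K (\<lambda>x. g (f x))"
proof (rule smooth_mapI)
  note chN = smooth_manifold_charted[OF N]
  have cf: "continuous_map (mtop M) (mtop N) f" using f by (simp add: smooth_map_def)
  show cgf: "continuous_map (mtop M) (mtop K) (\<lambda>x. g (f x))"
    using continuous_map_compose[OF cf, of "mtop K" g] g by (simp add: smooth_map_def o_def)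
  fix U \<phi> W \<kappa> assume U: "(U, \<phi>) \<in> atlas M" and W: "(W, \<kappa>) \<in> atlas K"
  show "smooth_on (\<phi> ` (U \<inter> (\<lambda>x. g (f x)) -` W)) (\<lambda>y. \<kappa> (g (f (inv_into U \<phi> y))))"
  proof (rule smooth_on_local)
    fix y assume "y \<in> \<phi> ` (U \<inter> (\<lambda>x. g (f x)) -` W)"
    then obtain x where x: "x \<in> U" "g (f x) \<in> W" "y = \<phi> x" by auto
    have fx: "f x \<in> pts N"
      using x(1) chart_subset[OF M U] cf by (auto simp: continuous_map_def)
    note V = chart_at[OF chN fx]
    let ?V = "pref_dom N (f x)" and ?\<psi> = "pref_chart N (f x)"
    define T where "T = \<phi> ` (U \<inter> f -` ({z \<in> pts N. g z \<in> W} \<inter> ?V))"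
    have oW: "openin (mtop N) ({z \<in> pts N. g z \<in> W} \<inter> ?V)"
      by (intro openin_Int smooth_map_nbhd[OF g chart_open(1)[OF K W]] chart_open(1)[OF chN V(1)])
    have T: "open T" unfolding T_def by (rule open_smooth_map_chart[OF M U cf oW])
    have "smooth_on T (\<lambda>y. ?\<psi> (f (inv_into U \<phi> y)))"
      by (rule smooth_on_subset[OF smooth_map_coordinates[OF f U V(1)]]) (auto simp: T_def)
    then have "smooth_on T (\<lambda>y. \<kappa> (g (inv_into ?V ?\<psi> (?\<psi> (f (inv_into U \<phi> y))))))"
    proof (rule smooth_on_compose[OF smooth_manifold_finite_dim[OF N] T _ smooth_map_coordinates[OF g V(1) W]])
      show "(\<lambda>y. ?\<psi> (f (inv_into U \<phi> y))) ` T \<subseteq> ?\<psi> ` (?V \<inter> g -` W)"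
        by (auto simp: T_def chart_inv[OF M U])
    qed
    then have "smooth_on T (\<lambda>y. \<kappa> (g (f (inv_into U \<phi> y))))"
      by (rule smooth_on_cong[OF T]) (auto simp: T_def chart_inv[OF M U] chart_inv[OF chN V(1)])
    moreover have "y \<in> T" "T \<subseteq> \<phi> ` (U \<inter> (\<lambda>x. g (f x)) -` W)"
      using x fx V(2) by (auto simp: T_def)
    ultimately show "\<exists>T. open T \<and> y \<in> T \<and> T \<subseteq> \<phi> ` (U \<inter> (\<lambda>x. g (f x)) -` W) \<and>
        smooth_on T (\<lambda>y. \<kappa> (g (f (inv_into U \<phi> y))))"
      using T by blast
  qed
qed

lemma smooth_map_vec_iff:
  assumes M: "charted M"
  shows "smooth_map M vec_mfd f \<longleftrightarrow>
    (\<forall>U \<phi>. (U, \<phi>) \<in> atlas M \<longrightarrow> smooth_on (\<phi> ` U) (\<lambda>y. f (inv_into U \<phi> y)))"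
    (is "_ \<longleftrightarrow> ?R")
proof
  assume "smooth_map M vec_mfd f"
  from smooth_map_coordinates[OF this, of _ _ UNIV "\<lambda>x. x"]
  show ?R by (auto simp: atlas_vec_mfd)
next
  assume R: ?R
  have "continuous_map (mtop M) euclidean f"
    unfolding continuous_map_def
  proof (intro conjI allI impI)
    fix B :: "'c set" assume "openin euclidean B"
    then have B: "open B" by simp
    show "openin (mtop M) {x \<in> pts M. f x \<in> B}"
    proof (subst openin_subopen, intro ballI)
      fix x assume x: "x \<in> {x \<in> pts M. f x \<in> B}"
      then have xM: "x \<in> pts M" by simp
      note c = chart_at[OF M xM]
      let ?U = "pref_dom M x" and ?\<phi> = "pref_chart M x"
      have "smooth_on (?\<phi> ` ?U) (\<lambda>y. f (inv_into ?U ?\<phi> y))" using R c(1) by blast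
      then have "continuous_on (?\<phi> ` ?U) (\<lambda>y. f (inv_into ?U ?\<phi> y))"
        unfolding smooth_on_def using Ck_on_continuous by blast
      then have "open ((\<lambda>y. f (inv_into ?U ?\<phi> y)) -` B \<inter> ?\<phi> ` ?U)"
        using continuous_on_open_vimage[OF chart_open(2)[OF M c(1)]] B by blast
      note o = openin_chart_preimage[OF M c(1) this]
      moreover have "{z \<in> ?U. ?\<phi> z \<in> (\<lambda>y. f (inv_into ?U ?\<phi> y)) -` B \<inter> ?\<phi> ` ?U} = {z \<in> ?U. f z \<in> B}"
        by (intro Collect_cong conj_cong) (simp_all add: chart_inv[OF M c(1)])
      ultimately have "openin (mtop M) {z \<in> ?U. f z \<in> B}" by simp
      then show "\<exists>T. openin (mtop M) T \<and> x \<in> T \<and> T \<subseteq> {x \<in> pts M. f x \<in> B}"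
        using x c(2) chart_subset[OF M c(1)] by (intro exI[of _ "{z \<in> ?U. f z \<in> B}"]) auto
    qed
  qed auto
  moreover have "f -` UNIV = UNIV" by simp
  ultimately show "smooth_map M vec_mfd f"
    using R unfolding smooth_map_def by (auto simp: atlas_vec_mfd o_def)
qed

lemma finite_dim_prod:
  assumes "finite_dim (UNIV :: 'e::real_vector set)" "finite_dim (UNIV :: 'f::real_vector set)"
  shows "finite_dim (UNIV :: ('e \<times> 'f) set)"
proof -
  obtain A :: "'e set" and B :: "'f set" where AB: "finite A" "span A = UNIV" "finite B" "span B = UNIV"
    using assms unfolding finite_dim_def by (metis top.extremum_uniqueI)
  define C where "C = (\<lambda>a. (a, 0)) ` A \<union> Pair 0 ` B"
  have "z \<in> span C" for z :: "'e \<times> 'f"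
  proof -
    have l1: "linear (\<lambda>a::'e. (a, 0::'f))" and l2: "linear (Pair (0::'e) :: 'f \<Rightarrow> 'e \<times> 'f)"
      by (auto simp: linear_iff)
    have "(fst z, 0 :: 'f) \<in> span ((\<lambda>a. (a, 0)) ` A)" "(0 :: 'e, snd z) \<in> span (Pair 0 ` B)"
      by (simp_all add: span_linear_image[OF l1] span_linear_image[OF l2] AB)
    then have "(fst z, 0) \<in> span C" "(0, snd z) \<in> span C"
      unfolding C_def by (meson in_mono span_mono sup_ge1 sup_ge2)+
    from span_add[OF this] show ?thesis by simp
  qed
  then show ?thesis unfolding finite_dim_def
    using AB by (intro exI[of _ C]) (auto simp: C_def)
qed

lemma smooth_map_fix_argument:
  fixes M :: "('m, 'e::real_normed_vector) mfd" and N :: "('n, 'f::real_normed_vector) mfd"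
  assumes M: "smooth_manifold M" and N: "smooth_manifold N" and K: "charted K"
    and f: "smooth_map (prod_mfd M N) K f"
  shows "y \<in> pts N \<Longrightarrow> smooth_map M K (\<lambda>x. f (x, y))"
    and "x \<in> pts M \<Longrightarrow> smooth_map N K (\<lambda>y. f (x, y))"
proof -
  note chM = smooth_manifold_charted[OF M] and chN = smooth_manifold_charted[OF N]
  have fd: "finite_dim (UNIV :: ('e \<times> 'f) set)"
    by (rule finite_dim_prod[OF smooth_manifold_finite_dim[OF M] smooth_manifold_finite_dim[OF N]])
  have cf: "continuous_map (prod_topology (mtop M) (mtop N)) (mtop K) f"
    using f by (simp add: smooth_map_def prod_mfd_def)
  have inv: "inv_into (U \<times> V) (map_prod \<phi> \<psi>) (\<phi> x, \<psi> y) = (x, y)"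
    if "(U, \<phi>) \<in> atlas M" "(V, \<psi>) \<in> atlas N" "x \<in> U" "y \<in> V" for U \<phi> V \<psi> x y
    by (rule inv_into_f_eq)
      (use that chart_inj[OF chM that(1)] chart_inj[OF chN that(2)] in \<open>auto simp: map_prod_inj_on\<close>)
  have sm: "smooth_on (map_prod \<phi> \<psi> ` ((U \<times> V) \<inter> f -` W))
      (\<lambda>z. \<kappa> (f (inv_into (U \<times> V) (map_prod \<phi> \<psi>) z)))"
    if "(U, \<phi>) \<in> atlas M" "(V, \<psi>) \<in> atlas N" "(W, \<kappa>) \<in> atlas K" for U \<phi> V \<psi> W \<kappa>
    by (rule smooth_map_coordinates[OF f _ that(3)]) (use that in \<open>auto simp: prod_mfd_def\<close>)
  show "smooth_map M K (\<lambda>x. f (x, y))" if y: "y \<in> pts N"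
  proof (rule smooth_mapI)
    show c: "continuous_map (mtop M) (mtop K) (\<lambda>x. f (x, y))"
      using continuous_map_compose[OF _ cf, of "mtop M" "\<lambda>x. (x, y)"] y
      by (simp add: o_def continuous_map_paired)
    fix U \<phi> W \<kappa> assume U: "(U, \<phi>) \<in> atlas M" and W: "(W, \<kappa>) \<in> atlas K"
    note V = chart_at[OF chN y]
    let ?S = "\<phi> ` (U \<inter> (\<lambda>x. f (x, y)) -` W)"
    let ?\<psi> = "pref_chart N y"
    have S: "open ?S" by (rule open_smooth_map_chart[OF chM U c chart_open(1)[OF K W]])
    have j: "smooth_on ?S (\<lambda>z. (z, ?\<psi> y))"
      unfolding smooth_on_def by (intro allI Ck_on_Pair Ck_on_id Ck_on_const S)
    have "smooth_on ?S (\<lambda>z. \<kappa> (f (inv_into (U \<times> pref_dom N y) (map_prod \<phi> ?\<psi>) (z, ?\<psi> y))))"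
      by (rule smooth_on_compose[OF fd S j sm[OF U V(1) W]]) (use V(2) in force)
    then show "smooth_on ?S (\<lambda>z. \<kappa> (f (inv_into U \<phi> z, y)))"
      by (rule smooth_on_cong[OF S]) (use V(2) in \<open>auto simp: inv[OF U V(1)] chart_inv[OF chM U]\<close>)
  qed
  show "smooth_map N K (\<lambda>y. f (x, y))" if x: "x \<in> pts M"
  proof (rule smooth_mapI)
    show c: "continuous_map (mtop N) (mtop K) (\<lambda>y. f (x, y))"
      using continuous_map_compose[OF _ cf, of "mtop N" "\<lambda>y. (x, y)"] x
      by (simp add: o_def continuous_map_paired)
    fix V \<psi> W \<kappa> assume V: "(V, \<psi>) \<in> atlas N" and W: "(W, \<kappa>) \<in> atlas K"
    note U = chart_at[OF chM x]
    let ?S = "\<psi> ` (V \<inter> (\<lambda>y. f (x, y)) -` W)"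
    let ?\<phi> = "pref_chart M x"
    have S: "open ?S" by (rule open_smooth_map_chart[OF chN V c chart_open(1)[OF K W]])
    have j: "smooth_on ?S (\<lambda>z. (?\<phi> x, z))"
      unfolding smooth_on_def by (intro allI Ck_on_Pair Ck_on_id Ck_on_const S)
    have "smooth_on ?S (\<lambda>z. \<kappa> (f (inv_into (pref_dom M x \<times> V) (map_prod ?\<phi> \<psi>) (?\<phi> x, z))))"
      by (rule smooth_on_compose[OF fd S j sm[OF U(1) V W]]) (use U(2) in force)
    then show "smooth_on ?S (\<lambda>z. \<kappa> (f (x, inv_into V \<psi> z)))"
      by (rule smooth_on_cong[OF S]) (use U(2) in \<open>auto simp: inv[OF U(1) V] chart_inv[OF chN V]\<close>)
  qed
qed

section \<open>The adjoint action and the Killing form\<close>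

lemma lie_groupD:
  assumes "lie_group G"
  shows "group (grp G)" "smooth_manifold (gmfd G)" "charted (gmfd G)" "pts (gmfd G) = gcarrier G"
  using assms by (auto simp: lie_group_def intro: smooth_manifold_charted)

abbreviation gconj :: "('a, 'g) lgroup \<Rightarrow> 'a \<Rightarrow> 'a \<Rightarrow> 'a" where
  "gconj G h x \<equiv> gmult G (gmult G h x) (ginv G h)"

lemma smooth_mult:
  assumes G: "lie_group G" and h: "h \<in> gcarrier G"
  shows "smooth_map (gmfd G) (gmfd G) (gmult G h)"
    "smooth_map (gmfd G) (gmfd G) (gconj G h)"
proof -
  note G' = lie_groupD[OF G]
  have m: "smooth_map (prod_mfd (gmfd G) (gmfd G)) (gmfd G) (\<lambda>(x, y). gmult G x y)"
    using G by (simp add: lie_group_def)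
  note fix_arg = smooth_map_fix_argument[OF G'(2,2,3) m, unfolded split_conv G'(4)]
  show l: "smooth_map (gmfd G) (gmfd G) (gmult G h)" using fix_arg(2)[OF h] .
  have "ginv G h \<in> gcarrier G" using G'(1) h by (simp add: group.inv_closed)
  from smooth_map_compose[OF G'(3,2,3) l fix_arg(1)[OF this]]
  show "smooth_map (gmfd G) (gmfd G) (gconj G h)" .
qed

lemma gconj_facts:
  assumes "group (grp G)"
  shows "h \<in> gcarrier G \<Longrightarrow> gconj G h (gone G) = gone G"
    "h \<in> gcarrier G \<Longrightarrow> k \<in> gcarrier G \<Longrightarrow> x \<in> gcarrier G \<Longrightarrow>
      gconj G h (gconj G k x) = gconj G (gmult G h k) x"
    "x \<in> gcarrier G \<Longrightarrow> gconj G (gone G) x = x"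
    "h \<in> gcarrier G \<Longrightarrow> x \<in> gcarrier G \<Longrightarrow> y \<in> gcarrier G \<Longrightarrow>
      gconj G h (gmult G x y) = gmult G (gconj G h x) (gconj G h y)"
proof -
  interpret group "grp G" by (rule assms)
  show "gconj G h (gone G) = gone G" if "h \<in> gcarrier G" using that by (simp add: r_inv)
  show "gconj G (gone G) x = x" if "x \<in> gcarrier G" using that by simp
  show "gconj G h (gconj G k x) = gconj G (gmult G h k) x"
    if "h \<in> gcarrier G" "k \<in> gcarrier G" "x \<in> gcarrier G"
    using that by (simp add: inv_mult_group m_assoc)
  show "gconj G h (gmult G x y) = gmult G (gconj G h x) (gconj G h y)"
    if "h \<in> gcarrier G" "x \<in> gcarrier G" "y \<in> gcarrier G"
  proof -
    have "gmult G (ginv G h) (gmult G h (gmult G y (ginv G h))) = gmult G y (ginv G h)"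
      using that by (simp add: m_assoc[symmetric] l_inv)
    then show ?thesis using that by (simp add: m_assoc)
  qed
qed

lemma one_in_group: "lie_group G \<Longrightarrow> gone G \<in> gcarrier G"
  using lie_groupD(1) group.is_monoid monoid.one_closed by metis

lemma gconj_diff_at:
  assumes G: "lie_group G" and "h \<in> gcarrier G" "x \<in> gcarrier G"
  shows "diff_at (gmfd G) (gmfd G) (gconj G h) x"
  using smooth_map_diff_at[OF _ _ smooth_mult(2)[OF assms(1,2)]] lie_groupD[OF G] assms by auto

text \<open>
  Functoriality of the tangent map, applied to conjugations, which all fix the identity.
\<close>

lemma Ad_mult:
  assumes G: "lie_group G" and h: "h \<in> gcarrier G" and k: "k \<in> gcarrier G"
  shows "Ad G (gmult G h k) A = Ad G h (Ad G k A)"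
proof -
  note G' = lie_groupD[OF G] and one = one_in_group[OF G]
  have k1: "gconj G k (gone G) = gone G" using gconj_facts(1)[OF G'(1) k] .
  have d: "diff_at (gmfd G) (gmfd G) (gconj G h) (gconj G k (gone G))"
    unfolding k1 by (rule gconj_diff_at[OF G h one])
  note c = tangent_map_compose[OF G'(3,3) gconj_diff_at[OF G k one] d]
  have "openin (mtop (gmfd G)) (gcarrier G)" using G'(4) by (metis openin_topspace)
  from tangent_map_cong(2)[OF G'(3) this one _ c(1), of "gconj G (gmult G h k)"] gconj_facts(2)[OF G'(1) h k]
  show ?thesis unfolding Ad_def c(2) k1 by simp
qed

lemma Ad_one:
  assumes G: "lie_group G"
  shows "Ad G (gone G) A = A"
proof -
  note G' = lie_groupD[OF G] and one = one_in_group[OF G]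
  have o: "openin (mtop (gmfd G)) (gcarrier G)" using G'(4) by (metis openin_topspace)
  note i = tangent_map_ident[OF G'(3), of "gone G", unfolded G'(4), OF one]
  have "tangent_map (gmfd G) (gmfd G) (gconj G (gone G)) (gone G) = (\<lambda>v. v)"
    using tangent_map_cong(2)[OF G'(3) o one _ i(1), of "gconj G (gone G)"] i(2)
      gconj_facts(3)[OF G'(1)] by simp
  then show ?thesis by (simp add: Ad_def)
qed

lemma Ad_inv:
  assumes G: "lie_group G" and h: "h \<in> gcarrier G"
  shows "Ad G h (Ad G (ginv G h) A) = A" "Ad G (ginv G h) (Ad G h A) = A"
proof -
  interpret group "grp G" by (rule lie_groupD[OF G])
  show "Ad G h (Ad G (ginv G h) A) = A" "Ad G (ginv G h) (Ad G h A) = A"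
    using h Ad_one[OF G] by (simp_all add: Ad_mult[OF G, symmetric])
qed

lemma linear_Ad: "lie_group G \<Longrightarrow> h \<in> gcarrier G \<Longrightarrow> linear (Ad G h)"
  unfolding Ad_def using linear_tangent_map gconj_diff_at one_in_group by metis

abbreviation left_inv_rep :: "('a, 'g::real_normed_vector) lgroup \<Rightarrow> 'g \<Rightarrow> 'g \<Rightarrow> 'g" where
  "left_inv_rep G A \<equiv> local_rep (gmfd G) (chart_at (gmfd G) (gone G)) (left_inv_field G A)"

definition left_inv_deriv :: "('a, 'g::real_normed_vector) lgroup \<Rightarrow> 'g \<Rightarrow> 'g \<Rightarrow> 'g" where
  "left_inv_deriv G A =
     frechet_derivative (left_inv_rep G A) (at (pref_chart (gmfd G) (gone G) (gone G)))"

lemma left_mult_diff_at: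
  assumes G: "lie_group G" and "h \<in> gcarrier G" "x \<in> gcarrier G"
  shows "diff_at (gmfd G) (gmfd G) (gmult G h) x"
  using smooth_map_diff_at[OF _ _ smooth_mult(1)[OF assms(1,2)]] lie_groupD[OF G] assms by auto

context
  fixes G :: "('a, 'g::real_normed_vector) lgroup" and U \<phi>
  assumes G: "lie_group G"
  defines "U \<equiv> pref_dom (gmfd G) (gone G)" and "\<phi> \<equiv> pref_chart (gmfd G) (gone G)"
begin

interpretation group "grp G" by (rule lie_groupD[OF G])

lemma one_chart: "(U, \<phi>) \<in> atlas (gmfd G)" "gone G \<in> U" "U \<subseteq> gcarrier G"
    "x \<in> U \<Longrightarrow> inv_into U \<phi> (\<phi> x) = x"
proof -
  have o: "gone G \<in> pts (gmfd G)" using one_in_group[OF G] lie_groupD[OF G] by simp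
  note c = chart_at[OF lie_groupD(3)[OF G] o]
  show "(U, \<phi>) \<in> atlas (gmfd G)" "gone G \<in> U" using c by (auto simp: U_def \<phi>_def)
  then show "U \<subseteq> gcarrier G" "x \<in> U \<Longrightarrow> inv_into U \<phi> (\<phi> x) = x"
    using chart_subset[OF lie_groupD(3)[OF G]] lie_groupD(4)[OF G] chart_inv[OF lie_groupD(3)[OF G]]
    by auto
qed

lemma left_inv_rep_eq:
  "x \<in> U \<Longrightarrow> left_inv_rep G A (\<phi> x) = tangent_map (gmfd G) vec_mfd \<phi> x (left_inv_field G A x)"
  using one_chart(4) by (simp add: local_rep_def U_def \<phi>_def Let_def)

lemma linear_left_inv_rep:
  assumes x: "x \<in> U"
  shows "linear (\<lambda>A. left_inv_rep G A (\<phi> x))"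
proof -
  have xG: "x \<in> gcarrier G" using x one_chart(3) by auto
  have "linear (tangent_map (gmfd G) vec_mfd \<phi> x)"
    by (rule linear_tangent_map[OF chart_diff_at(1)[OF lie_groupD(2)[OF G] one_chart(1) x]])
  moreover have "linear (\<lambda>A. left_inv_field G A x)"
    unfolding left_inv_field_def
    using linear_tangent_map[OF left_mult_diff_at[OF G xG one_in_group[OF G]]] .
  ultimately show ?thesis unfolding left_inv_rep_eq[OF x]
    using linear_compose by (fastforce simp: o_def)
qed

lemma left_inv_rep_one: "left_inv_rep G A (\<phi> (gone G)) = A"
proof -
  note one = one_in_group[OF G] and ch = lie_groupD(3)[OF G] and pt = lie_groupD(4)[OF G]
  have o: "openin (mtop (gmfd G)) (gcarrier G)" using pt by (metis openin_topspace)
  note i = tangent_map_ident[OF ch, of "gone G", unfolded pt, OF one]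
  have "tangent_map (gmfd G) (gmfd G) (gmult G (gone G)) (gone G) = (\<lambda>v. v)"
    using tangent_map_cong(2)[OF ch o one _ i(1), of "gmult G (gone G)"] i(2) by simp
  moreover have "tangent_map (gmfd G) vec_mfd \<phi> (gone G) = (\<lambda>v. v)"
    unfolding \<phi>_def using pref_chart_tangent(1)[OF ch] pt one by blast
  ultimately show ?thesis using left_inv_rep_eq[OF one_chart(2)] by (simp add: left_inv_field_def)
qed

text \<open>
  If \<open>m\<close> is the multiplication in the chart, then the field of \<open>A\<close> at \<open>y\<close> is the partial derivative
  of \<open>m (y, z)\<close> in \<open>z\<close> at the coordinates of the identity, in the direction of \<open>A\<close>.
\<close>

lemma left_inv_rep_differentiable: "left_inv_rep G A differentiable (at (\<phi> (gone G)))"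
proof -
  note sm = lie_groupD(2)[OF G] and ch = lie_groupD(3)[OF G] and one = one_in_group[OF G]
  note c = one_chart
  define y0 where "y0 = \<phi> (gone G)"
  define m where "m = (\<lambda>z. \<phi> ((\<lambda>(x, y). gmult G x y) (inv_into (U \<times> U) (map_prod \<phi> \<phi>) z)))"
  define T where "T = map_prod \<phi> \<phi> ` ((U \<times> U) \<inter> (\<lambda>(x, y). gmult G x y) -` U)"
  have mult: "smooth_map (prod_mfd (gmfd G) (gmfd G)) (gmfd G) (\<lambda>(x, y). gmult G x y)"
    using G by (simp add: lie_group_def)
  have m: "smooth_on T m" unfolding T_def m_def
    by (rule smooth_map_coordinates[OF mult _ c(1)]) (use c(1) in \<open>auto simp: prod_mfd_def\<close>)
  have m_eq: "m (\<phi> x, \<phi> z) = \<phi> (gmult G x z)" if "x \<in> U" "z \<in> U" for x z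
  proof -
    have "inv_into (U \<times> U) (map_prod \<phi> \<phi>) (\<phi> x, \<phi> z) = (x, z)"
      by (rule inv_into_f_eq)
        (use that chart_inj[OF ch c(1)] in \<open>auto simp: map_prod_inj_on\<close>)
    then show ?thesis by (simp add: m_def)
  qed
  have T: "(\<phi> x, y0) \<in> T" if "x \<in> U" for x
    unfolding T_def y0_def using that c(2,3) by force
  have oU: "open (\<phi> ` U)" and y0: "y0 \<in> \<phi> ` U" using chart_open(2)[OF ch c(1)] c(2) by (auto simp: y0_def)
  have rep: "left_inv_rep G A (\<phi> x) = frechet_derivative m (at (\<phi> x, y0)) (0, A)" if x: "x \<in> U" for x
  proof -
    have xG: "x \<in> gcarrier G" using x c(3) by auto
    have x1: "gmult G x (gone G) = x" using xG by simp
    have d\<phi>: "diff_at (gmfd G) vec_mfd \<phi> (gmult G x (gone G))"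
      unfolding x1 by (rule chart_diff_at(1)[OF sm c(1) x])
    note k = tangent_map_compose[OF ch ch left_mult_diff_at[OF G xG one] d\<phi>]
    have dm: "(m has_derivative frechet_derivative m (at (\<phi> x, y0))) (at (\<phi> x, y0))"
      using smooth_on_differentiable[OF m T[OF x]] frechet_derivative_works by blast
    have "((\<lambda>z. m (\<phi> x, z)) has_derivative (\<lambda>v. frechet_derivative m (at (\<phi> x, y0)) (0, v))) (at y0)"
      by (rule has_derivative_compose[where f = "\<lambda>z. (\<phi> x, z)", OF _ dm])
        (auto intro!: derivative_eq_intros)
    then have "((\<lambda>z. \<phi> (gmult G x (inv_into U \<phi> z))) has_derivative
        (\<lambda>v. frechet_derivative m (at (\<phi> x, y0)) (0, v))) (at y0)"
      by (rule has_derivative_transform_within_open[OF _ oU y0]) (auto simp: m_eq x c(4))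
    then have "frechet_derivative m (at (\<phi> x, y0)) (0, A) =
        frechet_derivative (\<lambda>z. \<phi> (gmult G x (inv_into U \<phi> z))) (at y0) A"
      using frechet_derivative_at by metis
    also have "\<dots> = tangent_map (gmfd G) vec_mfd (\<lambda>z. \<phi> (gmult G x z)) (gone G)
        (tangent_map vec_mfd (gmfd G) (inv_into U \<phi>) (\<phi> (gone G)) A)"
      unfolding y0_def by (rule tangent_map_in_chart[OF sm c(1,2) k(1)])
    also have "tangent_map vec_mfd (gmfd G) (inv_into U \<phi>) (\<phi> (gone G)) A = A"
      unfolding U_def \<phi>_def using pref_chart_tangent(2)[OF ch] lie_groupD(4)[OF G] one by metis
    finally show ?thesis unfolding k(2) x1 left_inv_rep_eq[OF x] left_inv_field_def by simp
  qed
  have "Ck_on (Suc (Suc 0)) T m" using m unfolding smooth_on_def by blast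
  then have "(\<lambda>z. frechet_derivative m (at z) (0, A)) differentiable (at (y0, y0))"
    using T[OF c(2)] unfolding y0_def[symmetric] Ck_on.simps by blast
  then have "((\<lambda>z. frechet_derivative m (at z) (0, A)) has_derivative
      frechet_derivative (\<lambda>z. frechet_derivative m (at z) (0, A)) (at (y0, y0))) (at (y0, y0))"
    using frechet_derivative_works by blast
  then have "((\<lambda>y. frechet_derivative m (at (y, y0)) (0, A)) has_derivative
      (\<lambda>v. frechet_derivative (\<lambda>z. frechet_derivative m (at z) (0, A)) (at (y0, y0)) (v, 0))) (at y0)"
    by (rule has_derivative_compose[rotated]) (auto intro!: derivative_eq_intros)
  then have "(left_inv_rep G A has_derivative
      (\<lambda>v. frechet_derivative (\<lambda>z. frechet_derivative m (at z) (0, A)) (at (y0, y0)) (v, 0))) (at y0)"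
    by (rule has_derivative_transform_within_open[OF _ oU y0]) (auto simp: rep)
  then show ?thesis unfolding y0_def differentiable_def by blast
qed

lemma left_inv_deriv:
  "(left_inv_rep G A has_derivative left_inv_deriv G A) (at (\<phi> (gone G)))"
  using left_inv_rep_differentiable[of A]
  by (simp add: frechet_derivative_works left_inv_deriv_def \<phi>_def)

lemma lie_bracket_eq: "lie_bracket G A B = left_inv_deriv G B A - left_inv_deriv G A B"
  using left_inv_rep_one by (simp add: lie_bracket_def vf_bracket_def Let_def \<phi>_def left_inv_deriv_def)

text \<open>
  The field of \<open>A\<close> depends linearly on \<open>A\<close>, not only at the identity but in a whole chart, so the
  derivative does as well.
\<close>

lemma linear_left_inv_deriv: "linear (\<lambda>A. left_inv_deriv G A B)" "linear (left_inv_deriv G A)"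
proof -
  have oU: "open (\<phi> ` U)" and y0: "\<phi> (gone G) \<in> \<phi> ` U"
    using chart_open(2)[OF lie_groupD(3)[OF G] one_chart(1)] one_chart(2) by auto
  show "linear (left_inv_deriv G A)" using has_derivative_linear[OF left_inv_deriv[of A]] .
  have "(left_inv_rep G (A + B) has_derivative (\<lambda>v. left_inv_deriv G A v + left_inv_deriv G B v))
      (at (\<phi> (gone G)))" for A B
    by (rule has_derivative_transform_within_open[OF has_derivative_add[OF left_inv_deriv[of A]
            left_inv_deriv[of B]] oU y0])
      (auto simp: linear_add[OF linear_left_inv_rep])
  moreover have "(left_inv_rep G (r *\<^sub>R A) has_derivative (\<lambda>v. r *\<^sub>R left_inv_deriv G A v))
      (at (\<phi> (gone G)))" for r A
    by (rule has_derivative_transform_within_open[OF has_derivative_scaleR_right[OF left_inv_deriv[of A]]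
            oU y0]) (auto simp: linear_cmul[OF linear_left_inv_rep])
  ultimately have "left_inv_deriv G (A + B) = (\<lambda>v. left_inv_deriv G A v + left_inv_deriv G B v)"
    "left_inv_deriv G (r *\<^sub>R A) = (\<lambda>v. r *\<^sub>R left_inv_deriv G A v)" for r A B
    using has_derivative_unique[OF left_inv_deriv] by blast+
  then show "linear (\<lambda>A. left_inv_deriv G A B)" by (simp add: linear_iff)
qed

lemma linear_lie_bracket: "linear (lie_bracket G A)" "linear (\<lambda>A. lie_bracket G A B)"
  unfolding lie_bracket_eq using linear_left_inv_deriv by (auto intro: linear_compose_sub)

text \<open>
  Conjugation by \<open>h\<close> carries the left invariant field of \<open>B\<close> to that of \<open>Ad h B\<close>.  Differentiating
  this relation at the identity in the direction of \<open>A\<close> produces, besides the terms wanted, a second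
  derivative of the conjugation, which is symmetric in \<open>A\<close> and \<open>B\<close> and drops out of the bracket.
\<close>

lemma Ad_lie_bracket:
  assumes h: "h \<in> gcarrier G"
  shows "Ad G h (lie_bracket G A B) = lie_bracket G (Ad G h A) (Ad G h B)"
proof -
  note sm = lie_groupD(2)[OF G] and ch = lie_groupD(3)[OF G] and one = one_in_group[OF G]
  note fd = smooth_manifold_finite_dim[OF sm]
  note c = one_chart
  note grp = lie_groupD(1)[OF G]
  have o: "openin (mtop (gmfd G)) (gcarrier G)" using lie_groupD(4)[OF G] by (metis openin_topspace)
  define y0 where "y0 = \<phi> (gone G)"
  define S where "S = \<phi> ` (U \<inter> gconj G h -` U)"
  define \<psi> where "\<psi> = (\<lambda>y. \<phi> (gconj G h (inv_into U \<phi> y)))"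
  have h1: "gconj G h (gone G) = gone G" using gconj_facts(1)[OF grp h] .
  have oS: "open S" unfolding S_def
    using open_smooth_map_chart[OF ch c(1) _ chart_open(1)[OF ch c(1)]] smooth_mult(2)[OF G h]
    by (simp add: smooth_map_def)
  have y0: "y0 \<in> S" unfolding S_def y0_def using c(2) h1 by auto
  have \<psi>: "smooth_on S \<psi>" unfolding S_def \<psi>_def
    by (rule smooth_map_coordinates[OF smooth_mult(2)[OF G h] c(1) c(1)])
  have \<psi>0: "\<psi> y0 = y0" unfolding \<psi>_def y0_def using c(2,4) h1 by simp
  have d\<psi>: "\<psi> differentiable (at y)" if "y \<in> S" for y using smooth_on_differentiable[OF \<psi> that] .
  have Ad: "frechet_derivative \<psi> (at y0) = Ad G h"
    unfolding Ad_def tangent_map_pref h1 by (simp add: \<psi>_def y0_def \<phi>_def U_def)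
  have rel: "frechet_derivative \<psi> (at y) (left_inv_rep G B y) = left_inv_rep G (Ad G h B) (\<psi> y)"
    if yS: "y \<in> S" for y B
  proof -
    obtain x where x: "x \<in> U" "gconj G h x \<in> U" "y = \<phi> x" using yS by (auto simp: S_def)
    have xG: "x \<in> gcarrier G" and cxG: "gconj G h x \<in> gcarrier G" using x c(3) by auto
    have x1: "gmult G x (gone G) = x" using xG by simp
    have d1: "diff_at (gmfd G) (gmfd G) (gconj G h) (gmult G x (gone G))"
      unfolding x1 by (rule gconj_diff_at[OF G h xG])
    have d2: "diff_at (gmfd G) (gmfd G) (gmult G (gconj G h x)) (gconj G h (gone G))"
      unfolding h1 by (rule left_mult_diff_at[OF G cxG one])
    note k1 = tangent_map_compose[OF ch ch left_mult_diff_at[OF G xG one] d1]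
    note k2 = tangent_map_compose[OF ch ch gconj_diff_at[OF G h one] d2]
    have "tangent_map (gmfd G) (gmfd G) (\<lambda>z. gmult G (gconj G h x) (gconj G h z)) (gone G) =
        tangent_map (gmfd G) (gmfd G) (\<lambda>z. gconj G h (gmult G x z)) (gone G)"
      by (rule tangent_map_cong(2)[OF ch o one _ k1(1)])
        (use gconj_facts(4)[OF grp h xG] in simp)
    \<comment> \<open>Conjugation is a homomorphism, so it relates the two left invariant fields.\<close>
    then have push: "tangent_map (gmfd G) (gmfd G) (gconj G h) x (left_inv_field G B x) =
        left_inv_field G (Ad G h B) (gconj G h x)"
      unfolding k1(2) k2(2) x1 h1 left_inv_field_def Ad_def by metis
    have d3: "diff_at (gmfd G) vec_mfd \<phi> (gconj G h x)" by (rule chart_diff_at(1)[OF sm c(1) x(2)])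
    note k3 = tangent_map_compose[OF ch ch gconj_diff_at[OF G h xG] d3]
    have "frechet_derivative \<psi> (at (\<phi> x)) v = tangent_map (gmfd G) vec_mfd (\<lambda>x. \<phi> (gconj G h x)) x
        (tangent_map vec_mfd (gmfd G) (inv_into U \<phi>) (\<phi> x) v)" for v
      unfolding \<psi>_def by (rule tangent_map_in_chart[OF sm c(1) x(1) k3(1)])
    then show ?thesis
      using x push c(4) by (simp add: left_inv_rep_eq k3(2) chart_tangent_inverse(1)[OF sm c(1) x(1)] \<psi>_def)
  qed
  define \<Psi> where "\<Psi> = (\<lambda>y. Blinfun (frechet_derivative \<psi> (at y)))"
  have \<Psi>: "blinfun_apply (\<Psi> y) = frechet_derivative \<psi> (at y)" if "y \<in> S" for y
    unfolding \<Psi>_def using d\<psi>[OF that]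
    by (intro bounded_linear_Blinfun_apply has_derivative_bounded_linear)
      (simp add: frechet_derivative_works)
  have C1: "Ck_on (Suc 0) S (\<lambda>y. frechet_derivative \<psi> (at y) v)" for v
  proof -
    have "Ck_on (Suc (Suc 0)) S \<psi>" using \<psi> unfolding smooth_on_def by blast
    then show ?thesis unfolding Ck_on.simps(2)[of "Suc 0"] by blast
  qed
  have "Ck_on (Suc 0) S \<Psi>" unfolding \<Psi>_def
    by (rule Ck_on_Blinfun[OF fd oS linear_frechet_derivative[OF d\<psi>] C1])
  note d\<Psi> = Ck_on_has_derivative[OF this y0]
  define D where "D = frechet_derivative \<Psi> (at y0)"
  have dir: "((\<lambda>y. frechet_derivative \<psi> (at y) v) has_derivative (\<lambda>u. blinfun_apply (D u) v)) (at y0)" for v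
  proof (rule has_derivative_transform_within_open[OF _ oS y0])
    show "((\<lambda>y. blinfun_apply (\<Psi> y) v) has_derivative (\<lambda>u. blinfun_apply (D u) v)) (at y0)"
      unfolding D_def
      by (rule bounded_linear.has_derivative[OF bounded_linear_apply_blinfun d\<Psi>])
  qed (simp add: \<Psi>)
  have sym: "blinfun_apply (D A) B = blinfun_apply (D B) A"
    by (rule symmetric_second_derivative[OF oS y0 d\<psi> dir dir])
  have key: "Ad G h (left_inv_deriv G B A) + blinfun_apply (D A) B =
      left_inv_deriv G (Ad G h B) (Ad G h A)" for A B
  proof -
    have "((\<lambda>y. blinfun_apply (\<Psi> y) (left_inv_rep G B y)) has_derivative
        (\<lambda>v. blinfun_apply (\<Psi> y0) (left_inv_deriv G B v) + blinfun_apply (D v) (left_inv_rep G B y0))) (at y0)"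
      unfolding D_def using left_inv_deriv d\<Psi>
      by (intro bounded_bilinear.FDERIV[OF bounded_bilinear_blinfun_apply]) (simp_all add: y0_def)
    then have 1: "((\<lambda>y. left_inv_rep G (Ad G h B) (\<psi> y)) has_derivative
        (\<lambda>v. Ad G h (left_inv_deriv G B v) + blinfun_apply (D v) B)) (at y0)"
      unfolding \<Psi>[OF y0] Ad left_inv_rep_one[folded y0_def]
      by (rule has_derivative_transform_within_open[OF _ oS y0]) (simp add: \<Psi> rel)
    have 2: "((\<lambda>y. left_inv_rep G (Ad G h B) (\<psi> y)) has_derivative
        (\<lambda>v. left_inv_deriv G (Ad G h B) (Ad G h v))) (at y0)"
      by (rule has_derivative_compose[of \<psi>])
        (use d\<psi>[OF y0] left_inv_deriv in \<open>simp_all add: frechet_derivative_works Ad \<psi>0 y0_def[symmetric]\<close>)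
    show ?thesis using has_derivative_unique[OF 1 2] by metis
  qed
  show ?thesis
    unfolding lie_bracket_eq linear_diff[OF linear_Ad[OF G h]] key[symmetric] sym by simp
qed

end

lemma trace_end_commute:
  fixes f g :: "'v::real_vector \<Rightarrow> 'v"
  assumes fd: "finite_dim (UNIV :: 'v set)" and f: "linear f" and g: "linear g"
  shows "trace_end (\<lambda>x. f (g x)) = trace_end (\<lambda>x. g (f x))"
proof -
  have *: "coord x (f (g x)) = (\<Sum>z\<in>some_basis. coord z (g x) * coord x (f z))"
    if "linear f" "linear g" for f g :: "'v \<Rightarrow> 'v" and x
    using linear_coord_expand[OF fd linear_compose[OF that(1) linear_coord[OF fd]], of x "g x"]
    by (simp add: o_def)
  show ?thesis unfolding trace_end_def *[OF f g] *[OF g f]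
    by (subst sum.swap) (simp add: mult.commute)
qed

lemma trace_end_add:
  assumes "finite_dim (UNIV :: 'v::real_vector set)"
  shows "trace_end (\<lambda>x::'v. f x + g x) = trace_end f + trace_end g"
  by (simp add: trace_end_def linear_add[OF linear_coord[OF assms]] sum.distrib)

lemma trace_end_scale:
  assumes "finite_dim (UNIV :: 'v::real_vector set)"
  shows "trace_end (\<lambda>x::'v. c *\<^sub>R f x) = c * trace_end f"
  by (simp add: trace_end_def linear_cmul[OF linear_coord[OF assms]] sum_distrib_left)

lemma killing_form_symmetric_bilinear:
  assumes G: "lie_group G"
  shows "killing_form G A B = killing_form G B A" "linear (killing_form G A)"
proof -
  note fd = smooth_manifold_finite_dim[OF lie_groupD(2)[OF G]]
  note l1 = linear_lie_bracket(1)[OF G] and l2 = linear_lie_bracket(2)[OF G]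
  show "killing_form G A B = killing_form G B A"
    unfolding killing_form_def by (rule trace_end_commute[OF fd l1 l1])
  show "linear (killing_form G A)"
    unfolding killing_form_def linear_iff
    by (simp add: linear_add[OF l2] linear_add[OF l1] linear_cmul[OF l2] linear_cmul[OF l1]
        trace_end_add[OF fd] trace_end_scale[OF fd])
qed

text \<open>
  The endomorphism whose trace is the Killing form is replaced by its conjugate under \<open>Ad G h\<close>.
\<close>

lemma killing_form_Ad:
  assumes G: "lie_group G" and h: "h \<in> gcarrier G"
  shows "killing_form G (Ad G h A) (Ad G h B) = killing_form G A B"
proof -
  note fd = smooth_manifold_finite_dim[OF lie_groupD(2)[OF G]]
  note l1 = linear_lie_bracket(1)[OF G]
  have hi: "ginv G h \<in> gcarrier G" using lie_groupD(1)[OF G] h by (simp add: group.inv_closed)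
  have "lie_bracket G (Ad G h A) (lie_bracket G (Ad G h B) C) =
      Ad G h (lie_bracket G A (lie_bracket G B (Ad G (ginv G h) C)))" for C
    using Ad_lie_bracket[OF G h] Ad_inv(1)[OF G h] by metis
  then have "killing_form G (Ad G h A) (Ad G h B) =
      trace_end (\<lambda>C. Ad G h (lie_bracket G A (lie_bracket G B (Ad G (ginv G h) C))))"
    unfolding killing_form_def by simp
  also have "\<dots> = trace_end (\<lambda>C. lie_bracket G A (lie_bracket G B (Ad G (ginv G h) (Ad G h C))))"
    using trace_end_commute[OF fd linear_Ad[OF G h]
        linear_compose[OF linear_Ad[OF G hi] linear_compose[OF l1[of B] l1[of A]]]]
    by (simp add: o_def)
  finally show ?thesis unfolding Ad_inv(2)[OF G h] killing_form_def .
qed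


section \<open>Contraction with an invariant metric\<close>

text \<open>
  The dual basis exists because \<open>y \<mapsto> \<Sum> b z y z\<close> is an injective, hence surjective, endomorphism.
\<close>

lemma dual_vec:
  fixes b :: "'v::real_vector \<Rightarrow> 'v \<Rightarrow> real"
  assumes fd: "finite_dim (UNIV :: 'v set)" and sym: "\<And>x y. b x y = b y x"
    and lin: "\<And>x. linear (b x)" and nd: "nondegenerate b"
    and x: "x \<in> some_basis" and z: "z \<in> some_basis"
  shows "b z (dual_vec b some_basis x) = (if z = x then 1 else 0)"
proof -
  interpret fin: finite_dimensional_vector_space "(*\<^sub>R)" "some_basis :: 'v set"
    by unfold_locales (use some_basis[OF fd] in \<open>auto simp: dependent_raw_def span_raw_def\<close>)
  define F where "F = (\<lambda>y. \<Sum>z\<in>some_basis. b z y *\<^sub>R z)"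
  have linF: "linear F"
    unfolding F_def by (auto simp: linear_iff linear_add[OF lin] linear_cmul[OF lin]
        scaleR_add_left sum.distrib scaleR_sum_right)
  have coordF: "coord z (F y) = b z y" if "z \<in> some_basis" for z y
  proof -
    have "coord z (F y) = (\<Sum>w\<in>some_basis. b w y * coord z w)"
      unfolding F_def linear_sum[OF linear_coord[OF fd]] by (simp add: linear_cmul[OF linear_coord[OF fd]])
    also have "\<dots> = (\<Sum>w\<in>some_basis. if w = z then b w y else 0)"
      by (intro sum.cong) (auto simp: coord_basis[OF fd that])
    finally show ?thesis using that some_basis(1)[OF fd] by simp
  qed
  have vanish: "y = 0" if "\<And>z. z \<in> some_basis \<Longrightarrow> b z y = 0" for y
  proof -
    have "b y w = 0" for w
      using linear_coord_expand[OF fd lin[of y], of w] that sym by simp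
    then show ?thesis using nd by (auto simp: nondegenerate_def)
  qed
  have "inj F"
    unfolding linear_injective_0[OF linF] using coordF vanish representation_zero
    by (metis)
  then have "surj F" using fin.linear_inj_imp_surj[of F] linF by (simp add: linear_def)
  then obtain y where y: "F y = x" by (metis surjD)
  have "\<forall>z\<in>some_basis. b z (dual_vec b some_basis x) = (if z = x then 1 else 0)"
    unfolding dual_vec_def
  proof (rule theI)
    show y': "\<forall>z\<in>some_basis. b z y = (if z = x then 1 else 0)"
    proof
      fix z :: 'v assume z: "z \<in> some_basis"
      have "b z y = coord z x" using coordF[OF z, of y] y by simp
      then show "b z y = (if z = x then 1 else 0)" using coord_basis[OF fd z x] by auto
    qed
    fix y2 assume y2: "\<forall>z\<in>some_basis. b z y2 = (if z = x then 1 else 0)"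
    have "y2 - y = 0" by (rule vanish) (use y' y2 in \<open>simp add: linear_diff[OF lin]\<close>)
    then show "y2 = y" by simp
  qed
  then show ?thesis using z by blast
qed

text \<open>
  With \<open>d x\<close> the dual basis, every \<open>v\<close> equals \<open>\<Sum> b v (d x) x\<close> and also \<open>\<Sum> b x v (d x)\<close>.
  The first expansion, transported by \<open>g\<close>, and the second one show that the bases \<open>x\<close> and \<open>g x\<close>
  give the same contraction.
\<close>

lemma metric_contraction_invariant:
  fixes b :: "'v::real_normed_vector \<Rightarrow> 'v \<Rightarrow> real"
    and T T' :: "'v \<Rightarrow>\<^sub>L ('v \<Rightarrow>\<^sub>L 'w::real_normed_vector)"
  assumes fd: "finite_dim (UNIV :: 'v set)" and sym: "\<And>x y. b x y = b y x"
    and lin: "\<And>x. linear (b x)"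
    and g: "linear g" "\<And>x. g (g' x) = x" and inv: "\<And>x y. b (g x) (g y) = b x y"
    and T': "\<And>x y. T' x y = T (g x) (g y)"
  shows "metric_contraction b T' = metric_contraction b T"
proof (cases "nondegenerate b")
  case True
  define d where "d = dual_vec b some_basis"
  note dv = dual_vec[OF fd sym lin True, folded d_def]
  have e1: "v = (\<Sum>x\<in>some_basis. b v (d x) *\<^sub>R x)" for v
  proof -
    have "b v (d x) = coord x v" if x: "x \<in> some_basis" for x
    proof -
      have "b v (d x) = b (d x) v" by (rule sym)
      also have "\<dots> = (\<Sum>z\<in>some_basis. coord z v *\<^sub>R b (d x) z)"
        by (rule linear_coord_expand[OF fd lin])
      also have "\<dots> = (\<Sum>z\<in>some_basis. if z = x then coord z v else 0)"
        by (intro sum.cong) (auto simp: sym[of "d x"] dv[OF x])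
      finally show ?thesis using x some_basis(1)[OF fd] by simp
    qed
    then show ?thesis using coord_sum[OF fd, of v] by simp
  qed
  have e2: "v = (\<Sum>x\<in>some_basis. b x v *\<^sub>R d x)" for v
  proof -
    define u where "u = v - (\<Sum>x\<in>some_basis. b x v *\<^sub>R d x)"
    have *: "b z u = 0" if z: "z \<in> some_basis" for z
    proof -
      have "b z u = b z v - (\<Sum>x\<in>some_basis. b x v * b z (d x))"
        unfolding u_def linear_diff[OF lin] linear_sum[OF lin] by (simp add: linear_cmul[OF lin])
      also have "(\<Sum>x\<in>some_basis. b x v * b z (d x)) = (\<Sum>x\<in>some_basis. if x = z then b x v else 0)"
        by (intro sum.cong) (auto simp: dv z)
      finally show ?thesis using z some_basis(1)[OF fd] by simp
    qed
    have "b u w = 0" for w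
      using linear_coord_expand[OF fd lin[of u], of w] * sym by simp
    then have "u = 0" using True by (auto simp: nondegenerate_def)
    then show ?thesis by (simp add: u_def)
  qed
  have e3: "(\<Sum>x\<in>some_basis. b v (g (d x)) *\<^sub>R g x) = v" for v
  proof -
    have "v = g (\<Sum>x\<in>some_basis. b (g' v) (d x) *\<^sub>R x)" using e1[of "g' v"] g(2) by simp
    also have "\<dots> = (\<Sum>x\<in>some_basis. b (g' v) (d x) *\<^sub>R g x)"
      unfolding linear_sum[OF g(1)] by (simp add: linear_cmul[OF g(1)])
    also have "\<dots> = (\<Sum>x\<in>some_basis. b v (g (d x)) *\<^sub>R g x)"
      using inv[of "g' v"] g(2) by simp
    finally show ?thesis by simp
  qed
  have "metric_contraction b T' = (\<Sum>x\<in>some_basis. T (g x) (g (d x)))"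
    using True by (simp add: metric_contraction_def d_def T')
  also have "\<dots> = (\<Sum>x\<in>some_basis. \<Sum>w\<in>some_basis. b w (g (d x)) *\<^sub>R T (g x) (d w))"
    by (rule sum.cong[OF refl], subst e2)
      (simp add: blinfun.sum_right blinfun.scaleR_right)
  also have "\<dots> = (\<Sum>w\<in>some_basis. \<Sum>x\<in>some_basis. b w (g (d x)) *\<^sub>R T (g x) (d w))"
    by (rule sum.swap)
  also have "\<dots> = (\<Sum>w\<in>some_basis. T (\<Sum>x\<in>some_basis. b w (g (d x)) *\<^sub>R g x) (d w))"
    by (simp add: blinfun.sum_right blinfun.sum_left blinfun.scaleR_right blinfun.scaleR_left)
  also have "\<dots> = metric_contraction b T"
    using True by (simp add: metric_contraction_def d_def[symmetric] e3)
  finally show ?thesis .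
qed (simp add: metric_contraction_def)

text \<open>
  The contraction is a linear combination of values of \<open>T\<close>, so it commutes with linear maps of the
  target; in the degenerate case both sides are 0.
\<close>

lemma metric_contraction_linear_on:
  assumes "subspace S" "linear_on S L" "\<And>x y. blinfun_apply (blinfun_apply T x) y \<in> S"
    and "\<And>x y. blinfun_apply (blinfun_apply T' x) y = L (T x y)"
  shows "metric_contraction b T \<in> S" "metric_contraction b T' = L (metric_contraction b T)"
proof -
  have "(\<Sum>x\<in>some_basis. L (T x (d x))) = L (\<Sum>x\<in>some_basis. T x (d x))" for d
    by (rule linear_on_sum[OF assms(1,2,3), symmetric])
  then show "metric_contraction b T' = L (metric_contraction b T)"
    using linear_on_0[OF assms(1,2)] by (simp add: metric_contraction_def assms(4))
  show "metric_contraction b T \<in> S"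
    using assms(1,3) by (auto simp: metric_contraction_def subspace_0 intro: subspace_sum)
qed

lemma bounded_linear_metric_contraction:
  fixes b :: "'v::real_normed_vector \<Rightarrow> 'v \<Rightarrow> real"
  shows "bounded_linear (metric_contraction b :: _ \<Rightarrow> 'w::real_normed_vector)"
proof (cases "nondegenerate b")
  case True
  then have *: "(metric_contraction b :: _ \<Rightarrow> 'w) =
      (\<lambda>T. \<Sum>x\<in>some_basis. blinfun_apply (blinfun_apply T x) (dual_vec b some_basis x))"
    by (auto simp: metric_contraction_def)
  show ?thesis unfolding *
    by (auto intro!: bounded_linear_sum bounded_linear_compose[OF bounded_linear_apply_blinfun])
next
  case False
  then have "(metric_contraction b :: _ \<Rightarrow> 'w) = (\<lambda>T. 0)" by (auto simp: metric_contraction_def)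
  then show ?thesis by simp
qed

section \<open>Representations on spaces of linear maps\<close>

text \<open>
  The algebraic part of a representation.  It is stable under \<open>hom_rep\<close> by algebra alone, which
  allows the passage from \<open>W\<close> to \<open>hom_rep G W\<close> to be iterated.
\<close>

definition lin_rep :: "('a, 'p) lgroup \<Rightarrow> ('a, 'w::real_vector) rep \<Rightarrow> bool" where
  "lin_rep P W \<longleftrightarrow>
     subspace (rspace W) \<and> finite_dim (rspace W) \<and>
     (\<forall>h\<in>gcarrier P. linear_on (rspace W) (ract W h) \<and> ract W h ` rspace W \<subseteq> rspace W) \<and>
     (\<forall>w\<in>rspace W. ract W (gone P) w = w) \<and>
     (\<forall>h\<in>gcarrier P. \<forall>k\<in>gcarrier P. \<forall>w\<in>rspace W.
        ract W (gmult P h k) w = ract W h (ract W k w))"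

lemma representation_of_lin_rep: "representation_of P W \<Longrightarrow> lin_rep P W"
  by (simp add: representation_of_def lin_rep_def)

lemma lin_repD:
  assumes "lin_rep P W"
  shows "subspace (rspace W)" "finite_dim (rspace W)"
    "h \<in> gcarrier P \<Longrightarrow> linear_on (rspace W) (ract W h)"
    "h \<in> gcarrier P \<Longrightarrow> w \<in> rspace W \<Longrightarrow> ract W h w \<in> rspace W"
    "w \<in> rspace W \<Longrightarrow> ract W (gone P) w = w"
    "h \<in> gcarrier P \<Longrightarrow> k \<in> gcarrier P \<Longrightarrow> w \<in> rspace W \<Longrightarrow>
      ract W (gmult P h k) w = ract W h (ract W k w)"
  using assms by (auto simp: lin_rep_def)

lemma subrep_simps [simp]: "rspace (subrep W V) = V" "ract (subrep W V) = ract W"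
  by (simp_all add: subrep_def)

lemma linear_on_subset: "linear_on S f \<Longrightarrow> T \<subseteq> S \<Longrightarrow> linear_on T f"
  unfolding linear_on_def by blast

lemma finite_dim_subset: "finite_dim S \<Longrightarrow> T \<subseteq> S \<Longrightarrow> finite_dim T"
  unfolding finite_dim_def by (meson order_trans)

lemma lin_rep_subrep:
  assumes W: "lin_rep P W" and V: "invariant_subspace P W V"
  shows "lin_rep P (subrep W V)"
proof -
  have V': "subspace V" "V \<subseteq> rspace W" "\<And>h. h \<in> gcarrier P \<Longrightarrow> ract W h ` V \<subseteq> V"
    using V by (auto simp: invariant_subspace_def)
  have "w \<in> rspace W" if "w \<in> V" for w using that V'(2) by auto
  then show ?thesis unfolding lin_rep_def subrep_simps
    using V' lin_repD(5,6)[OF W] finite_dim_subset[OF lin_repD(2)[OF W]]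
      linear_on_subset[OF lin_repD(3)[OF W]]
    by simp
qed

lemma equivariant_linearD:
  assumes "equivariant_linear P W V \<Phi>"
  shows "linear_on (rspace W) \<Phi>" "w \<in> rspace W \<Longrightarrow> \<Phi> w \<in> rspace V"
    "h \<in> gcarrier P \<Longrightarrow> w \<in> rspace W \<Longrightarrow> \<Phi> (ract W h w) = ract V h (\<Phi> w)"
  using assms by (auto simp: equivariant_linear_def)

lemma lie_subgroupD:
  assumes G: "lie_group G" and P: "lie_subgroup G P"
  shows "lie_group P" "gcarrier P \<subseteq> gcarrier G" "gmult P = gmult G" "gone P = gone G"
    "h \<in> gcarrier P \<Longrightarrow> ginv P h = ginv G h"
proof -
  have P': "lie_group P" "subgroup (gcarrier P) (grp G)" "grp P = (grp G)\<lparr>carrier := gcarrier P\<rparr>"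
    using P by (auto simp: lie_subgroup_def)
  show "lie_group P" "gcarrier P \<subseteq> gcarrier G" using P' subgroup.subset by auto
  show "gmult P = gmult G" "gone P = gone G"
    using arg_cong[OF P'(3), of monoid.mult] arg_cong[OF P'(3), of monoid.one] by simp_all
  show "ginv P h = ginv G h" if "h \<in> gcarrier P"
    using group.m_inv_consistent[OF lie_groupD(1)[OF G] P'(2) that] P'(3) by simp
qed

text \<open>
  The map that \<open>\<Phi>\<close> induces between the spaces of \<open>hom_rep\<close>.  It has the intended value when
  \<open>\<Phi>\<close> is linear on a subspace that contains the range of \<open>T\<close>; otherwise \<open>Blinfun\<close> is arbitrary.
\<close>

definition hom_map :: "('w \<Rightarrow> 'v) \<Rightarrow> ('g::real_normed_vector \<Rightarrow>\<^sub>L 'w::real_normed_vector) \<Rightarrow>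
    'g \<Rightarrow>\<^sub>L 'v::real_normed_vector" where
  "hom_map \<Phi> T = Blinfun (\<lambda>A. \<Phi> (blinfun_apply T A))"

lemma linear_linear_on_compose:
  assumes "subspace S" "linear_on S L" "linear f" "range f \<subseteq> S"
  shows "linear (\<lambda>x. L (f x))"
proof -
  have "f x \<in> S" for x using assms(4) by auto
  then show ?thesis using linear_onD[OF assms(2)] linear_add[OF assms(3)] linear_cmul[OF assms(3)]
    by (simp add: linear_iff)
qed

lemma hom_map_apply:
  fixes T :: "'g::real_normed_vector \<Rightarrow>\<^sub>L 'w::real_normed_vector"
    and \<Phi> :: "'w \<Rightarrow> 'v::real_normed_vector"
  assumes "finite_dim (UNIV :: 'g set)" "subspace S" "linear_on S \<Phi>" "range (blinfun_apply T) \<subseteq> S"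
  shows "blinfun_apply (hom_map \<Phi> T) A = \<Phi> (T A)"
  using bounded_linear_Blinfun_apply[OF linear_imp_bounded_linear_finite_dim[OF assms(1)
      linear_linear_on_compose[OF assms(2,3)
        bounded_linear.linear[OF blinfun.bounded_linear_right] assms(4)]]]
  by (simp add: hom_map_def)

lemma finite_dim_hom:
  fixes S :: "'w::real_normed_vector set"
  assumes fd: "finite_dim (UNIV :: 'g::real_normed_vector set)" and S: "finite_dim S"
  shows "finite_dim {T :: 'g \<Rightarrow>\<^sub>L 'w. range (blinfun_apply T) \<subseteq> S}"
proof -
  obtain F where F: "finite F" "S \<subseteq> span F" using S by (auto simp: finite_dim_def)
  define E :: "'g \<Rightarrow> 'w \<Rightarrow> 'g \<Rightarrow>\<^sub>L 'w" where "E = (\<lambda>b w. Blinfun (\<lambda>v. coord b v *\<^sub>R w))"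
  note E = bounded_linear_rank_one[OF bounded_linear_coord[OF fd]]
  define B where "B = (\<Union>b\<in>some_basis. E b ` F)"
  have "T \<in> span B" if T: "range (blinfun_apply T) \<subseteq> S" for T :: "'g \<Rightarrow>\<^sub>L 'w"
  proof -
    have "E b (T b) \<in> span B" if "b \<in> some_basis" for b
    proof -
      have "T b \<in> span F" using T F(2) by auto
      then have "E b (T b) \<in> span (E b ` F)"
        using span_linear_image[OF bounded_linear.linear[OF E(1)], of b F] by (auto simp: E_def)
      moreover have "span (E b ` F) \<subseteq> span B" using that by (intro span_mono) (auto simp: B_def)
      ultimately show ?thesis by auto
    qed
    moreover have "T = (\<Sum>b\<in>some_basis. E b (T b))"
      by (rule blinfun_eqI)
        (simp add: E_def E(2) blinfun.sum_left
          linear_coord_expand[OF fd bounded_linear.linear[OF blinfun.bounded_linear_right], symmetric])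
    ultimately show ?thesis by (metis span_sum)
  qed
  moreover have "finite B" using some_basis(1)[OF fd] F(1) by (simp add: B_def)
  ultimately show ?thesis unfolding finite_dim_def by blast
qed


section \<open>Derivatives of equivariant functions\<close>

text \<open>
  Cartan geometries of type \<open>(G, P)\<close>.
\<close>

locale cartan_setting =
  fixes G :: "('a, 'g::real_normed_vector) lgroup"
    and P :: "('a, 'p::real_normed_vector) lgroup"
    and X :: "('u, 'e::real_normed_vector, 'm, 'b::real_normed_vector, 'a, 'g) geometry"
  assumes lie_G: "lie_group G" and sub_P: "lie_subgroup G P"
    and principal: "principal_bundle P X" and cartan: "cartan_connection G P X"
begin

lemmas P_facts = lie_subgroupD[OF lie_G sub_P]
lemmas G_facts = lie_groupD[OF lie_G]

lemma fd_g: "finite_dim (UNIV :: 'g set)"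
  by (rule smooth_manifold_finite_dim[OF G_facts(2)])

lemma P_in_G: "h \<in> gcarrier P \<Longrightarrow> h \<in> gcarrier G"
  using P_facts(2) by auto

lemma P_closed:
  assumes "h \<in> gcarrier P"
  shows "ginv G h \<in> gcarrier P" "k \<in> gcarrier P \<Longrightarrow> gmult G h k \<in> gcarrier P"
    "ginv G (ginv G h) = h" "gmult G h (ginv G h) = gone G" "gmult G (ginv G h) h = gone G"
    "gone G \<in> gcarrier P"
proof -
  interpret P: group "grp P" by (rule lie_groupD[OF P_facts(1)])
  interpret G: group "grp G" by (rule G_facts(1))
  show "ginv G h \<in> gcarrier P" using P.inv_closed[OF assms] P_facts(5)[OF assms] by simp
  show "k \<in> gcarrier P \<Longrightarrow> gmult G h k \<in> gcarrier P"
    using P.m_closed[OF assms, of k] P_facts(3) by simp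
  show "gone G \<in> gcarrier P" using P.one_closed P_facts(4) by simp
  show "ginv G (ginv G h) = h" "gmult G h (ginv G h) = gone G" "gmult G (ginv G h) h = gone G"
    using P_in_G[OF assms] by simp_all
qed

lemma total_manifold: "smooth_manifold (total X)" "charted (total X)"
  using principal by (auto simp: principal_bundle_def intro: smooth_manifold_charted)

lemma pact_closed:
  assumes "u \<in> pts (total X)" "h \<in> gcarrier P"
  shows "pact X u h \<in> pts (total X)"
proof -
  have "smooth_map (prod_mfd (total X) (gmfd P)) (total X) (\<lambda>(u, h). pact X u h)"
    using principal by (simp add: principal_bundle_def)
  then have "continuous_map (prod_topology (mtop (total X)) (mtop (gmfd P))) (mtop (total X))
      (\<lambda>(u, h). pact X u h)"
    by (simp add: smooth_map_def prod_mfd_def)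
  from continuous_map_funspace[OF this] show ?thesis
    using assms lie_groupD(4)[OF P_facts(1)] by (auto simp: Pi_iff)
qed

lemma pact_one: "u \<in> pts (total X) \<Longrightarrow> pact X u (gone G) = u"
  using principal P_facts(4) by (simp add: principal_bundle_def)

lemma pact_mult:
  "u \<in> pts (total X) \<Longrightarrow> h \<in> gcarrier P \<Longrightarrow> k \<in> gcarrier P \<Longrightarrow>
    pact X (pact X u h) k = pact X u (gmult G h k)"
  using principal P_facts(3) by (simp add: principal_bundle_def)

lemma pact_smooth: "h \<in> gcarrier P \<Longrightarrow> smooth_map (total X) (total X) (\<lambda>u. pact X u h)"
  using smooth_map_fix_argument(1)[OF total_manifold(1) lie_groupD(2)[OF P_facts(1)] total_manifold(2),
      of "\<lambda>(u, h). pact X u h" h] principal lie_groupD(4)[OF P_facts(1)]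
  by (simp add: principal_bundle_def)

lemma cform_linear:
  assumes "u \<in> pts (total X)"
  shows "linear (cform X u)" "bij (cform X u)" "linear (inv_into UNIV (cform X u))"
    "cform X u (inv_into UNIV (cform X u) A) = A" "inv_into UNIV (cform X u) (cform X u \<xi>) = \<xi>"
proof -
  show lin: "linear (cform X u)" and bij: "bij (cform X u)"
    using cartan assms by (auto simp: cartan_connection_def)
  have c: "cform X u (inv_into UNIV (cform X u) A) = A" for A using bij by (simp add: bij_is_surj surj_f_inv_f)
  have i: "inv_into UNIV (cform X u) (cform X u \<xi>) = \<xi>" for \<xi> using bij by (simp add: bij_is_inj)
  show "cform X u (inv_into UNIV (cform X u) A) = A" "inv_into UNIV (cform X u) (cform X u \<xi>) = \<xi>"
    by (rule c i)+
  show "linear (inv_into UNIV (cform X u))"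
  proof (rule linearI)
    fix A B r
    show "inv_into UNIV (cform X u) (A + B) = inv_into UNIV (cform X u) A + inv_into UNIV (cform X u) B"
      using i[of "inv_into UNIV (cform X u) A + inv_into UNIV (cform X u) B"] by (simp add: linear_add[OF lin] c)
    show "inv_into UNIV (cform X u) (r *\<^sub>R A) = r *\<^sub>R inv_into UNIV (cform X u) A"
      using i[of "r *\<^sub>R inv_into UNIV (cform X u) A"] by (simp add: linear_cmul[OF lin] c)
  qed
qed

lemma hom_rep_act:
  assumes W: "lin_rep P (W :: ('a, 'w::real_normed_vector) rep)" and h: "h \<in> gcarrier P"
    and T: "T \<in> rspace (hom_rep G W)"
  shows "blinfun_apply (ract (hom_rep G W) h T) A = ract W h (T (Ad G (ginv G h) A))"
proof -
  have "linear (\<lambda>A. blinfun_apply T (Ad G (ginv G h) A))"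
    using linear_compose[OF linear_Ad[OF lie_G P_in_G[OF P_closed(1)[OF h]]]
        bounded_linear.linear[OF blinfun.bounded_linear_right[of T]]] by (simp add: o_def)
  then have "linear (\<lambda>A. ract W h (blinfun_apply T (Ad G (ginv G h) A)))"
    using T by (intro linear_linear_on_compose[OF lin_repD(1,3)[OF W] _]) (auto simp: hom_rep_def h)
  from bounded_linear_Blinfun_apply[OF linear_imp_bounded_linear_finite_dim[OF fd_g this]]
  show ?thesis by (simp add: hom_rep_def)
qed

lemma hom_rep_space: "T \<in> rspace (hom_rep G W) \<longleftrightarrow> (\<forall>A. blinfun_apply T A \<in> rspace W)"
  by (auto simp: hom_rep_def)

lemma lin_rep_hom_rep:
  assumes W: "lin_rep P (W :: ('a, 'w::real_normed_vector) rep)"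
  shows "lin_rep P (hom_rep G W)"
  unfolding lin_rep_def
proof (intro conjI ballI)
  show sub: "subspace (rspace (hom_rep G W))"
    using lin_repD(1)[OF W]
    by (auto simp: subspace_def hom_rep_space blinfun.add_left blinfun.scaleR_left)
  show "finite_dim (rspace (hom_rep G W))"
    unfolding hom_rep_def using finite_dim_hom[OF fd_g lin_repD(2)[OF W]] by simp
  fix h assume h: "h \<in> gcarrier P"
  note act = hom_rep_act[OF W h]
  show "linear_on (rspace (hom_rep G W)) (ract (hom_rep G W) h)"
    unfolding linear_on_def
  proof (intro conjI ballI allI; rule blinfun_eqI)
    fix S T A assume ST: "S \<in> rspace (hom_rep G W)" "T \<in> rspace (hom_rep G W)"
    then show "blinfun_apply (ract (hom_rep G W) h (S + T)) A =
        blinfun_apply (ract (hom_rep G W) h S + ract (hom_rep G W) h T) A"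
      using linear_onD(1)[OF lin_repD(3)[OF W h]] ST[unfolded hom_rep_space]
      unfolding act[OF subspace_add[OF sub ST]] by (simp add: act ST blinfun.add_left)
  next
    fix r S A assume S: "S \<in> rspace (hom_rep G W)"
    then show "blinfun_apply (ract (hom_rep G W) h (r *\<^sub>R S)) A =
        blinfun_apply (r *\<^sub>R ract (hom_rep G W) h S) A"
      using linear_onD(2)[OF lin_repD(3)[OF W h]] S[unfolded hom_rep_space]
      unfolding act[OF subspace_scale[OF sub S]] by (simp add: act S blinfun.scaleR_left)
  qed
  show closed: "ract (hom_rep G W) h ` rspace (hom_rep G W) \<subseteq> rspace (hom_rep G W)"
  proof (rule image_subsetI)
    fix T assume T: "T \<in> rspace (hom_rep G W)"
    show "ract (hom_rep G W) h T \<in> rspace (hom_rep G W)"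
      unfolding hom_rep_space act[OF T] using lin_repD(4)[OF W h] T[unfolded hom_rep_space] by blast
  qed
next
  fix T assume T: "T \<in> rspace (hom_rep G W)"
  have one: "gone G \<in> gcarrier P" using one_in_group[OF P_facts(1)] P_facts(4) by simp
  interpret G: group "grp G" by (rule G_facts(1))
  show "ract (hom_rep G W) (gone P) T = T"
    using lin_repD(5)[OF W] T[unfolded hom_rep_space] unfolding P_facts(4)
    by (intro blinfun_eqI) (simp add: hom_rep_act[OF W one T] Ad_one[OF lie_G])
next
  fix h k T assume h: "h \<in> gcarrier P" and k: "k \<in> gcarrier P" and T: "T \<in> rspace (hom_rep G W)"
  have kT: "ract (hom_rep G W) k T \<in> rspace (hom_rep G W)"
    unfolding hom_rep_space hom_rep_act[OF W k T]
    using lin_repD(4)[OF W k] T[unfolded hom_rep_space] by blast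
  interpret G: group "grp G" by (rule G_facts(1))
  have "ginv G (gmult G h k) = gmult G (ginv G k) (ginv G h)"
    using G.inv_mult_group P_in_G h k by simp
  then have "Ad G (ginv G (gmult G h k)) A = Ad G (ginv G k) (Ad G (ginv G h) A)" for A
    using Ad_mult[OF lie_G P_in_G P_in_G] P_closed(1) h k by simp
  then show "ract (hom_rep G W) (gmult P h k) T = ract (hom_rep G W) h (ract (hom_rep G W) k T)"
    unfolding P_facts(3) using lin_repD(6)[OF W h k] T[unfolded hom_rep_space]
    by (intro blinfun_eqI)
      (simp add: hom_rep_act[OF W h kT] hom_rep_act[OF W k T]
        hom_rep_act[OF W P_closed(2)[OF h k] T] P_facts(3))
qed

lemma equivariant_linear_hom_map:
  fixes \<Phi> :: "'w::real_normed_vector \<Rightarrow> 'v::real_normed_vector"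
  assumes W: "lin_rep P W" and V: "lin_rep P V" and \<Phi>: "equivariant_linear P W V \<Phi>"
  shows "equivariant_linear P (hom_rep G W) (hom_rep G V) (hom_map \<Phi>)"
    "T \<in> rspace (hom_rep G W) \<Longrightarrow> blinfun_apply (hom_map \<Phi> T) A = \<Phi> (T A)"
proof -
  note \<Phi>' = equivariant_linearD[OF \<Phi>]
  show ap: "blinfun_apply (hom_map \<Phi> T) A = \<Phi> (T A)" if "T \<in> rspace (hom_rep G W)" for T A
    by (rule hom_map_apply[OF fd_g lin_repD(1)[OF W] \<Phi>'(1)]) (use that in \<open>auto simp: hom_rep_def\<close>)
  note sub = lin_repD(1)[OF lin_rep_hom_rep[OF W]]
  have mem: "hom_map \<Phi> T \<in> rspace (hom_rep G V)" if "T \<in> rspace (hom_rep G W)" for T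
    unfolding hom_rep_space ap[OF that] using that[unfolded hom_rep_space] \<Phi>'(2) by blast
  show "equivariant_linear P (hom_rep G W) (hom_rep G V) (hom_map \<Phi>)"
    unfolding equivariant_linear_def linear_on_def
  proof (intro conjI ballI allI; (rule blinfun_eqI)?)
    fix S T A assume ST: "S \<in> rspace (hom_rep G W)" "T \<in> rspace (hom_rep G W)"
    then show "blinfun_apply (hom_map \<Phi> (S + T)) A = blinfun_apply (hom_map \<Phi> S + hom_map \<Phi> T) A"
      using linear_onD(1)[OF \<Phi>'(1)] ST[unfolded hom_rep_space]
      unfolding ap[OF subspace_add[OF sub ST]] by (simp add: ap ST blinfun.add_left)
  next
    fix r T A assume T: "T \<in> rspace (hom_rep G W)"
    then show "blinfun_apply (hom_map \<Phi> (r *\<^sub>R T)) A = blinfun_apply (r *\<^sub>R hom_map \<Phi> T) A"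
      using linear_onD(2)[OF \<Phi>'(1)] T[unfolded hom_rep_space]
      unfolding ap[OF subspace_scale[OF sub T]] by (simp add: ap T blinfun.scaleR_left)
  next
    show "hom_map \<Phi> ` rspace (hom_rep G W) \<subseteq> rspace (hom_rep G V)" using mem by auto
  next
    fix h T A assume h: "h \<in> gcarrier P" and T: "T \<in> rspace (hom_rep G W)"
    have "ract (hom_rep G W) h T \<in> rspace (hom_rep G W)"
      by (rule lin_repD(4)[OF lin_rep_hom_rep[OF W] h T])
    then show "blinfun_apply (hom_map \<Phi> (ract (hom_rep G W) h T)) A =
        blinfun_apply (ract (hom_rep G V) h (hom_map \<Phi> T)) A"
      using \<Phi>'(3)[OF h] T[unfolded hom_rep_space]
      by (simp add: ap[OF T] ap hom_rep_act[OF W h T] hom_rep_act[OF V h mem[OF T]])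
  qed
qed

text \<open>
  Tangent maps commute with linear maps of the target.
\<close>

lemma smooth_map_linear_on:
  fixes f :: "'u \<Rightarrow> 'w::real_normed_vector"
  assumes f: "smooth_map (total X) vec_mfd f" and S: "subspace S" "finite_dim S" "linear_on S L"
    and fS: "f ` pts (total X) \<subseteq> S"
  shows "smooth_map (total X) vec_mfd (\<lambda>u. L (f u))"
    "u \<in> pts (total X) \<Longrightarrow> tangent_map (total X) vec_mfd f u v \<in> S"
    "u \<in> pts (total X) \<Longrightarrow>
      tangent_map (total X) vec_mfd (\<lambda>u. L (f u)) u v = L (tangent_map (total X) vec_mfd f u v)"
proof -
  note ch = total_manifold(2)
  have im: "(\<lambda>y. f (inv_into U \<phi> y)) ` \<phi> ` U \<subseteq> S" if "(U, \<phi>) \<in> atlas (total X)" for U \<phi>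
  proof (rule image_subsetI)
    fix y assume "y \<in> \<phi> ` U"
    then obtain x where "x \<in> U" "y = \<phi> x" by blast
    then show "f (inv_into U \<phi> y) \<in> S"
      using fS chart_subset[OF ch that] chart_inv[OF ch that] by (metis image_subset_iff subsetD)
  qed
  show "smooth_map (total X) vec_mfd (\<lambda>u. L (f u))"
    using f unfolding smooth_map_vec_iff[OF ch] smooth_on_def
    by (auto intro!: Ck_on_linear_on[OF _ S] chart_open(2)[OF ch] im)
  fix u assume u: "u \<in> pts (total X)"
  note c = chart_at[OF ch u]
  note d = diff_atD(3)[OF smooth_map_diff_at[OF ch charted_vec_mfd f u], simplified]
  have pu: "pref_chart (total X) u u \<in> pref_chart (total X) u ` pref_dom (total X) u" using c(2) by auto
  note lin = has_derivative_linear_on[OF d S chart_open(2)[OF ch c(1)] pu im[OF c(1)]]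
  show "tangent_map (total X) vec_mfd f u v \<in> S" by (rule lin(1))
  show "tangent_map (total X) vec_mfd (\<lambda>u. L (f u)) u v = L (tangent_map (total X) vec_mfd f u v)"
    using frechet_derivative_at[OF lin(2)] by (simp add: tangent_map_pref) metis
qed

lemma equivariant_functionsD:
  assumes "f \<in> equivariant_functions P X W"
  shows "smooth_map (total X) vec_mfd f" "u \<in> pts (total X) \<Longrightarrow> f u \<in> rspace W"
    "u \<in> pts (total X) \<Longrightarrow> h \<in> gcarrier P \<Longrightarrow> f (pact X u h) = ract W (ginv G h) (f u)"
    "f ` pts (total X) \<subseteq> rspace W"
    "u \<in> pts (total X) \<Longrightarrow> diff_at (total X) vec_mfd f u"
  using assms P_facts(5) smooth_map_diff_at[OF total_manifold(2) charted_vec_mfd]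
  by (auto simp: equivariant_functions_def)

lemma equivariant_functions_map:
  assumes W: "lin_rep P W" and \<Phi>: "equivariant_linear P W V \<Phi>"
    and f: "f \<in> equivariant_functions P X W"
  shows "(\<lambda>u. \<Phi> (f u)) \<in> equivariant_functions P X V"
  using equivariant_functionsD[OF f] equivariant_linearD[OF \<Phi>] P_facts(5) P_closed(1)
    smooth_map_linear_on(1)[OF _ lin_repD(1,2)[OF W] equivariant_linearD(1)[OF \<Phi>], of f]
  by (auto simp: equivariant_functions_def)

lemma deriv_fun_apply:
  assumes u: "u \<in> pts (total X)" and f: "diff_at (total X) vec_mfd f u"
  shows "blinfun_apply (deriv_fun X f u) A = tangent_map (total X) vec_mfd f u (inv_into UNIV (cform X u) A)"
proof -
  have "linear (\<lambda>A. tangent_map (total X) vec_mfd f u (inv_into UNIV (cform X u) A))"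
    using linear_compose[OF cform_linear(3)[OF u] linear_tangent_map[OF f]] by (simp add: o_def)
  from bounded_linear_Blinfun_apply[OF linear_imp_bounded_linear_finite_dim[OF fd_g this]]
  show ?thesis by (simp add: deriv_fun_def)
qed

lemma deriv_fun_cong:
  assumes "\<And>u. u \<in> pts (total X) \<Longrightarrow> f u = g u" "diff_at (total X) vec_mfd f u" "u \<in> pts (total X)"
  shows "deriv_fun X g u = deriv_fun X f u"
  using tangent_map_cong(2)[OF total_manifold(2) _ assms(3) assms(1,2)]
  by (simp add: deriv_fun_def)

text \<open>
  The fundamental derivative is natural: differentiation commutes with the constant linear map \<open>\<Phi>\<close>.
\<close>

lemma deriv_fun_map:
  fixes \<Phi> :: "'w::real_normed_vector \<Rightarrow> 'v::real_normed_vector"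
  assumes W: "lin_rep P W" and V: "lin_rep P V" and \<Phi>: "equivariant_linear P W V \<Phi>"
    and f: "f \<in> equivariant_functions P X W" and u: "u \<in> pts (total X)"
  shows "deriv_fun X (\<lambda>u. \<Phi> (f u)) u = hom_map \<Phi> (deriv_fun X f u)"
proof -
  note f' = equivariant_functionsD[OF f]
  note k = smooth_map_linear_on[OF f'(1) lin_repD(1,2)[OF W] equivariant_linearD(1)[OF \<Phi>] f'(4)]
  have "deriv_fun X f u \<in> rspace (hom_rep G W)"
    unfolding hom_rep_space deriv_fun_apply[OF u f'(5)[OF u]] using k(2)[OF u] by blast
  then show ?thesis
    by (intro blinfun_eqI) (simp add: equivariant_linear_hom_map(2)[OF W V \<Phi>]
        deriv_fun_apply[OF u f'(5)[OF u]] k(3)[OF u]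
        deriv_fun_apply[OF u equivariant_functionsD(5)[OF equivariant_functions_map[OF W \<Phi> f] u]])
qed

text \<open>
  In a chart, \<open>deriv_fun f\<close> is the derivative of \<open>f\<close> composed with the inverse of the matrix that
  the Cartan connection has in the chart, so that smoothness comes from that of inversion.
\<close>

lemma smooth_deriv_fun:
  fixes f :: "'u \<Rightarrow> 'w::real_normed_vector"
  assumes f: "smooth_map (total X) vec_mfd f"
  shows "smooth_map (total X) vec_mfd (deriv_fun X f)"
  unfolding smooth_map_vec_iff[OF total_manifold(2)]
proof (intro allI impI)
  note sm = total_manifold(1) and ch = total_manifold(2)
  note fd_e = smooth_manifold_finite_dim[OF sm]
  fix U \<phi> assume c: "(U, \<phi>) \<in> atlas (total X)"
  have oU: "open (\<phi> ` U)" by (rule chart_open(2)[OF ch c])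
  \<comment> \<open>\<open>N y\<close> is the Cartan connection and \<open>F y\<close> the derivative of \<open>f\<close>, both in the chart; \<open>I y\<close> inverts \<open>N y\<close>.\<close>
  define p where "p = inv_into U \<phi>"
  define J where "J = (\<lambda>y. tangent_map vec_mfd (total X) p y)"
  define N where "N = (\<lambda>y v. cform X (p y) (J y v))"
  define I where "I = (\<lambda>y A. tangent_map (total X) vec_mfd \<phi> (p y) (inv_into UNIV (cform X (p y)) A))"
  define F where "F = (\<lambda>y. frechet_derivative (\<lambda>y. f (p y)) (at y))"
  have at: "p y \<in> U" "p y \<in> pts (total X)" "\<phi> (p y) = y" "linear (N y)" "linear (I y)" "linear (F y)"
      "I y (N y v) = v" "N y (I y A) = A"
      "F y (I y A) = blinfun_apply (deriv_fun X f (p y)) A"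
    if y: "y \<in> \<phi> ` U" for y v A
  proof -
    obtain x where x: "x \<in> U" "y = \<phi> x" using y by auto
    have px: "p y = x" unfolding p_def x by (rule chart_inv[OF ch c x(1)])
    have xM: "x \<in> pts (total X)" using x chart_subset[OF ch c] by auto
    show "p y \<in> U" "p y \<in> pts (total X)" "\<phi> (p y) = y" using px x xM by auto
    note d = chart_diff_at[OF sm c x(1), folded p_def x(2)]
    note inv = chart_tangent_inverse[OF sm c x(1), folded p_def x(2)]
    note w = cform_linear[OF xM]
    have fx: "diff_at (total X) vec_mfd f x" by (rule smooth_map_diff_at[OF ch charted_vec_mfd f xM])
    show "linear (N y)" unfolding N_def px J_def
      using linear_compose[OF linear_tangent_map[OF d(2)] w(1)] by (simp add: o_def)
    show "linear (I y)" unfolding I_def px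
      using linear_compose[OF w(3) linear_tangent_map[OF d(1)]] by (simp add: o_def)
    have F: "F y v = tangent_map (total X) vec_mfd f x (J y v)" for v
      unfolding F_def J_def using tangent_map_in_chart[OF sm c x(1) fx, folded p_def x(2)] .
    show "linear (F y)"
      using linear_compose[OF linear_tangent_map[OF d(2)] linear_tangent_map[OF fx]]
      by (simp add: o_def F[abs_def] J_def)
    show "I y (N y v) = v" "N y (I y A) = A"
      by (simp_all add: I_def N_def px J_def w inv)
    show "F y (I y A) = blinfun_apply (deriv_fun X f (p y)) A"
      unfolding px deriv_fun_apply[OF xM fx] F by (simp add: I_def J_def px inv)
  qed
  have Ck: "Ck_on n (\<phi> ` U) (\<lambda>y. Blinfun (F y) o\<^sub>L Blinfun (I y))" for n
  proof (rule Ck_on_bilinear[OF oU bounded_bilinear_blinfun_compose])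
    have "Ck_on (Suc n) (\<phi> ` U) (\<lambda>y. f (p y))"
      using f c unfolding smooth_map_vec_iff[OF ch] smooth_on_def p_def by blast
    then have Fv: "Ck_on n (\<phi> ` U) (\<lambda>y. F y v)" for v unfolding F_def by simp
    show "Ck_on n (\<phi> ` U) (\<lambda>y. Blinfun (F y))" by (rule Ck_on_Blinfun[OF fd_e oU at(6) Fv])
    have "smooth_form (total X) (cform X)" using cartan by (simp add: cartan_connection_def)
    then have "\<forall>v. smooth_on (\<phi> ` U) (\<lambda>y. N y v)"
      unfolding smooth_form_def N_def J_def p_def using c by (auto dest!: bspec)
    then have Nv: "Ck_on n (\<phi> ` U) (\<lambda>y. N y v)" for v by (simp add: smooth_on_def)
    have bl: "blinfun_apply (Blinfun (N y)) = N y" "blinfun_apply (Blinfun (I y)) = I y"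
      if "y \<in> \<phi> ` U" for y
      using at(4,5)[OF that] linear_imp_bounded_linear_finite_dim[OF fd_e]
        linear_imp_bounded_linear_finite_dim[OF fd_g] bounded_linear_Blinfun_apply by blast+
    show "Ck_on n (\<phi> ` U) (\<lambda>y. Blinfun (I y))"
      by (rule Ck_on_blinfun_inverse[OF oU _ _ Ck_on_Blinfun[OF fd_e oU at(4) Nv]])
        (auto intro!: blinfun_eqI simp: bl at(7,8))
  qed
  have eq: "Blinfun (F y) o\<^sub>L Blinfun (I y) = deriv_fun X f (p y)" if y: "y \<in> \<phi> ` U" for y
  proof (rule blinfun_eqI)
    have "blinfun_apply (Blinfun (F y)) = F y" "blinfun_apply (Blinfun (I y)) = I y"
      using at(5,6)[OF y] linear_imp_bounded_linear_finite_dim[OF fd_e]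
        linear_imp_bounded_linear_finite_dim[OF fd_g] bounded_linear_Blinfun_apply by blast+
    then show "blinfun_apply (Blinfun (F y) o\<^sub>L Blinfun (I y)) A = blinfun_apply (deriv_fun X f (p y)) A" for A
      by (simp add: at(9)[OF y])
  qed
  show "smooth_on (\<phi> ` U) (\<lambda>y. deriv_fun X f (inv_into U \<phi> y))"
    unfolding smooth_on_def p_def[symmetric] using Ck_on_cong[OF oU eq Ck] by blast
qed

text \<open>
  The right action by \<open>h\<close> moves \<open>\<xi>\<close> at \<open>u\<close> to a vector at \<open>u h\<close> on which the Cartan connection takes the
  value \<open>Ad (h\<^sup>-\<^sup>1) (\<omega> \<xi>)\<close>, and \<open>f\<close> changes by the linear map \<open>h\<^sup>-\<^sup>1\<close> along this action.  So the derivative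
  is a function of the same kind as \<open>f\<close> and can be differentiated again.
\<close>

lemma deriv_fun_equivariant:
  fixes W :: "('a, 'w::real_normed_vector) rep"
  assumes W: "lin_rep P W" and f: "f \<in> equivariant_functions P X W"
  shows "deriv_fun X f \<in> equivariant_functions P X (hom_rep G W)"
proof -
  note f' = equivariant_functionsD[OF f] and ch = total_manifold(2)
  have mem: "deriv_fun X f u \<in> rspace (hom_rep G W)" if u: "u \<in> pts (total X)" for u
    unfolding hom_rep_space deriv_fun_apply[OF u f'(5)[OF u]]
    using smooth_map_linear_on(2)[OF f'(1) lin_repD(1,2)[OF W] _ f'(4) u, of "\<lambda>x. x"]
    by (simp add: linear_on_def)
  have "deriv_fun X f (pact X u h) = ract (hom_rep G W) (ginv G h) (deriv_fun X f u)"
    if u: "u \<in> pts (total X)" and h: "h \<in> gcarrier P" for u h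
  proof (rule blinfun_eqI)
    fix A
    note hi = P_closed(1)[OF h] and uh = pact_closed[OF u h]
    define \<xi> where "\<xi> = inv_into UNIV (cform X u) (Ad G h A)"
    define r where "r = (\<lambda>v. pact X v h)"
    have r: "diff_at (total X) (total X) r u"
      unfolding r_def by (rule smooth_map_diff_at[OF ch ch pact_smooth[OF h] u])
    have "cform X (pact X u h) (tangent_map (total X) (total X) r u \<xi>) = Ad G (ginv G h) (cform X u \<xi>)"
      unfolding r_def using cartan u h by (simp add: cartan_connection_def)
    also have "\<dots> = A" by (simp add: \<xi>_def cform_linear(4)[OF u] Ad_inv(2)[OF lie_G P_in_G[OF h]])
    finally have inv: "inv_into UNIV (cform X (pact X u h)) A = tangent_map (total X) (total X) r u \<xi>"
      using cform_linear(5)[OF uh] by metis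
    have fr: "diff_at (total X) vec_mfd f (r u)" unfolding r_def by (rule f'(5)[OF uh])
    note k = tangent_map_compose[OF ch ch r fr]
    have "tangent_map (total X) vec_mfd (\<lambda>v. ract W (ginv G h) (f v)) u =
        tangent_map (total X) vec_mfd (\<lambda>v. f (r v)) u"
      by (rule tangent_map_cong(2)[OF ch openin_topspace u _ k(1)]) (simp add: r_def f'(3)[OF _ h])
    then have "tangent_map (total X) vec_mfd f (r u) (tangent_map (total X) (total X) r u \<xi>) =
        ract W (ginv G h) (tangent_map (total X) vec_mfd f u \<xi>)"
      unfolding k(2)
      using smooth_map_linear_on(3)[OF f'(1) lin_repD(1,2)[OF W] lin_repD(3)[OF W hi] f'(4) u] by metis
    then show "blinfun_apply (deriv_fun X f (pact X u h)) A =
        blinfun_apply (ract (hom_rep G W) (ginv G h) (deriv_fun X f u)) A"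
      by (simp add: hom_rep_act[OF W hi mem[OF u]] deriv_fun_apply[OF uh f'(5)[OF uh]]
          deriv_fun_apply[OF u f'(5)[OF u]] inv P_closed(3)[OF h] \<xi>_def r_def)
  qed
  then show ?thesis
    using mem smooth_deriv_fun[OF f'(1)] P_facts(5) by (auto simp: equivariant_functions_def)
qed

end

context cartan_setting
begin

section \<open>Sections and equivariant functions\<close>

lemma topspace_models:
  "pts (prod_mfd M N) = pts M \<times> pts N" "pts (open_submfd M S) = pts M \<inter> S"
  by (simp_all add: prod_mfd_def open_submfd_def)

lemma smooth_map_pts: "smooth_map M N f \<Longrightarrow> x \<in> pts M \<Longrightarrow> f x \<in> pts N"
  by (auto simp: smooth_map_def continuous_map_def)

text \<open>
  The consequences of local triviality that are used: over \<open>U\<close> the bundle is \<open>U \<times> P\<close> as a set with a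
  right action of \<open>P\<close>.
\<close>

lemma trivialization:
  assumes x: "x \<in> pts (base X)"
  obtains U \<tau> where "x \<in> U" "U \<subseteq> pts (base X)"
    "\<And>y h. y \<in> U \<Longrightarrow> h \<in> gcarrier P \<Longrightarrow> \<tau> (y, h) \<in> pts (total X) \<and> proj X (\<tau> (y, h)) = y"
    "\<And>y h k. y \<in> U \<Longrightarrow> h \<in> gcarrier P \<Longrightarrow> k \<in> gcarrier P \<Longrightarrow>
      pact X (\<tau> (y, h)) k = \<tau> (y, gmult G h k)"
    "\<And>u. u \<in> pts (total X) \<Longrightarrow> proj X u \<in> U \<Longrightarrow> \<exists>h\<in>gcarrier P. u = \<tau> (proj X u, h)"
    "inj_on \<tau> (U \<times> gcarrier P)"
proof -
  obtain U \<tau> where U: "openin (mtop (base X)) U" "x \<in> U"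
    and dif: "diffeo (prod_mfd (open_submfd (base X) U) (gmfd P))
          (open_submfd (total X) {u \<in> pts (total X). proj X u \<in> U}) \<tau>"
    and act: "\<forall>y\<in>U. \<forall>h\<in>gcarrier P. proj X (\<tau> (y, h)) = y \<and>
           (\<forall>k\<in>gcarrier P. pact X (\<tau> (y, h)) k = \<tau> (y, gmult P h k))"
    using principal x unfolding principal_bundle_def by blast
  have UM: "U \<subseteq> pts (base X)" using openin_subset[OF U(1)] .
  let ?A = "prod_mfd (open_submfd (base X) U) (gmfd P)"
    and ?B = "open_submfd (total X) {u \<in> pts (total X). proj X u \<in> U}"
  have A: "pts ?A = U \<times> gcarrier P" using UM lie_groupD(4)[OF P_facts(1)] by (auto simp: topspace_models)
  have B: "pts ?B = {u \<in> pts (total X). proj X u \<in> U}" by (auto simp: topspace_models)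
  obtain g where \<tau>: "smooth_map ?A ?B \<tau>" and g: "smooth_map ?B ?A g"
    "\<forall>x\<in>pts ?A. g (\<tau> x) = x" "\<forall>y\<in>pts ?B. \<tau> (g y) = y"
    using dif unfolding diffeo_def by blast
  show thesis
  proof (rule that[OF U(2) UM, of \<tau>])
    show "\<tau> (y, h) \<in> pts (total X) \<and> proj X (\<tau> (y, h)) = y" if "y \<in> U" "h \<in> gcarrier P" for y h
      using smooth_map_pts[OF \<tau>, of "(y, h)"] that act unfolding A B by simp
    show "pact X (\<tau> (y, h)) k = \<tau> (y, gmult G h k)"
      if "y \<in> U" "h \<in> gcarrier P" "k \<in> gcarrier P" for y h k
      using act that unfolding P_facts(3) by blast
    show "\<exists>h\<in>gcarrier P. u = \<tau> (proj X u, h)" if u: "u \<in> pts (total X)" "proj X u \<in> U" for u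
    proof -
      have uB: "u \<in> pts ?B" using u B by simp
      obtain y h where yh: "g u = (y, h)" by fastforce
      have "y \<in> U" "h \<in> gcarrier P" using smooth_map_pts[OF g(1) uB] unfolding yh A by auto
      moreover have "\<tau> (y, h) = u" using g(3) uB yh by metis
      ultimately show ?thesis using act by metis
    qed
    show "inj_on \<tau> (U \<times> gcarrier P)" using g(2) unfolding A by (metis inj_on_inverseI)
  qed
qed

lemma proj_base: "u \<in> pts (total X) \<Longrightarrow> proj X u \<in> pts (base X)"
  using principal smooth_map_pts[of "total X" "base X" "proj X"] by (simp add: principal_bundle_def)

lemma proj_surj:
  assumes "x \<in> pts (base X)"
  obtains u where "u \<in> pts (total X)" "proj X u = x"
proof -
  have one: "gone G \<in> gcarrier P" using one_in_group[OF P_facts(1)] P_facts(4) by simp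
  show thesis
    by (rule trivialization[OF assms]) (use one that in blast)
qed

lemma pact_free:
  assumes u: "u \<in> pts (total X)" and h: "h \<in> gcarrier P" and "pact X u h = u"
  shows "h = gone G"
proof -
  interpret group "grp G" by (rule G_facts(1))
  obtain U \<tau> where U: "proj X u \<in> U" "U \<subseteq> pts (base X)"
    and val: "\<And>y h. y \<in> U \<Longrightarrow> h \<in> gcarrier P \<Longrightarrow> \<tau> (y, h) \<in> pts (total X) \<and> proj X (\<tau> (y, h)) = y"
    and act: "\<And>y h k. y \<in> U \<Longrightarrow> h \<in> gcarrier P \<Longrightarrow> k \<in> gcarrier P \<Longrightarrow>
      pact X (\<tau> (y, h)) k = \<tau> (y, gmult G h k)"
    and sur: "\<And>u. u \<in> pts (total X) \<Longrightarrow> proj X u \<in> U \<Longrightarrow> \<exists>h\<in>gcarrier P. u = \<tau> (proj X u, h)"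
    and inj: "inj_on \<tau> (U \<times> gcarrier P)"
    by (rule trivialization[OF proj_base[OF u]]) (rule that)
  obtain k where k: "k \<in> gcarrier P" "u = \<tau> (proj X u, k)" using sur[OF u U(1)] by blast
  have "\<tau> (proj X u, gmult G k h) = \<tau> (proj X u, k)" using act[OF U(1) k(1) h] k(2) assms(3) by metis
  then have "gmult G k h = k" using inj_onD[OF inj] U(1) k(1) h P_closed(2)[OF k(1) h] by blast
  then show ?thesis using P_in_G[OF h] P_in_G[OF k(1)] by (metis l_cancel_one)
qed

lemma pact_transitive:
  assumes u: "u \<in> pts (total X)" and v: "v \<in> pts (total X)" and eq: "proj X v = proj X u"
  obtains h where "h \<in> gcarrier P" "v = pact X u h"
proof -
  interpret group "grp G" by (rule G_facts(1))
  obtain U \<tau> where U: "proj X u \<in> U" "U \<subseteq> pts (base X)"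
    and val: "\<And>y h. y \<in> U \<Longrightarrow> h \<in> gcarrier P \<Longrightarrow> \<tau> (y, h) \<in> pts (total X) \<and> proj X (\<tau> (y, h)) = y"
    and act: "\<And>y h k. y \<in> U \<Longrightarrow> h \<in> gcarrier P \<Longrightarrow> k \<in> gcarrier P \<Longrightarrow>
      pact X (\<tau> (y, h)) k = \<tau> (y, gmult G h k)"
    and sur: "\<And>u. u \<in> pts (total X) \<Longrightarrow> proj X u \<in> U \<Longrightarrow> \<exists>h\<in>gcarrier P. u = \<tau> (proj X u, h)"
    and inj: "inj_on \<tau> (U \<times> gcarrier P)"
    by (rule trivialization[OF proj_base[OF u]]) (rule that)
  obtain k where k: "k \<in> gcarrier P" "u = \<tau> (proj X u, k)" using sur[OF u U(1)] by blast
  obtain l where l: "l \<in> gcarrier P" "v = \<tau> (proj X u, l)" using sur[OF v] U(1) eq by metis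
  define h where "h = gmult G (ginv G k) l"
  have h: "h \<in> gcarrier P" unfolding h_def by (rule P_closed(2)[OF P_closed(1)[OF k(1)] l(1)])
  have "gmult G k h = l" unfolding h_def using P_in_G[OF k(1)] P_in_G[OF l(1)]
    by (simp add: m_assoc[symmetric])
  then have "v = pact X u h" using act[OF U(1) k(1) h] k(2) l(2) by metis
  then show thesis using that h by blast
qed

lemma assoc_class_eq:
  "assoc_class P X W u w = {(pact X u h, ract W (ginv G h) w) | h. h \<in> gcarrier P}"
  unfolding assoc_class_def using P_facts(5) by (intro Collect_cong) metis

lemma assoc_class_subrep: "assoc_class P X (subrep W V) = assoc_class P X W"
  by (intro ext) (simp add: assoc_class_def)

lemma assoc_class_refl:
  assumes W: "lin_rep P W" and u: "u \<in> pts (total X)" and w: "w \<in> rspace W"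
  shows "(u, w) \<in> assoc_class P X W u w"
proof -
  interpret group "grp G" by (rule G_facts(1))
  have one: "gone G \<in> gcarrier P" using one_in_group[OF P_facts(1)] P_facts(4) by simp
  have "(pact X u (gone G), ract W (ginv G (gone G)) w) = (u, w)"
    using pact_one[OF u] lin_repD(5)[OF W w] P_facts(4) by simp
  then show ?thesis unfolding assoc_class_eq using one by (metis (mono_tags, lifting) mem_Collect_eq)
qed

text \<open>
  The action on the total space is free, so a class meets each fibre \<open>{u} \<times> W\<close> only once.  This is what
  makes the function of a section well defined.
\<close>

lemma assoc_class_fibre:
  assumes W: "lin_rep P W" and u: "u \<in> pts (total X)" and w: "w \<in> rspace W"
    and "(u, w') \<in> assoc_class P X W u w"
  shows "w' = w"
proof -
  interpret group "grp G" by (rule G_facts(1))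
  obtain h where h: "h \<in> gcarrier P" "u = pact X u h" "w' = ract W (ginv G h) w"
    using assms(4) unfolding assoc_class_eq by blast
  have "h = gone G" using pact_free[OF u h(1)] h(2) by simp
  then show ?thesis using h(3) lin_repD(5)[OF W w] P_facts(4) by simp
qed

lemma assoc_class_translate:
  assumes W: "lin_rep P W" and u: "u \<in> pts (total X)" and w: "w \<in> rspace W" and h: "h \<in> gcarrier P"
  shows "assoc_class P X W (pact X u h) (ract W (ginv G h) w) = assoc_class P X W u w"
proof -
  interpret group "grp G" by (rule G_facts(1))
  have step: "(pact X (pact X u h) k, ract W (ginv G k) (ract W (ginv G h) w)) =
      (pact X u (gmult G h k), ract W (ginv G (gmult G h k)) w)" if k: "k \<in> gcarrier P" for k
    using pact_mult[OF u h k] lin_repD(6)[OF W P_closed(1)[OF k] P_closed(1)[OF h] w]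
      inv_mult_group[OF P_in_G[OF h] P_in_G[OF k]] P_facts(3) by simp
  show ?thesis
  proof (intro subset_antisym subsetI)
    fix z assume "z \<in> assoc_class P X W (pact X u h) (ract W (ginv G h) w)"
    then obtain k where k: "k \<in> gcarrier P"
      "z = (pact X (pact X u h) k, ract W (ginv G k) (ract W (ginv G h) w))"
      unfolding assoc_class_eq by blast
    then show "z \<in> assoc_class P X W u w"
      unfolding assoc_class_eq step[OF k(1)] using P_closed(2)[OF h k(1)] by blast
  next
    fix z assume "z \<in> assoc_class P X W u w"
    then obtain l where l: "l \<in> gcarrier P" "z = (pact X u l, ract W (ginv G l) w)"
      unfolding assoc_class_eq by blast
    define k where "k = gmult G (ginv G h) l"
    have k: "k \<in> gcarrier P" unfolding k_def by (rule P_closed(2)[OF P_closed(1)[OF h] l(1)])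
    have "gmult G h k = l" unfolding k_def using P_in_G[OF h] P_in_G[OF l(1)]
      by (simp add: m_assoc[symmetric])
    then have "z = (pact X (pact X u h) k, ract W (ginv G k) (ract W (ginv G h) w))"
      using l(2) step[OF k] by simp
    then show "z \<in> assoc_class P X W (pact X u h) (ract W (ginv G h) w)"
      unfolding assoc_class_eq using k by blast
  qed
qed

lemma bundle_map_assoc_class:
  assumes \<Phi>: "equivariant_linear P W V \<Phi>" and w: "w \<in> rspace W"
  shows "bundle_map \<Phi> (assoc_class P X W u w) = assoc_class P X V u (\<Phi> w)"
proof -
  have eq: "\<Phi> (ract W (ginv G h) w) = ract V (ginv G h) (\<Phi> w)" if "h \<in> gcarrier P" for h
    using equivariant_linearD(3)[OF \<Phi> P_closed(1)[OF that] w] .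
  show ?thesis
    unfolding bundle_map_def assoc_class_eq
    by (auto simp: eq) (metis eq)+
qed

text \<open>
  A relation and not a function of \<open>\<sigma>\<close>, because \<open>f\<close> is determined on the total space only, and
  neither \<open>f\<close> nor \<open>\<sigma>\<close> is controlled elsewhere.
\<close>

definition section_from :: "('a, 'w) rep \<Rightarrow> ('m \<Rightarrow> ('u \<times> 'w) set) \<Rightarrow> ('u \<Rightarrow> 'w) \<Rightarrow> bool" where
  "section_from W \<sigma> f \<longleftrightarrow> (\<forall>u\<in>pts (total X). \<sigma> (proj X u) = assoc_class P X W u (f u))"

lemma sections_iff: "\<sigma> \<in> sections P X W \<longleftrightarrow> (\<exists>f\<in>equivariant_functions P X W. section_from W \<sigma> f)"
  by (simp add: sections_def section_from_def)

lemma fun_of_section: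
  assumes W: "lin_rep P W" and f: "f \<in> equivariant_functions P X W" and \<sigma>: "section_from W \<sigma> f"
    and u: "u \<in> pts (total X)"
  shows "fun_of_section X W \<sigma> u = f u"
proof -
  note fu = equivariant_functionsD(2)[OF f u]
  have "\<sigma> (proj X u) = assoc_class P X W u (f u)" using \<sigma> u by (simp add: section_from_def)
  then show ?thesis unfolding fun_of_section_def
    using assoc_class_refl[OF W u fu] assoc_class_fibre[OF W u fu] fu by (intro the_equality) auto
qed

text \<open>
  The value of \<open>section_of_fun\<close> is computed at some point of the fibre; equivariance makes the choice
  of the point irrelevant.  The function \<open>g\<close> agrees with \<open>f\<close> on the total space only, as the function
  recovered from a section does.
\<close>

lemma section_of_fun:
  assumes W: "lin_rep P W" and f: "f \<in> equivariant_functions P X W"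
    and g: "\<And>u. u \<in> pts (total X) \<Longrightarrow> g u = f u"
  shows "section_from W (section_of_fun P X W g) f"
  unfolding section_from_def
proof
  fix u assume u: "u \<in> pts (total X)"
  define v where "v = (SOME v. v \<in> pts (total X) \<and> proj X v = proj X u)"
  have v: "v \<in> pts (total X) \<and> proj X v = proj X u"
    unfolding v_def by (rule someI[of _ u]) (use u in simp)
  obtain h where h: "h \<in> gcarrier P" "v = pact X u h" using pact_transitive[OF u] v by blast
  have "section_of_fun P X W g (proj X u) = assoc_class P X W v (f v)"
    unfolding section_of_fun_def v_def[symmetric] Let_def using g v by simp
  also have "\<dots> = assoc_class P X W u (f u)"
    unfolding h(2) equivariant_functionsD(3)[OF f u h(1)]
    by (rule assoc_class_translate[OF W u equivariant_functionsD(2)[OF f u] h(1)])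
  finally show "section_of_fun P X W g (proj X u) = assoc_class P X W u (f u)" .
qed

text \<open>
  On equivariant functions the fundamental derivative is \<open>deriv_fun\<close>.
\<close>

lemma fundamental_derivative_from:
  fixes W :: "('a, 'w::real_normed_vector) rep"
  assumes W: "lin_rep P W" and f: "f \<in> equivariant_functions P X W" and \<sigma>: "section_from W \<sigma> f"
  shows "section_from (hom_rep G W) (fundamental_derivative G P X W \<sigma>) (deriv_fun X f)"
  unfolding fundamental_derivative_def
proof (rule section_of_fun[OF lin_rep_hom_rep[OF W] deriv_fun_equivariant[OF W f]])
  show "deriv_fun X (fun_of_section X W \<sigma>) u = deriv_fun X f u" if "u \<in> pts (total X)" for u
    by (rule deriv_fun_cong[OF _ equivariant_functionsD(5)[OF f that] that])
      (simp add: fun_of_section[OF W f \<sigma>])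
qed


section \<open>The curved Casimir operator on equivariant functions\<close>

text \<open>
  Invariance of the Killing form under the adjoint action of \<open>P\<close>: this is why the Casimir operator
  maps sections to sections.
\<close>

lemma equivariant_contraction:
  fixes W :: "('a, 'w::real_normed_vector) rep"
  assumes W: "lin_rep P W"
  shows "equivariant_linear P (hom_rep G (hom_rep G W)) W (metric_contraction (killing_form G))"
proof -
  let ?b = "killing_form G"
  note HW = lin_rep_hom_rep[OF W] and HHW = lin_rep_hom_rep[OF lin_rep_hom_rep[OF W]]
  note kf = killing_form_symmetric_bilinear[OF lie_G]
  note bl = bounded_linear.linear[OF bounded_linear_metric_contraction]
  have sp: "blinfun_apply (blinfun_apply T A) B \<in> rspace W"
    if "T \<in> rspace (hom_rep G (hom_rep G W))" for T A B
    using that by (simp add: hom_rep_space)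
  have mem: "metric_contraction ?b T \<in> rspace W" if "T \<in> rspace (hom_rep G (hom_rep G W))" for T
    by (rule metric_contraction_linear_on(1)[OF lin_repD(1)[OF W] _ sp[OF that],
          of "\<lambda>w. w" T]) (simp_all add: linear_on_def)
  have equ: "metric_contraction ?b (ract (hom_rep G (hom_rep G W)) h T) = ract W h (metric_contraction ?b T)"
    if h: "h \<in> gcarrier P" and T: "T \<in> rspace (hom_rep G (hom_rep G W))" for h T
  proof -
    define g where "g = Ad G (ginv G h)"
    note hi = P_in_G[OF P_closed(1)[OF h]]
    have lg: "linear g" unfolding g_def by (rule linear_Ad[OF lie_G hi])
    have gb: "blinfun_apply (Blinfun g) = g"
      by (rule bounded_linear_Blinfun_apply[OF linear_imp_bounded_linear_finite_dim[OF fd_g lg]])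
    have "linear (\<lambda>A. T (g A) o\<^sub>L Blinfun g)"
      by (rule linearI; rule blinfun_eqI)
        (simp_all add: linear_add[OF lg] linear_cmul[OF lg] blinfun.add_right blinfun.scaleR_right
          blinfun.add_left blinfun.scaleR_left)
    from bounded_linear_Blinfun_apply[OF linear_imp_bounded_linear_finite_dim[OF fd_g this]]
    have T2: "blinfun_apply (Blinfun (\<lambda>A. T (g A) o\<^sub>L Blinfun g)) A B = T (g A) (g B)" for A B
      by (simp add: gb)
    have act: "ract (hom_rep G (hom_rep G W)) h T A B = ract W h (T (g A) (g B))" for A B
    proof -
      have "T (g A) \<in> rspace (hom_rep G W)" using T by (simp add: hom_rep_space)
      then show ?thesis unfolding hom_rep_act[OF HW h T] g_def by (rule hom_rep_act[OF W h])
    qed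
    have "metric_contraction ?b (ract (hom_rep G (hom_rep G W)) h T) =
        ract W h (metric_contraction ?b (Blinfun (\<lambda>A. T (g A) o\<^sub>L Blinfun g)))"
      by (rule metric_contraction_linear_on(2)[OF lin_repD(1)[OF W] lin_repD(3)[OF W h]])
        (simp_all add: T2 act sp[OF T])
    also have "metric_contraction ?b (Blinfun (\<lambda>A. T (g A) o\<^sub>L Blinfun g)) = metric_contraction ?b T"
      by (rule metric_contraction_invariant[OF fd_g kf lg, where g' = "Ad G h"])
        (simp_all add: T2 killing_form_Ad[OF lie_G hi, folded g_def]
          Ad_inv(2)[OF lie_G P_in_G[OF h], folded g_def])
    finally show ?thesis .
  qed
  show ?thesis
    unfolding equivariant_linear_def linear_on_def
    using mem equ by (auto simp: linear_add[OF bl] linear_cmul[OF bl])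
qed

text \<open>
  The curved Casimir operator, seen on equivariant functions.
\<close>

definition casimir_fun :: "('u \<Rightarrow> 'w::real_normed_vector) \<Rightarrow> 'u \<Rightarrow> 'w" where
  "casimir_fun f u = metric_contraction (killing_form G) (deriv_fun X (deriv_fun X f) u)"

lemma casimir_fun_equivariant:
  fixes W :: "('a, 'w::real_normed_vector) rep"
  assumes W: "lin_rep P W" and f: "f \<in> equivariant_functions P X W"
  shows "casimir_fun f \<in> equivariant_functions P X W"
  using equivariant_functions_map[OF lin_rep_hom_rep[OF lin_rep_hom_rep[OF W]]
      equivariant_contraction[OF W]
      deriv_fun_equivariant[OF lin_rep_hom_rep[OF W] deriv_fun_equivariant[OF W f]]]
  by (simp add: casimir_fun_def[abs_def])

lemma curved_casimir_from:
  fixes W :: "('a, 'w::real_normed_vector) rep"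
  assumes W: "lin_rep P W" and f: "f \<in> equivariant_functions P X W" and \<sigma>: "section_from W \<sigma> f"
  shows "section_from W (curved_casimir G P X W \<sigma>) (casimir_fun f)"
  unfolding section_from_def
proof
  fix u assume u: "u \<in> pts (total X)"
  note HW = lin_rep_hom_rep[OF W] and Df = deriv_fun_equivariant[OF W f]
  note DDf = deriv_fun_equivariant[OF HW Df]
  have "fundamental_derivative G P X (hom_rep G W) (fundamental_derivative G P X W \<sigma>) (proj X u) =
      assoc_class P X (hom_rep G (hom_rep G W)) u (deriv_fun X (deriv_fun X f) u)"
    using fundamental_derivative_from[OF HW Df fundamental_derivative_from[OF W f \<sigma>]] u
    by (simp add: section_from_def)
  then show "curved_casimir G P X W \<sigma> (proj X u) = assoc_class P X W u (casimir_fun f u)"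
    by (simp add: curved_casimir_def casimir_fun_def
        bundle_map_assoc_class[OF equivariant_contraction[OF W] equivariant_functionsD(2)[OF DDf u]])
qed

text \<open>
  The fundamental derivative is natural, which turns \<open>\<Phi>\<close> into \<open>hom_map (hom_map \<Phi>)\<close> after two
  steps, and the contraction is taken in the arguments only.
\<close>

lemma casimir_fun_map:
  fixes W :: "('a, 'w::real_normed_vector) rep" and V :: "('a, 'v::real_normed_vector) rep"
  assumes W: "lin_rep P W" and V: "lin_rep P V" and \<Phi>: "equivariant_linear P W V \<Phi>"
    and f: "f \<in> equivariant_functions P X W" and u: "u \<in> pts (total X)"
  shows "casimir_fun (\<lambda>u. \<Phi> (f u)) u = \<Phi> (casimir_fun f u)"
proof -
  note HW = lin_rep_hom_rep[OF W] and HV = lin_rep_hom_rep[OF V]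
  note Df = deriv_fun_equivariant[OF W f]
  note DDf = equivariant_functionsD(2)[OF deriv_fun_equivariant[OF HW Df] u]
  note H\<Phi> = equivariant_linear_hom_map[OF W V \<Phi>]
  note HH\<Phi> = equivariant_linear_hom_map[OF HW HV H\<Phi>(1)]
  have "deriv_fun X (deriv_fun X (\<lambda>u. \<Phi> (f u))) u =
      deriv_fun X (\<lambda>u. hom_map \<Phi> (deriv_fun X f u)) u"
    by (rule deriv_fun_cong[OF _ equivariant_functionsD(5)[OF equivariant_functions_map[OF HW H\<Phi>(1) Df] u] u])
      (simp add: deriv_fun_map[OF W V \<Phi> f])
  also have "\<dots> = hom_map (hom_map \<Phi>) (deriv_fun X (deriv_fun X f) u)"
    by (rule deriv_fun_map[OF HW HV H\<Phi>(1) Df u])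
  finally have eq: "deriv_fun X (deriv_fun X (\<lambda>u. \<Phi> (f u))) u =
      hom_map (hom_map \<Phi>) (deriv_fun X (deriv_fun X f) u)" .
  have DDf1: "blinfun_apply (deriv_fun X (deriv_fun X f) u) A \<in> rspace (hom_rep G W)" for A
    using DDf by (simp add: hom_rep_space)
  show ?thesis unfolding casimir_fun_def eq
    by (rule metric_contraction_linear_on(2)[OF lin_repD(1)[OF W] equivariant_linearD(1)[OF \<Phi>]])
      (use DDf1[unfolded hom_rep_space] in \<open>simp_all add: HH\<Phi>(2)[OF DDf] H\<Phi>(2)[OF DDf1]\<close>)
qed

lemma section_from_map:
  assumes \<Phi>: "equivariant_linear P W V \<Phi>"
    and f: "f \<in> equivariant_functions P X W" and \<sigma>: "section_from W \<sigma> f"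
  shows "section_from V (\<lambda>x. bundle_map \<Phi> (\<sigma> x)) (\<lambda>u. \<Phi> (f u))"
  using \<sigma> bundle_map_assoc_class[OF \<Phi> equivariant_functionsD(2)[OF f]]
  by (simp add: section_from_def)

lemma section_from_eqD:
  assumes "section_from W \<sigma> f" "section_from V \<tau> g"
    and "\<And>u. u \<in> pts (total X) \<Longrightarrow> assoc_class P X W u (f u) = assoc_class P X V u (g u)"
    and "x \<in> pts (base X)"
  shows "\<sigma> x = \<tau> x"
  using proj_surj[OF assms(4)] assms(1-3) unfolding section_from_def by metis

text \<open>The last hypothesis allows \<open>\<tau>\<close> to differ from the image of \<open>\<sigma>\<close> outside the base.\<close>

lemma curved_casimir_natural:
  fixes W :: "('a, 'w::real_normed_vector) rep" and V :: "('a, 'v::real_normed_vector) rep"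
  assumes W: "lin_rep P W" and V: "lin_rep P V" and \<Phi>: "equivariant_linear P W V \<Phi>"
    and \<sigma>: "\<sigma> \<in> sections P X W" and \<tau>: "\<And>x. x \<in> pts (base X) \<Longrightarrow> bundle_map \<Phi> (\<sigma> x) = \<tau> x"
  shows "\<tau> \<in> sections P X V"
    "x \<in> pts (base X) \<Longrightarrow> curved_casimir G P X V \<tau> x = bundle_map \<Phi> (curved_casimir G P X W \<sigma> x)"
proof -
  obtain f where f: "f \<in> equivariant_functions P X W" "section_from W \<sigma> f"
    using \<sigma> sections_iff by blast
  note \<Phi>f = equivariant_functions_map[OF W \<Phi> f(1)]
  have \<tau>f: "section_from V \<tau> (\<lambda>u. \<Phi> (f u))"
    using section_from_map[OF \<Phi> f] \<tau> proj_base by (simp add: section_from_def)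
  then show "\<tau> \<in> sections P X V" using \<Phi>f sections_iff by blast
  show "curved_casimir G P X V \<tau> x = bundle_map \<Phi> (curved_casimir G P X W \<sigma> x)"
    if "x \<in> pts (base X)"
    by (rule section_from_eqD[OF curved_casimir_from[OF V \<Phi>f \<tau>f]
          section_from_map[OF \<Phi> casimir_fun_equivariant[OF W f(1)] curved_casimir_from[OF W f]] _ that])
      (simp add: casimir_fun_map[OF W V \<Phi> f(1)])
qed

text \<open>
  A section of the bundle of \<open>W\<close> with values in the subbundle has an equivariant function with values
  in \<open>V\<close>: the class of \<open>(v, w)\<close> with \<open>w \<in> V\<close> consists of pairs with second component in \<open>V\<close>.
\<close>

lemma section_of_subbundle:
  assumes W: "lin_rep P W" and V: "invariant_subspace P W V"
    and f: "f \<in> equivariant_functions P X W" and \<sigma>: "section_from W \<sigma> f"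
    and sub: "\<forall>x \<in> pts (base X). \<sigma> x \<in> natural_bundle P X (subrep W V)"
  shows "f \<in> equivariant_functions P X (subrep W V)" "section_from (subrep W V) \<sigma> f"
proof -
  have "f u \<in> V" if u: "u \<in> pts (total X)" for u
  proof -
    have "\<sigma> (proj X u) \<in> natural_bundle P X (subrep W V)" using sub proj_base[OF u] by blast
    then obtain v w where vw: "w \<in> V" "\<sigma> (proj X u) = assoc_class P X W v w"
      unfolding natural_bundle_def assoc_class_subrep by auto
    have "(u, f u) \<in> \<sigma> (proj X u)"
      using \<sigma> u assoc_class_refl[OF W u equivariant_functionsD(2)[OF f u]]
      by (simp add: section_from_def)
    then obtain h where h: "h \<in> gcarrier P" "f u = ract W (ginv G h) w"
      unfolding vw(2) assoc_class_eq by blast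
    then show ?thesis using V vw(1) P_closed(1)[OF h(1)] unfolding invariant_subspace_def by blast
  qed
  then show "f \<in> equivariant_functions P X (subrep W V)"
    using f by (auto simp: equivariant_functions_def)
  show "section_from (subrep W V) \<sigma> f" using \<sigma> by (simp add: section_from_def assoc_class_subrep)
qed

text \<open>
  Over \<open>W\<close> and over the subrepresentation both the classes and the Casimir operator on functions are
  literally the same, so one and the same equivariant function represents both sides.
\<close>

lemma curved_casimir_subbundle:
  fixes W :: "('a, 'w::real_normed_vector) rep"
  assumes W: "lin_rep P W" and V: "invariant_subspace P W V" and \<sigma>: "\<sigma> \<in> sections P X W"
    and sub: "\<forall>x \<in> pts (base X). \<sigma> x \<in> natural_bundle P X (subrep W V)"
  shows "\<sigma> \<in> sections P X (subrep W V)"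
    "curved_casimir G P X W \<sigma> \<in> sections P X (subrep W V)"
    "x \<in> pts (base X) \<Longrightarrow> curved_casimir G P X W \<sigma> x = curved_casimir G P X (subrep W V) \<sigma> x"
proof -
  obtain f where f: "f \<in> equivariant_functions P X W" "section_from W \<sigma> f"
    using \<sigma> sections_iff by blast
  note WV = lin_rep_subrep[OF W V]
  note f' = section_of_subbundle[OF W V f sub]
  note C = curved_casimir_from[OF W f] and C' = curved_casimir_from[OF WV f']
  show "\<sigma> \<in> sections P X (subrep W V)" using f' sections_iff by blast
  have "section_from (subrep W V) (curved_casimir G P X W \<sigma>) (casimir_fun f)"
    using C by (simp add: section_from_def assoc_class_subrep)
  then show "curved_casimir G P X W \<sigma> \<in> sections P X (subrep W V)"
    using casimir_fun_equivariant[OF WV f'(1)] sections_iff by blast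
  show "curved_casimir G P X W \<sigma> x = curved_casimir G P X (subrep W V) \<sigma> x" if "x \<in> pts (base X)"
    by (rule section_from_eqD[OF C C' _ that]) (simp add: assoc_class_subrep)
qed

end

theorem proposition2:
  fixes G :: "('a, 'g::real_normed_vector) lgroup"
    and P :: "('a, 'p::real_normed_vector) lgroup"
    and X :: "('u, 'e::real_normed_vector, 'm, 'b::real_normed_vector, 'a, 'g) geometry"
    and W :: "('a, 'w::real_normed_vector) rep"
    and W' :: "('a, 'v::real_normed_vector) rep"
    and \<Phi> :: "'w \<Rightarrow> 'v"
  assumes "semisimple_lie_group G" and "parabolic_subgroup G P"
    and "representation_of P W" and "representation_of P W'"
    and "equivariant_linear P W W' \<Phi>"
    and "parabolic_geometry G P X"
  shows "(\<forall>\<sigma> \<in> sections P X W.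
            (\<lambda>x. bundle_map \<Phi> (\<sigma> x)) \<in> sections P X W' \<and>
            (\<forall>x \<in> pts (base X).
               curved_casimir G P X W' (\<lambda>x. bundle_map \<Phi> (\<sigma> x)) x =
               bundle_map \<Phi> (curved_casimir G P X W \<sigma> x))) \<and>
         (\<forall>V. invariant_subspace P W V \<longrightarrow>
            (\<forall>\<sigma> \<in> sections P X W.
               (\<forall>x \<in> pts (base X). \<sigma> x \<in> natural_bundle P X (subrep W V)) \<longrightarrow>
               \<sigma> \<in> sections P X (subrep W V) \<and>
               curved_casimir G P X W \<sigma> \<in> sections P X (subrep W V) \<and>
               (\<forall>x \<in> pts (base X).
                  curved_casimir G P X W \<sigma> x = curved_casimir G P X (subrep W V) \<sigma> x))) \<and>
         (\<forall>V (Q :: ('a, 'q::real_normed_vector) rep) q.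
            invariant_subspace P W V \<and> quotient_rep P W V Q q \<longrightarrow>
            (\<forall>\<sigma> \<in> sections P X W. \<forall>\<tau> \<in> sections P X Q.
               (\<forall>x \<in> pts (base X). bundle_map q (\<sigma> x) = \<tau> x) \<longrightarrow>
               (\<forall>x \<in> pts (base X).
                  curved_casimir G P X Q \<tau> x = bundle_map q (curved_casimir G P X W \<sigma> x))))"
proof -
  interpret cartan_setting G P X
    using assms by unfold_locales
      (auto simp: semisimple_lie_group_def parabolic_subgroup_def parabolic_geometry_def)
  note W = representation_of_lin_rep[OF assms(3)] and W' = representation_of_lin_rep[OF assms(4)]
  show ?thesis
  proof (intro conjI allI ballI impI)
    fix \<sigma> assume \<sigma>: "\<sigma> \<in> sections P X W"
    show "(\<lambda>x. bundle_map \<Phi> (\<sigma> x)) \<in> sections P X W'"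
      by (rule curved_casimir_natural(1)[OF W W' assms(5) \<sigma> refl])
    show "curved_casimir G P X W' (\<lambda>x. bundle_map \<Phi> (\<sigma> x)) x =
        bundle_map \<Phi> (curved_casimir G P X W \<sigma> x)" if "x \<in> pts (base X)" for x
      by (rule curved_casimir_natural(2)[OF W W' assms(5) \<sigma> refl that])
  next
    fix V \<sigma> assume V: "invariant_subspace P W V" and \<sigma>: "\<sigma> \<in> sections P X W"
      and sub: "\<forall>x \<in> pts (base X). \<sigma> x \<in> natural_bundle P X (subrep W V)"
    show "\<sigma> \<in> sections P X (subrep W V)" "curved_casimir G P X W \<sigma> \<in> sections P X (subrep W V)"
      by (rule curved_casimir_subbundle[OF W V \<sigma> sub])+
    show "curved_casimir G P X W \<sigma> x = curved_casimir G P X (subrep W V) \<sigma> x"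
      if "x \<in> pts (base X)" for x
      by (rule curved_casimir_subbundle(3)[OF W V \<sigma> sub that])
  next
    fix V and Q :: "('a, 'q) rep" and q \<sigma> \<tau> x
    assume "invariant_subspace P W V \<and> quotient_rep P W V Q q" and \<sigma>: "\<sigma> \<in> sections P X W"
      and \<tau>: "\<forall>x \<in> pts (base X). bundle_map q (\<sigma> x) = \<tau> x" and x: "x \<in> pts (base X)"
    then have "lin_rep P Q" "equivariant_linear P W Q q"
      by (auto simp: quotient_rep_def intro: representation_of_lin_rep)
    then show "curved_casimir G P X Q \<tau> x = bundle_map q (curved_casimir G P X W \<sigma> x)"
      using curved_casimir_natural(2)[OF W _ _ \<sigma> _ x] \<tau> by blast
  qed
qed

end
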